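(* Assume (H), (A1), (A2), (A3), (A4), (A5) and (A11)(I) from the context, that $\psi_p$ is sequentially consistent on $\mathcal U_p$, and that $x^\star$ is the unique solution of the primal problem (i.e. $\mathcal S_P=\{x^\star\}$). If the sublevel sets of $D_{\psi_p}(x^\star,\cdot)$ are bounded, then the sequence $(x_k)$ converges strongly to $x^\star$ almost surely. Furthermore, if in addition (A11)(II) holds, $\mu^\star$ is the unique solution of the dual problem (i.e. $\mathcal S_D=\{\mu^\star\}$), $\psi_d$ is sequentially consistent on $\mathcal U_d$, and the sublevel sets of $D_{\psi_d}(\mu^\star,\cdot)$ are bounded, then almost surely the sequence $(w_k)$ converges strongly to the saddle point $w^\star=(x^\star,\mu^\star)$.
   Context: Problem and assumption (H). $\mathcal X_p,\mathcal X_d$ are real reflexive Banach spaces with topological duals $\mathcal X_p^*,\mathcal X_d^*$ and duality pairing $\langle\cdot,\cdot\rangle$. $\Gamma_0(\mathcal X)$ is the set of proper convex lower semicontinuous functions $\mathcal X\to\mathbb R\cup\{+\infty\}$; $\partial$ is the convex subdifferential, differentiability and gradients are in the Gâteaux sense, $\iota_{\mathcal C}$ is the indicator function of $\mathcal C$, $\operatorname{int}$ is the interior, a superscript $*$ on a function is the Fenchel conjugate. (H): $\mathcal C_p\subset\mathcal X_p$, $\mathcal C_d\subset\mathcal X_d$ are nonempty closed convex; $f,g\in\Gamma_0(\mathcal X_p)$; $h,l\in\Gamma_0(\mathcal X_d^* )$ (so $h^*,l^*\in\Gamma_0(\mathcal X_d)$); $\mathcal C_p\subset\operatorname{dom}(f)$,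 $\mathcal C_d\subset\operatorname{dom}(h^* )$, $f$ is differentiable on $\operatorname{int}\mathcal C_p$ and $h^*$ on $\operatorname{int}\mathcal C_d$; $\mathcal C_p\cap\operatorname{dom}(g)\ne\emptyset$, $\mathcal C_d\cap\operatorname{dom}(l^* )\neq\emptyset$; $T:\mathcal X_p\to\mathcal X_d^*$ is linear and continuous; the set of saddle points of $$\mathcal L(x,\mu)=f(x)+g(x)+\iota_{\mathcal C_p}(x)+\langle Tx,\mu\rangle-h^*(\mu)-l^*(\mu)-\iota_{\mathcal C_d}(\mu)$$ is nonempty, where $(x^\star,\mu^\star)$ is a saddle point if $\mathcal L(x^\star,\mu)\le\mathcal L(x^\star,\mu^\star)\le\mathcal L(x,\mu^\star)$ for all $(x,\mu)\in\mathcal X_p\times\mathcal X_d$. The primal and dual solution sets are $$\mathcal S_P=\operatorname*{argmin}_{x\in\mathcal C_p}\max_{\mu\in\mathcal C_d}\{f(x)+g(x)+\langle Tx,\mu\rangle-h^*(\mu)-l^*(\mu)\},$$ $$\mathcal S_D=\operatorname*{argmax}_{\mu\in\mathcal C_d}\min_{x\in\mathcal C_p}\{f(x)+g(x)+\langle Tx,\mu\rangle-h^*(\mu)-l^*(\mu)\};$$ every saddle point lies in $\mathcal S_P\times\mathcal S_D$. Bregman divergences. For $\phi$ differentiable on $\operatorname{int}\operatorname{dom}(\phi)$, $D_\phi(x,y)=\phi(x)-\phi(y)-\langle\nabla\phi(y),x-y\rangle$ if $x\in\operatorname{dom}(\phi)$, $y\in\operatorname{int}\operatorname{dom}(\phi)$,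 and $+\infty$ otherwise. A function $F$ is $L$-smooth with respect to $\phi$ if $F$ is differentiable on $\operatorname{int}\operatorname{dom}(\phi)$ and $L\phi-F$ is convex there. For a nonempty closed convex $\mathcal C\subset\operatorname{dom}(F)\cap\operatorname{dom}(\phi)$, $F$ is $m$-strongly convex on $\mathcal C$ with respect to $\phi$ if $F(x)-F(y)-\langle u,x-y\rangle\ge mD_\phi(x,y)$ for all $x\in\mathcal C$, $y\in\operatorname{int}\operatorname{dom}(\phi)\cap\operatorname{dom}(\partial F)\cap\mathcal C$ and $u\in\partial F(y)$. For two entropies $\phi_p,\phi_d$ put $D_p=D_{\phi_p}$, $D_d=D_{\phi_d}$. Set $\mathcal U_p=\operatorname{int}\operatorname{dom}(\phi_p)\cap\operatorname{dom}(\partial g)$, $\mathcal U_d=\operatorname{int}\operatorname{dom}(\phi_d)\cap\operatorname{dom}(\partial l^* )$, $\tilde{\mathcal U}_p=\operatorname{dom}(\phi_p)\cap\operatorname{dom}(\partial g)$, $\tilde{\mathcal U}_d=\operatorname{dom}(\phi_d)\cap\operatorname{dom}(\partial l^* )$. Sequential consistency. For an entropy $\psi$ on $\mathcal X$, $x\in\operatorname{int}\operatorname{dom}(\psi)$, $t\ge0$, let $\Theta_\psi(x,t)=\inf\{D_\psi(x',x):\|x-x'\|_{\mathcal X}=t\}$. $\psi$ is sequentially consistent on $X\subseteq\operatorname{int}\operatorname{dom}(\psi)$ if $\inf_{x\in V}\Theta_\psi(x,t)>0$ for every bounded $V\subseteq X$ and every $t>0$. Algorithm (SBPD). Let $\lambda_k,\nu_k>0$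 be step sizes, $\delta^p_k,\delta^d_k$ ($k\in\mathbb N=\{0,1,\dots\}$) random variables on a probability space $(\Omega,\mathcal F,\mathbb P)$ with values in $\mathcal X_p^*,\mathcal X_d^*$, and $w_0=(x_0,\mu_0)\in\mathcal U_p\times\mathcal U_d$ deterministic. For $k=0,1,\dots$, $$x_{k+1}=\operatorname*{argmin}_{x\in\mathcal C_p}\Big\{g(x)+\langle\nabla f(x_k)+\delta^p_k,x\rangle+\langle Tx,\mu_k\rangle+\tfrac1{\lambda_k}D_p(x,x_k)\Big\},$$ $$\mu_{k+1}=\operatorname*{argmin}_{\mu\in\mathcal C_d}\Big\{l^*(\mu)+\langle\nabla h^*(\mu_k)+\delta^d_k,\mu\rangle-\langle T(2x_{k+1}-x_k),\mu\rangle+\tfrac1{\nu_k}D_d(\mu,\mu_k)\Big\}.$$ Write $w_k=(x_k,\mu_k)$. Let $\mathcal F_k=\sigma(w_0,\dots,w_k)$ and $\mathfrak F=(\mathcal F_k)_k$. $\ell^1_+$ is the set of nonnegative summable real sequences, and $\ell^1_+(\mathfrak F)$ the set of sequences $(a_k)$ of $[0,+\infty)$-valued random variables with $a_k$ $\mathcal F_k$-measurable and $\sum_k a_k<+\infty$ a.s. All relations between random quantities hold $\mathbb P$-a.s. Notation. For $w_i=(x_i,\mu_i)$: $(\frac1{\Lambda_\infty}-L)D(w_1,w_2)=(\frac1{\lambda_\infty}-L_p)D_p(x_1,x_2)+(\frac1{\nu_\infty}-L_d)D_d(\mu_1,\mu_2)$, $M(w_1,w_2)=\langle T(x_1-x_2),\mu_1-\mu_2\rangle$.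 (A1) $\phi_p\in\Gamma_0(\mathcal X_p)$, $\phi_d\in\Gamma_0(\mathcal X_d)$ are differentiable on the interiors of their domains, $\operatorname{dom}(\phi_p)=\mathcal C_p$, $\operatorname{dom}(\phi_d)=\mathcal C_d$; $f$ is $L_p$-smooth with respect to $\phi_p$ and $h^*$ is $L_d$-smooth with respect to $\phi_d$; the mappings $(\nabla\phi_p+\lambda_k\partial g)^{-1}$ and $(\nabla\phi_d+\nu_k\partial l^* )^{-1}$ are nonempty and single-valued, with values in $\operatorname{int}\operatorname{dom}(\phi_p)$ and $\operatorname{int}\operatorname{dom}(\phi_d)$ respectively, at the dual points where the algorithm (with or without errors) evaluates them, so that the iterates are uniquely defined and stay in $\operatorname{int}\operatorname{dom}(\phi_p)\times\operatorname{int}\operatorname{dom}(\phi_d)$. (A2) $(\lambda_k)$, $(\nu_k)$ are positive, nondecreasing, bounded above, with limits $\lambda_\infty,\nu_\infty$. (A3) (A2) holds and there are a function $d:(\mathcal X_p\times\mathcal X_d)^2\to\mathbb R_+$ and $\varepsilon\ge0$ with $$\inf_{w_1\in\tilde{\mathcal U}_p\times\tilde{\mathcal U}_d,\ w_2\in\mathcal U_p\times\mathcal U_d,\ w_1\ne w_2}\frac{(\frac1{\Lambda_\infty}-L)D(w_1,w_2)-M(w_1,w_2)}{d(w_1,w_2)}\ge\varepsilon.$$ (A4) $\mathbb E[\delta^p_k\mid\mathcal F_k]=0$ and $\mathbb E[\delta^d_k\mid\mathcal F_k]=0$ for all $k$. (A5) One of the following holds. (I) $\delta^p_k=0$, $\delta^d_k=0$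 a.s. for all $k$. (II) $(\mathbb E[\|\delta^p_k\|_{\mathcal X_p^*}\mid\mathcal F_k])_k,(\mathbb E[\|\delta^d_k\|_{\mathcal X_d^*}\mid\mathcal F_k])_k\in\ell^1_+(\mathfrak F)$, $(\mathbb E\|\delta^p_k\|_{\mathcal X_p^*})_k,(\mathbb E\|\delta^d_k\|_{\mathcal X_d^*})_k\in\ell^1_+$, and $\mathcal U_p,\mathcal U_d$ are bounded with positive diameter. (III) $\phi_p,\phi_d$ are strongly convex with moduli $\sigma_p,\sigma_d>0$ with respect to the squared norms, i.e. $D_p(x,y)\ge\frac{\sigma_p}2\|x-y\|_{\mathcal X_p}^2$ and $D_d(\mu,\eta)\ge\frac{\sigma_d}2\|\mu-\eta\|_{\mathcal X_d}^2$; (A2) holds with $\nu_\infty\lambda_\infty<\sigma_p\sigma_d/\|T\|^2$, $\|T\|$ being the operator norm from $\mathcal X_p$ to $\mathcal X_d^*$; and $(\mathbb E[\|\delta^p_k\|^2_{\mathcal X_p^*}\mid\mathcal F_k])_k,(\mathbb E[\|\delta^d_k\|^2_{\mathcal X_d^*}\mid\mathcal F_k])_k\in\ell^1_+(\mathfrak F)$, $(\mathbb E\|\delta^p_k\|^2_{\mathcal X_p^*})_k,(\mathbb E\|\delta^d_k\|^2_{\mathcal X_d^*})_k\in\ell^1_+$. (A11)(I) At least one of $f$, $g$ is strongly convex on $\mathcal C_p\cap\operatorname{dom}(g)$ with respect to a convex entropy $\psi_p:\mathcal X_p\to\mathbb R\cup\{+\infty\}$ (differentiable on $\operatorname{int}\operatorname{dom}(\psi_p)$)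 with constant $m_f>0$, respectively $m_g>0$, and $\operatorname{dom}(\phi_p)\subseteq\operatorname{dom}(\psi_p)$. (A11)(II) At least one of $h^*$, $l^*$ is strongly convex on $\mathcal C_d\cap\operatorname{dom}(l^* )$ with respect to a convex entropy $\psi_d:\mathcal X_d\to\mathbb R\cup\{+\infty\}$ (differentiable on $\operatorname{int}\operatorname{dom}(\psi_d)$) with constant $m_{h^*}>0$, respectively $m_{l^*}>0$, and $\operatorname{dom}(\phi_d)\subseteq\operatorname{dom}(\psi_d)$. *)

theory Defs
  imports "HOL-Probability.Probability"
begin

text \<open>
  The topological dual of a real normed space \<open>'a\<close> is the normed space of bounded linear
  functionals, and the duality pairing is function application.
\<close>

type_synonym 'a dual = "'a \<Rightarrow>\<^sub>L real"

text \<open>Reflexivity: the canonical embedding into the bidual is onto.\<close>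

definition reflexive_space :: "'a::real_normed_vector itself \<Rightarrow> bool" where
  "reflexive_space _ \<longleftrightarrow>
    (\<forall>\<Phi>::'a dual dual. \<exists>x::'a. \<forall>u::'a dual. blinfun_apply \<Phi> u = blinfun_apply u x)"

section \<open>Extended-real-valued convex functions\<close>

definition edom :: "('a \<Rightarrow> ereal) \<Rightarrow> 'a set" where
  "edom f = {x. f x < \<infinity>}"

text \<open>Only applied to functions that never take the value \<open>-\<infinity>\<close>.\<close>

definition convex_fun :: "('a::real_vector \<Rightarrow> ereal) \<Rightarrow> bool" where
  "convex_fun f \<longleftrightarrow> (\<forall>x y. \<forall>t::real. 0 < t \<longrightarrow> t < 1 \<longrightarrow>
     f ((1 - t) *\<^sub>R x + t *\<^sub>R y) \<le> ereal (1 - t) * f x + ereal t * f y)"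

definition proper_fun :: "('a \<Rightarrow> ereal) \<Rightarrow> bool" where
  "proper_fun f \<longleftrightarrow> (\<forall>x. f x \<noteq> -\<infinity>) \<and> edom f \<noteq> {}"

definition lsc_fun :: "('a::topological_space \<Rightarrow> ereal) \<Rightarrow> bool" where
  "lsc_fun f \<longleftrightarrow> (\<forall>x. f x \<le> Liminf (at x) f)"

definition Gamma0 :: "('a::real_normed_vector \<Rightarrow> ereal) set" where
  "Gamma0 = {f. proper_fun f \<and> convex_fun f \<and> lsc_fun f}"

definition indicator_fun :: "'a set \<Rightarrow> 'a \<Rightarrow> ereal" where
  "indicator_fun C x = (if x \<in> C then 0 else \<infinity>)"

definition subdiff :: "('a::real_normed_vector \<Rightarrow> ereal) \<Rightarrow> 'a \<Rightarrow> 'a dual set" where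
  "subdiff f x = {u. x \<in> edom f \<and> (\<forall>y. f x + ereal (blinfun_apply u (y - x)) \<le> f y)}"

definition dom_subdiff :: "('a::real_normed_vector \<Rightarrow> ereal) \<Rightarrow> 'a set" where
  "dom_subdiff f = {x. subdiff f x \<noteq> {}}"

text \<open>
  The conjugate of a function on the dual of \<open>'a\<close>, regarded as a function on \<open>'a\<close> itself through the
  identification of the (reflexive) space with its bidual.
\<close>

definition fenchel_conj :: "('a::real_normed_vector dual \<Rightarrow> ereal) \<Rightarrow> 'a \<Rightarrow> ereal" where
  "fenchel_conj h \<mu> = (SUP y. ereal (blinfun_apply y \<mu>) - h y)"

text \<open>
  Gateaux gradients are considered only at interior points of the domain, where the function is
  finite nearby and passing to real values loses nothing.
\<close>

definition has_gateaux_gradient ::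
    "('a::real_normed_vector \<Rightarrow> ereal) \<Rightarrow> 'a dual \<Rightarrow> 'a \<Rightarrow> bool" where
  "has_gateaux_gradient f u x \<longleftrightarrow> x \<in> interior (edom f) \<and>
     (\<forall>v. ((\<lambda>t. real_of_ereal (f (x + t *\<^sub>R v))) has_real_derivative blinfun_apply u v) (at 0))"

definition gateaux_differentiable_on ::
    "('a::real_normed_vector \<Rightarrow> ereal) \<Rightarrow> 'a set \<Rightarrow> bool" where
  "gateaux_differentiable_on f S \<longleftrightarrow> (\<forall>x\<in>S. \<exists>u. has_gateaux_gradient f u x)"

definition grad :: "('a::real_normed_vector \<Rightarrow> ereal) \<Rightarrow> 'a \<Rightarrow> 'a dual" where
  "grad f x = (THE u. has_gateaux_gradient f u x)"

definition argmin_on :: "'a set \<Rightarrow> ('a \<Rightarrow> ereal) \<Rightarrow> 'a set" where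
  "argmin_on C F = {x \<in> C. \<forall>y\<in>C. F x \<le> F y}"

definition argmax_on :: "'a set \<Rightarrow> ('a \<Rightarrow> ereal) \<Rightarrow> 'a set" where
  "argmax_on C F = {x \<in> C. \<forall>y\<in>C. F y \<le> F x}"

section \<open>Bregman divergences\<close>

definition bregman :: "('a::real_normed_vector \<Rightarrow> ereal) \<Rightarrow> 'a \<Rightarrow> 'a \<Rightarrow> ereal" where
  "bregman \<phi> x y =
     (if x \<in> edom \<phi> \<and> y \<in> interior (edom \<phi>)
      then \<phi> x - \<phi> y - ereal (blinfun_apply (grad \<phi> y) (x - y)) else \<infinity>)"

definition relatively_smooth ::
    "real \<Rightarrow> ('a::real_normed_vector \<Rightarrow> ereal) \<Rightarrow> ('a \<Rightarrow> ereal) \<Rightarrow> bool" where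
  "relatively_smooth L F \<phi> \<longleftrightarrow> gateaux_differentiable_on F (interior (edom \<phi>)) \<and>
     convex_on (interior (edom \<phi>)) (\<lambda>x. L * real_of_ereal (\<phi> x) - real_of_ereal (F x))"

text \<open>
  Closedness of \<open>C\<close> is not part of the predicate: it is applied to sets \<open>C\<^sub>p \<inter> dom(g)\<close>,
  which are nonempty and convex but need not be closed.
\<close>

definition relatively_strongly_convex_on ::
    "real \<Rightarrow> 'a::real_normed_vector set \<Rightarrow> ('a \<Rightarrow> ereal) \<Rightarrow> ('a \<Rightarrow> ereal) \<Rightarrow> bool" where
  "relatively_strongly_convex_on m C F \<phi> \<longleftrightarrow>
     (\<forall>x\<in>C. \<forall>y \<in> interior (edom \<phi>) \<inter> dom_subdiff F \<inter> C. \<forall>u\<in>subdiff F y.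
        ereal m * bregman \<phi> x y \<le> F x - F y - ereal (blinfun_apply u (x - y)))"

definition convex_entropy :: "('a::real_normed_vector \<Rightarrow> ereal) \<Rightarrow> bool" where
  "convex_entropy \<psi> \<longleftrightarrow> (\<forall>x. \<psi> x \<noteq> -\<infinity>) \<and> convex_fun \<psi> \<and>
     gateaux_differentiable_on \<psi> (interior (edom \<psi>))"

definition bregman_modulus :: "('a::real_normed_vector \<Rightarrow> ereal) \<Rightarrow> 'a \<Rightarrow> real \<Rightarrow> ereal" where
  "bregman_modulus \<psi> x t = Inf {bregman \<psi> x' x | x'. norm (x - x') = t}"

definition sequentially_consistent_on ::
    "('a::real_normed_vector \<Rightarrow> ereal) \<Rightarrow> 'a set \<Rightarrow> bool" where
  "sequentially_consistent_on \<psi> X \<longleftrightarrow> X \<subseteq> interior (edom \<psi>) \<and>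
     (\<forall>V t. V \<subseteq> X \<longrightarrow> bounded V \<longrightarrow> 0 < t \<longrightarrow> 0 < (INF x\<in>V. bregman_modulus \<psi> x t))"

definition bounded_sublevel_sets :: "('a::metric_space \<Rightarrow> ereal) \<Rightarrow> bool" where
  "bounded_sublevel_sets F \<longleftrightarrow> (\<forall>r::real. bounded {y. F y \<le> ereal r})"

text \<open>The set-valued inverse of \<open>\<nabla>\<phi> + t \<partial>G\<close> at \<open>\<zeta>\<close>.\<close>

definition bregman_resolvent ::
    "('a::real_normed_vector \<Rightarrow> ereal) \<Rightarrow> real \<Rightarrow> ('a \<Rightarrow> ereal) \<Rightarrow> 'a dual \<Rightarrow> 'a set" where
  "bregman_resolvent \<phi> t G \<zeta> =
     {z. \<exists>v u. has_gateaux_gradient \<phi> v z \<and> u \<in> subdiff G z \<and> \<zeta> = v + t *\<^sub>R u}"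

text \<open>The sets written \<open>U\<close> and \<open>U\<close> with a tilde, for an entropy \<open>\<phi>\<close> and a function \<open>G\<close>.\<close>

definition int_region :: "('a::real_normed_vector \<Rightarrow> ereal) \<Rightarrow> ('a \<Rightarrow> ereal) \<Rightarrow> 'a set" where
  "int_region \<phi> G = interior (edom \<phi>) \<inter> dom_subdiff G"

definition dom_region :: "('a::real_normed_vector \<Rightarrow> ereal) \<Rightarrow> ('a \<Rightarrow> ereal) \<Rightarrow> 'a set" where
  "dom_region \<phi> G = edom \<phi> \<inter> dom_subdiff G"

section \<open>The saddle point problem\<close>

text \<open>
  Whenever both a primal and a dual term are infinite, the value is \<open>\<infinity> - \<infinity> = \<infinity>\<close> in
  \<^typ>\<open>ereal\<close>. Since \<open>C\<^sub>p \<inter> dom(g)\<close> and \<open>C\<^sub>d \<inter> dom(l\<^sup>*)\<close> are nonempty, this convention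
  influences neither the saddle points nor the primal and dual solutions.
\<close>

definition coupling ::
    "('x::real_normed_vector \<Rightarrow> ereal) \<Rightarrow> ('x \<Rightarrow> ereal) \<Rightarrow>
     ('y::real_normed_vector dual \<Rightarrow> ereal) \<Rightarrow> ('y dual \<Rightarrow> ereal) \<Rightarrow>
     ('x \<Rightarrow>\<^sub>L 'y dual) \<Rightarrow> 'x \<Rightarrow> 'y \<Rightarrow> ereal" where
  "coupling f g h l T x \<mu> =
     f x + g x + ereal (blinfun_apply (blinfun_apply T x) \<mu>) - fenchel_conj h \<mu> - fenchel_conj l \<mu>"

definition lagrangian ::
    "'x::real_normed_vector set \<Rightarrow> 'y::real_normed_vector set \<Rightarrow>
     ('x \<Rightarrow> ereal) \<Rightarrow> ('x \<Rightarrow> ereal) \<Rightarrow> ('y dual \<Rightarrow> ereal) \<Rightarrow> ('y dual \<Rightarrow> ereal) \<Rightarrow>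
     ('x \<Rightarrow>\<^sub>L 'y dual) \<Rightarrow> 'x \<Rightarrow> 'y \<Rightarrow> ereal" where
  "lagrangian Cp Cd f g h l T x \<mu> =
     f x + g x + indicator_fun Cp x + ereal (blinfun_apply (blinfun_apply T x) \<mu>)
       - fenchel_conj h \<mu> - fenchel_conj l \<mu> - indicator_fun Cd \<mu>"

definition saddle_points :: "('x \<Rightarrow> 'y \<Rightarrow> ereal) \<Rightarrow> ('x \<times> 'y) set" where
  "saddle_points \<L> = {(xs, \<mu>s). \<forall>x \<mu>. \<L> xs \<mu> \<le> \<L> xs \<mu>s \<and> \<L> xs \<mu>s \<le> \<L> x \<mu>s}"

text \<open>The inner maximum and minimum are read as supremum and infimum.\<close>

definition primal_solutions ::
    "'x::real_normed_vector set \<Rightarrow> 'y::real_normed_vector set \<Rightarrow>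
     ('x \<Rightarrow> ereal) \<Rightarrow> ('x \<Rightarrow> ereal) \<Rightarrow> ('y dual \<Rightarrow> ereal) \<Rightarrow> ('y dual \<Rightarrow> ereal) \<Rightarrow>
     ('x \<Rightarrow>\<^sub>L 'y dual) \<Rightarrow> 'x set" where
  "primal_solutions Cp Cd f g h l T = argmin_on Cp (\<lambda>x. SUP \<mu>\<in>Cd. coupling f g h l T x \<mu>)"

definition dual_solutions ::
    "'x::real_normed_vector set \<Rightarrow> 'y::real_normed_vector set \<Rightarrow>
     ('x \<Rightarrow> ereal) \<Rightarrow> ('x \<Rightarrow> ereal) \<Rightarrow> ('y dual \<Rightarrow> ereal) \<Rightarrow> ('y dual \<Rightarrow> ereal) \<Rightarrow>
     ('x \<Rightarrow>\<^sub>L 'y dual) \<Rightarrow> 'y set" where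
  "dual_solutions Cp Cd f g h l T = argmax_on Cd (\<lambda>\<mu>. INF x\<in>Cp. coupling f g h l T x \<mu>)"

definition saddle_problem ::
    "'x::banach set \<Rightarrow> 'y::banach set \<Rightarrow>
     ('x \<Rightarrow> ereal) \<Rightarrow> ('x \<Rightarrow> ereal) \<Rightarrow> ('y dual \<Rightarrow> ereal) \<Rightarrow> ('y dual \<Rightarrow> ereal) \<Rightarrow>
     ('x \<Rightarrow>\<^sub>L 'y dual) \<Rightarrow> bool" where
  "saddle_problem Cp Cd f g h l T \<longleftrightarrow>
     reflexive_space TYPE('x) \<and> reflexive_space TYPE('y) \<and>
     Cp \<noteq> {} \<and> closed Cp \<and> convex Cp \<and> Cd \<noteq> {} \<and> closed Cd \<and> convex Cd \<and>
     f \<in> Gamma0 \<and> g \<in> Gamma0 \<and> h \<in> Gamma0 \<and> l \<in> Gamma0 \<and>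
     Cp \<subseteq> edom f \<and> Cd \<subseteq> edom (fenchel_conj h) \<and>
     gateaux_differentiable_on f (interior Cp) \<and>
     gateaux_differentiable_on (fenchel_conj h) (interior Cd) \<and>
     Cp \<inter> edom g \<noteq> {} \<and> Cd \<inter> edom (fenchel_conj l) \<noteq> {} \<and>
     saddle_points (lagrangian Cp Cd f g h l T) \<noteq> {}"

section \<open>Random variables in Banach spaces\<close>

text \<open>
  Random variables in a Banach space are understood in Bochner's sense: Borel measurable and almost
  surely separably valued. The second condition is automatic in separable spaces.
\<close>

definition random_element :: "'w measure \<Rightarrow> ('w \<Rightarrow> 'b::real_normed_vector) \<Rightarrow> bool" where
  "random_element M X \<longleftrightarrow> X \<in> borel_measurable M \<and>
     (\<exists>D. countable D \<and> (AE \<omega> in M. X \<omega> \<in> closure D))"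

text \<open>
  The library's Bochner integral is restricted to second-countable spaces. This is its defining
  property without that restriction, as needed for duals of nonseparable spaces.
\<close>

definition has_bochner_integral_gen ::
    "'w measure \<Rightarrow> ('w \<Rightarrow> 'b::real_normed_vector) \<Rightarrow> 'b \<Rightarrow> bool" where
  "has_bochner_integral_gen M X I \<longleftrightarrow> X \<in> borel_measurable M \<and>
     (\<exists>s. (\<forall>i. Bochner_Integration.simple_bochner_integrable M (s i)) \<and>
          (\<lambda>i. \<integral>\<^sup>+\<omega>. ennreal (norm (X \<omega> - s i \<omega>)) \<partial>M) \<longlonglongrightarrow> 0 \<and>
          (\<lambda>i. Bochner_Integration.simple_bochner_integral M (s i)) \<longlonglongrightarrow> I)"

text \<open>\<open>Y\<close> is a version of the conditional expectation of \<open>X\<close> given the sub-\<open>\<sigma>\<close>-algebra \<open>F\<close>.\<close>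

definition has_cond_exp ::
    "'w measure \<Rightarrow> 'w measure \<Rightarrow> ('w \<Rightarrow> 'b::real_normed_vector) \<Rightarrow> ('w \<Rightarrow> 'b) \<Rightarrow> bool" where
  "has_cond_exp M F X Y \<longleftrightarrow> subalgebra M F \<and> Y \<in> borel_measurable F \<and>
     (\<forall>A\<in>sets F. \<exists>I. has_bochner_integral_gen M (\<lambda>\<omega>. indicator A \<omega> *\<^sub>R X \<omega>) I \<and>
                     has_bochner_integral_gen M (\<lambda>\<omega>. indicator A \<omega> *\<^sub>R Y \<omega>) I)"

definition natural_filtration ::
    "'w measure \<Rightarrow> (nat \<Rightarrow> 'w \<Rightarrow> 'b::topological_space) \<Rightarrow> nat \<Rightarrow> 'w measure" where
  "natural_filtration M w k =
     sigma (space M) (\<Union>i\<in>{..k}. {w i -` B \<inter> space M | B. B \<in> sets borel})"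

definition ell1_plus :: "(nat \<Rightarrow> real) \<Rightarrow> bool" where
  "ell1_plus a \<longleftrightarrow> (\<forall>k. 0 \<le> a k) \<and> summable a"

definition ell1_plus_adapted ::
    "'w measure \<Rightarrow> (nat \<Rightarrow> 'w measure) \<Rightarrow> (nat \<Rightarrow> 'w \<Rightarrow> real) \<Rightarrow> bool" where
  "ell1_plus_adapted M F a \<longleftrightarrow> (\<forall>k. a k \<in> borel_measurable (F k)) \<and>
     (AE \<omega> in M. \<forall>k. 0 \<le> a k \<omega>) \<and> (AE \<omega> in M. summable (\<lambda>k. a k \<omega>))"

text \<open>
  Summability of the \<open>q\<close>-th moments of the errors, conditional and unconditional. Integrability is
  stated because \<^const>\<open>real_cond_exp\<close> and the Bochner integral take default values without it.
\<close>

definition summable_moments ::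
    "'w measure \<Rightarrow> (nat \<Rightarrow> 'w measure) \<Rightarrow> nat \<Rightarrow> (nat \<Rightarrow> 'w \<Rightarrow> 'b::real_normed_vector) \<Rightarrow> bool"
  where
  "summable_moments M F q \<delta> \<longleftrightarrow>
     (\<forall>k. integrable M (\<lambda>\<omega>. norm (\<delta> k \<omega>) ^ q)) \<and>
     ell1_plus_adapted M F (\<lambda>k. real_cond_exp M (F k) (\<lambda>\<omega>. norm (\<delta> k \<omega>) ^ q)) \<and>
     ell1_plus (\<lambda>k. \<integral>\<omega>. norm (\<delta> k \<omega>) ^ q \<partial>M)"

section \<open>The algorithm and its assumptions\<close>

definition adjoint_map :: "('x::real_normed_vector \<Rightarrow>\<^sub>L 'y::real_normed_vector dual) \<Rightarrow> 'y \<Rightarrow> 'x dual"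
  where "adjoint_map T \<mu> = Blinfun (\<lambda>x. blinfun_apply (blinfun_apply T x) \<mu>)"

lemma adjoint_map_apply [simp]:
  "blinfun_apply (adjoint_map T \<mu>) x = blinfun_apply (blinfun_apply T x) \<mu>"
proof -
  have "bounded_linear (\<lambda>x. blinfun_apply (blinfun_apply T x) \<mu>)"
    by (intro bounded_linear_intros)
  then show ?thesis
    by (simp add: adjoint_map_def bounded_linear_Blinfun_apply)
qed

definition primal_dual_iterates ::
    "'w measure \<Rightarrow> 'x::banach set \<Rightarrow> 'y::banach set \<Rightarrow>
     ('x \<Rightarrow> ereal) \<Rightarrow> ('x \<Rightarrow> ereal) \<Rightarrow> ('y dual \<Rightarrow> ereal) \<Rightarrow> ('y dual \<Rightarrow> ereal) \<Rightarrow>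
     ('x \<Rightarrow>\<^sub>L 'y dual) \<Rightarrow> ('x \<Rightarrow> ereal) \<Rightarrow> ('y \<Rightarrow> ereal) \<Rightarrow> (nat \<Rightarrow> real) \<Rightarrow> (nat \<Rightarrow> real) \<Rightarrow>
     (nat \<Rightarrow> 'w \<Rightarrow> 'x dual) \<Rightarrow> (nat \<Rightarrow> 'w \<Rightarrow> 'y dual) \<Rightarrow>
     (nat \<Rightarrow> 'w \<Rightarrow> 'x) \<Rightarrow> (nat \<Rightarrow> 'w \<Rightarrow> 'y) \<Rightarrow> bool" where
  "primal_dual_iterates P Cp Cd f g h l T \<phi>p \<phi>d lam \<nu> \<delta>p \<delta>d x \<mu> \<longleftrightarrow>
     (\<forall>k. 0 < lam k \<and> 0 < \<nu> k) \<and>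
     (\<forall>k. random_element P (\<delta>p k) \<and> random_element P (\<delta>d k) \<and>
          random_element P (\<lambda>\<omega>. (x k \<omega>, \<mu> k \<omega>))) \<and>
     (\<exists>x0 \<in> int_region \<phi>p g. \<exists>\<mu>0 \<in> int_region \<phi>d (fenchel_conj l).
        \<forall>\<omega>\<in>space P. x 0 \<omega> = x0 \<and> \<mu> 0 \<omega> = \<mu>0) \<and>
     (AE \<omega> in P. \<forall>k.
        argmin_on Cp (\<lambda>z. g z + ereal (blinfun_apply (grad f (x k \<omega>) + \<delta>p k \<omega>) z)
             + ereal (blinfun_apply (blinfun_apply T z) (\<mu> k \<omega>))
             + ereal (1 / lam k) * bregman \<phi>p z (x k \<omega>)) = {x (Suc k) \<omega>} \<and>
        argmin_on Cd (\<lambda>z. fenchel_conj l z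
             + ereal (blinfun_apply (grad (fenchel_conj h) (\<mu> k \<omega>) + \<delta>d k \<omega>) z)
             - ereal (blinfun_apply (blinfun_apply T (2 *\<^sub>R x (Suc k) \<omega> - x k \<omega>)) z)
             + ereal (1 / \<nu> k) * bregman \<phi>d z (\<mu> k \<omega>)) = {\<mu> (Suc k) \<omega>})"

text \<open>
  The dual points at which the two resolvents are evaluated in one step of the algorithm, with
  error \<open>e\<close> (\<open>e = 0\<close> for an error-free step); \<open>x'\<close> is the new primal point.
\<close>

definition primal_eval_point ::
    "('x::banach \<Rightarrow> ereal) \<Rightarrow> ('x \<Rightarrow>\<^sub>L 'y::banach dual) \<Rightarrow> ('x \<Rightarrow> ereal) \<Rightarrow> real \<Rightarrow>
     'x \<Rightarrow> 'y \<Rightarrow> 'x dual \<Rightarrow> 'x dual" where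
  "primal_eval_point f T \<phi>p t x \<mu> e = grad \<phi>p x - t *\<^sub>R (grad f x + e + adjoint_map T \<mu>)"

definition dual_eval_point ::
    "('y::banach dual \<Rightarrow> ereal) \<Rightarrow> ('x::banach \<Rightarrow>\<^sub>L 'y dual) \<Rightarrow> ('y \<Rightarrow> ereal) \<Rightarrow> real \<Rightarrow>
     'x \<Rightarrow> 'x \<Rightarrow> 'y \<Rightarrow> 'y dual \<Rightarrow> 'y dual" where
  "dual_eval_point h T \<phi>d t x x' \<mu> e =
     grad \<phi>d \<mu> - t *\<^sub>R (grad (fenchel_conj h) \<mu> + e - blinfun_apply T (2 *\<^sub>R x' - x))"

text \<open>
  One step from \<open>(x, \<mu>)\<close> with errors \<open>ep\<close>, \<open>ed\<close> evaluates both resolvents at points where they are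
  nonempty, single-valued and have their value in the interior of the domain of the entropy.
\<close>

definition well_posed_step ::
    "('x::banach \<Rightarrow> ereal) \<Rightarrow> ('x \<Rightarrow> ereal) \<Rightarrow> ('y::banach dual \<Rightarrow> ereal) \<Rightarrow> ('y dual \<Rightarrow> ereal) \<Rightarrow>
     ('x \<Rightarrow>\<^sub>L 'y dual) \<Rightarrow> ('x \<Rightarrow> ereal) \<Rightarrow> ('y \<Rightarrow> ereal) \<Rightarrow> real \<Rightarrow> real \<Rightarrow>
     'x \<Rightarrow> 'y \<Rightarrow> 'x dual \<Rightarrow> 'y dual \<Rightarrow> bool" where
  "well_posed_step f g h l T \<phi>p \<phi>d s t x \<mu> ep ed \<longleftrightarrow>
     (\<exists>x' \<in> interior (edom \<phi>p). \<exists>\<mu>' \<in> interior (edom \<phi>d).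
        bregman_resolvent \<phi>p s g (primal_eval_point f T \<phi>p s x \<mu> ep) = {x'} \<and>
        bregman_resolvent \<phi>d t (fenchel_conj l) (dual_eval_point h T \<phi>d t x x' \<mu> ed) = {\<mu>'})"

definition entropy_assumption ::
    "'w measure \<Rightarrow> 'x::banach set \<Rightarrow> 'y::banach set \<Rightarrow>
     ('x \<Rightarrow> ereal) \<Rightarrow> ('x \<Rightarrow> ereal) \<Rightarrow> ('y dual \<Rightarrow> ereal) \<Rightarrow> ('y dual \<Rightarrow> ereal) \<Rightarrow>
     ('x \<Rightarrow>\<^sub>L 'y dual) \<Rightarrow> ('x \<Rightarrow> ereal) \<Rightarrow> ('y \<Rightarrow> ereal) \<Rightarrow> real \<Rightarrow> real \<Rightarrow>
     (nat \<Rightarrow> real) \<Rightarrow> (nat \<Rightarrow> real) \<Rightarrow>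
     (nat \<Rightarrow> 'w \<Rightarrow> 'x dual) \<Rightarrow> (nat \<Rightarrow> 'w \<Rightarrow> 'y dual) \<Rightarrow>
     (nat \<Rightarrow> 'w \<Rightarrow> 'x) \<Rightarrow> (nat \<Rightarrow> 'w \<Rightarrow> 'y) \<Rightarrow> bool" where
  "entropy_assumption P Cp Cd f g h l T \<phi>p \<phi>d Lp Ld lam \<nu> \<delta>p \<delta>d x \<mu> \<longleftrightarrow>
     \<phi>p \<in> Gamma0 \<and> \<phi>d \<in> Gamma0 \<and>
     gateaux_differentiable_on \<phi>p (interior (edom \<phi>p)) \<and>
     gateaux_differentiable_on \<phi>d (interior (edom \<phi>d)) \<and>
     edom \<phi>p = Cp \<and> edom \<phi>d = Cd \<and>
     relatively_smooth Lp f \<phi>p \<and> relatively_smooth Ld (fenchel_conj h) \<phi>d \<and>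
     (AE \<omega> in P. \<forall>k.
        well_posed_step f g h l T \<phi>p \<phi>d (lam k) (\<nu> k) (x k \<omega>) (\<mu> k \<omega>) (\<delta>p k \<omega>) (\<delta>d k \<omega>) \<and>
        well_posed_step f g h l T \<phi>p \<phi>d (lam k) (\<nu> k) (x k \<omega>) (\<mu> k \<omega>) 0 0)"

definition step_assumption :: "(nat \<Rightarrow> real) \<Rightarrow> real \<Rightarrow> bool" where
  "step_assumption lam laminf \<longleftrightarrow>
     (\<forall>k. 0 < lam k) \<and> incseq lam \<and> bdd_above (range lam) \<and> lam \<longlonglongrightarrow> laminf"

text \<open>
  The numerator is finite on the index set. Where \<open>d\<close> vanishes, division in \<^typ>\<open>ereal\<close> gives
  \<open>\<infinity>\<close>, \<open>0\<close> or \<open>-\<infinity>\<close> according to the sign of the numerator.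
\<close>

definition coercivity_assumption ::
    "('x::banach \<Rightarrow> ereal) \<Rightarrow> ('y::banach dual \<Rightarrow> ereal) \<Rightarrow> ('x \<Rightarrow>\<^sub>L 'y dual) \<Rightarrow>
     ('x \<Rightarrow> ereal) \<Rightarrow> ('y \<Rightarrow> ereal) \<Rightarrow> real \<Rightarrow> real \<Rightarrow> real \<Rightarrow> real \<Rightarrow> bool" where
  "coercivity_assumption g l T \<phi>p \<phi>d Lp Ld laminf \<nu>inf \<longleftrightarrow>
     (\<exists>(d :: 'x \<times> 'y \<Rightarrow> 'x \<times> 'y \<Rightarrow> real) (\<epsilon> :: real).
        (\<forall>w1 w2. 0 \<le> d w1 w2) \<and> 0 \<le> \<epsilon> \<and>
        ereal \<epsilon> \<le> Inf {(ereal (1 / laminf - Lp) * bregman \<phi>p x1 x2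
                           + ereal (1 / \<nu>inf - Ld) * bregman \<phi>d \<mu>1 \<mu>2
                           - ereal (blinfun_apply (blinfun_apply T (x1 - x2)) (\<mu>1 - \<mu>2)))
                         / ereal (d (x1, \<mu>1) (x2, \<mu>2)) | x1 \<mu>1 x2 \<mu>2.
             x1 \<in> dom_region \<phi>p g \<and> \<mu>1 \<in> dom_region \<phi>d (fenchel_conj l) \<and>
             x2 \<in> int_region \<phi>p g \<and> \<mu>2 \<in> int_region \<phi>d (fenchel_conj l) \<and>
             (x1, \<mu>1) \<noteq> (x2, \<mu>2)})"

definition unbiased_errors ::
    "'w measure \<Rightarrow> (nat \<Rightarrow> 'w measure) \<Rightarrow> (nat \<Rightarrow> 'w \<Rightarrow> 'b::real_normed_vector) \<Rightarrow> bool" where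
  "unbiased_errors P F \<delta> \<longleftrightarrow> (\<forall>k. has_cond_exp P (F k) (\<delta> k) (\<lambda>_. 0))"

text \<open>
  In the third alternative the bound \<open>\<nu>\<^sub>\<infinity> \<lambda>\<^sub>\<infinity> < \<sigma>\<^sub>p \<sigma>\<^sub>d / \<parallel>T\<parallel>\<^sup>2\<close> is multiplied out, so that it
  imposes no restriction when \<open>T = 0\<close>.
\<close>

definition error_assumption ::
    "'w measure \<Rightarrow> (nat \<Rightarrow> 'w measure) \<Rightarrow>
     ('x::banach \<Rightarrow> ereal) \<Rightarrow> ('y::banach dual \<Rightarrow> ereal) \<Rightarrow> ('x \<Rightarrow>\<^sub>L 'y dual) \<Rightarrow>
     ('x \<Rightarrow> ereal) \<Rightarrow> ('y \<Rightarrow> ereal) \<Rightarrow> real \<Rightarrow> real \<Rightarrow>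
     (nat \<Rightarrow> 'w \<Rightarrow> 'x dual) \<Rightarrow> (nat \<Rightarrow> 'w \<Rightarrow> 'y dual) \<Rightarrow> bool" where
  "error_assumption P F g l T \<phi>p \<phi>d laminf \<nu>inf \<delta>p \<delta>d \<longleftrightarrow>
     (AE \<omega> in P. \<forall>k. \<delta>p k \<omega> = 0 \<and> \<delta>d k \<omega> = 0) \<or>
     (summable_moments P F 1 \<delta>p \<and> summable_moments P F 1 \<delta>d \<and>
      bounded (int_region \<phi>p g) \<and> 0 < diameter (int_region \<phi>p g) \<and>
      bounded (int_region \<phi>d (fenchel_conj l)) \<and>
      0 < diameter (int_region \<phi>d (fenchel_conj l))) \<or>
     ((\<exists>\<sigma>p>0. \<exists>\<sigma>d>0.
         (\<forall>z y. ereal (\<sigma>p / 2 * (norm (z - y))\<^sup>2) \<le> bregman \<phi>p z y) \<and>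
         (\<forall>z y. ereal (\<sigma>d / 2 * (norm (z - y))\<^sup>2) \<le> bregman \<phi>d z y) \<and>
         \<nu>inf * laminf * (norm T)\<^sup>2 < \<sigma>p * \<sigma>d) \<and>
      summable_moments P F 2 \<delta>p \<and> summable_moments P F 2 \<delta>d)"

text \<open>
  At least one of \<open>F\<close>, \<open>G\<close> is relatively strongly convex on \<open>C \<inter> dom(G)\<close>; used with \<open>(f, g)\<close> and
  with \<open>(h\<^sup>*, l\<^sup>*)\<close>.
\<close>

definition strong_convexity_assumption ::
    "'a::real_normed_vector set \<Rightarrow> ('a \<Rightarrow> ereal) \<Rightarrow> ('a \<Rightarrow> ereal) \<Rightarrow> ('a \<Rightarrow> ereal) \<Rightarrow>
     ('a \<Rightarrow> ereal) \<Rightarrow> bool" where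
  "strong_convexity_assumption C F G \<phi> \<psi> \<longleftrightarrow>
     convex_entropy \<psi> \<and> edom \<phi> \<subseteq> edom \<psi> \<and>
     ((\<exists>m>0. relatively_strongly_convex_on m (C \<inter> edom G) F \<psi>) \<or>
      (\<exists>m>0. relatively_strongly_convex_on m (C \<inter> edom G) G \<psi>))"

end

theory Submission
  imports Defs
begin

text \<open>
  The proof follows the energy
  \<open>V\<^sub>k = D\<^sub>p(x\<^sup>*, x\<^sub>k) / \<lambda>\<^sub>k + D\<^sub>d(\<mu>\<^sup>*, \<mu>\<^sub>k) / \<nu>\<^sub>k - \<langle>T(x\<^sup>* - x\<^sub>k), \<mu>\<^sup>* - \<mu>\<^sub>k\<rangle>\<close> of the iterates at a saddle
  point \<open>(x\<^sup>*, \<mu>\<^sup>*)\<close>. The optimality conditions of one step, the three-point identity for Bregman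
  divergences, relative smoothness and the saddle point inequalities give
  \<open>V\<^sub>k\<^sub>+\<^sub>1 + E\<^sub>k \<le> V\<^sub>k + \<langle>\<delta>\<^sup>p\<^sub>k, x\<^sup>* - x\<^sub>k\<^sub>+\<^sub>1\<rangle> + \<langle>\<delta>\<^sup>d\<^sub>k, \<mu>\<^sup>* - \<mu>\<^sub>k\<^sub>+\<^sub>1\<rangle>\<close>
  (lemma \<open>energy_descent\<close>). The excess \<open>E\<^sub>k\<close> is the total gap in the subgradient inequalities that
  were used for \<open>f\<close>, \<open>g\<close>, \<open>h\<^sup>*\<close> and \<open>l\<^sup>*\<close>, and strong convexity of one of these functions bounds a
  multiple of \<open>D\<^sub>\<psi>(x\<^sup>*, x\<^sub>k)\<close> or \<open>D\<^sub>\<psi>(x\<^sup>*, x\<^sub>k\<^sub>+\<^sub>1)\<close> by it. So it suffices that \<open>E\<^sub>k \<rightarrow> 0\<close> almost surely;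
  sequential consistency and bounded sublevel sets then turn \<open>D\<^sub>\<psi>(x\<^sup>*, x\<^sub>k) \<rightarrow> 0\<close> into strong convergence.

  Nonnegativity of \<open>V\<^sub>k\<close> is the coercivity assumption with the saddle point in the first argument, which
  requires \<open>\<partial>g(x\<^sup>*)\<close> and \<open>\<partial>l\<^sup>*(\<mu>\<^sup>*)\<close> to be nonempty. They are, because \<open>x\<^sup>*\<close> minimises a sum
  of \<open>g\<close> and a function that is continuous at some point of \<open>dom g\<close>, namely \<open>x\<^sub>0\<close>, and similarly for \<open>\<mu>\<^sup>*\<close>: this is the
  Moreau-Rockafellar sum rule, obtained here from the Hahn-Banach theorem and a Baire category argument.

  If the errors vanish, or if the regions are bounded and the errors are summable, then \<open>E\<^sub>k\<close> is summable
  path by path. In the remaining case only the squares of the errors are summable, and \<open>x\<^sub>k\<^sub>+\<^sub>1\<close> in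
  \<open>\<langle>\<delta>\<^sup>p\<^sub>k, x\<^sup>* - x\<^sub>k\<^sub>+\<^sub>1\<rangle>\<close> has to be replaced, at a cost \<open>O(\<parallel>\<delta>\<^sub>k\<parallel>)\<close>, by a point that depends on the past only, since
  then the pairing has mean zero. The point produced by an error-free step is natural, but its measurability
  is unclear: gradients are only Gateaux gradients, hence only continuous from the norm to the weak topology,
  and the spaces need not be separable. A quantised version works instead. In a reflexive space a
  norm-to-weak continuous map sends separable sets to norm separable sets, so up to an error \<open>2\<^sup>-\<^sup>k\<close> the dual
  points at which the resolvents are evaluated fall into countably many measurable classes (lemma
  \<open>quantise_weakly_continuous_map\<close>); as the resolvents are Lipschitz under strong convexity, one error-free
  step per class gives a countably valued proxy. Taking expectations and telescoping then bounds
  the expected sum of a majorant of \<open>E\<^sub>k\<close>.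
\<close>

section \<open>The Hahn-Banach theorem\<close>

definition sublinear :: "('a::real_vector \<Rightarrow> real) \<Rightarrow> bool" where
  "sublinear q \<longleftrightarrow> (\<forall>v w. q (v + w) \<le> q v + q w) \<and> (\<forall>c>0. \<forall>v. q (c *\<^sub>R v) \<le> c * q v)"

lemma sublinear_add: "sublinear q \<Longrightarrow> q (v + w) \<le> q v + q w"
  by (simp add: sublinear_def)

lemma sublinear_zero: assumes "sublinear q" shows "q 0 = 0"
proof -
  have "q (0 + 0) \<le> q 0 + q 0" using assms sublinear_add by blast
  moreover have "q ((1/2) *\<^sub>R 0) \<le> (1/2) * q 0" using assms unfolding sublinear_def by (metis half_gt_zero_iff zero_less_one)
  ultimately show ?thesis by simp
qed

lemma sublinear_scale:
  assumes "sublinear q" "0 \<le> c" shows "q (c *\<^sub>R v) = c * q v"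
proof (cases "c = 0")
  case True then show ?thesis using sublinear_zero[OF assms(1)] by simp
next
  case False
  then have c: "0 < c" using assms by simp
  have "q (c *\<^sub>R v) \<le> c * q v" using assms c unfolding sublinear_def by blast
  moreover have "q ((1/c) *\<^sub>R (c *\<^sub>R v)) \<le> (1/c) * q (c *\<^sub>R v)"
    using assms c unfolding sublinear_def by (metis zero_less_divide_1_iff)
  ultimately show ?thesis using c by (simp add: field_simps)
qed

lemma sublinear_minus: "sublinear q \<Longrightarrow> - q (- v) \<le> q v"
  using sublinear_add[of q v "- v"] sublinear_zero[of q] by simp

text \<open>
  This one modification is the whole of the Hahn-Banach argument: a minimal sublinear functional equals
  its own modification in every direction \<open>a\<close>, and is therefore odd, hence linear. Applied once to a given
  functional it also lets the dominated linear functional attain the value \<open>q a\<close> at a prescribed point.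
\<close>

lemma sublinear_smaller_in_direction:
  assumes q: "sublinear q"
  obtains q' where "sublinear q'" "\<And>v. q' v \<le> q v" "q' (- a) \<le> - q a"
proof -
  \<comment> \<open>The largest sublinear functional below \<open>q\<close> whose value at \<open>- a\<close> is at most \<open>- q a\<close>.\<close>
  define q' where "q' v = (INF t\<in>{0..}. q (v + t *\<^sub>R a) - t * q a)" for v
  have lower: "- q (- v) \<le> q (v + t *\<^sub>R a) - t * q a" if "0 \<le> t" for v t
    using sublinear_add[OF q, of "v + t *\<^sub>R a" "- v"] sublinear_scale[OF q that, of a] by simp
  have bdd: "bdd_below ((\<lambda>t. q (v + t *\<^sub>R a) - t * q a) ` {0..})" for v
    by (intro bdd_belowI2[of _ "- q (- v)"] lower) simp
  have upper: "q' v \<le> q (v + t *\<^sub>R a) - t * q a" if "0 \<le> t" for v t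
    unfolding q'_def by (rule cINF_lower[OF bdd]) (use that in simp)
  have greatest: "b \<le> q' v" if "\<And>t. 0 \<le> t \<Longrightarrow> b \<le> q (v + t *\<^sub>R a) - t * q a" for v b
    unfolding q'_def by (rule cINF_greatest) (use that in auto)
  have "q' (v + w) \<le> q' v + q' w" for v w
  proof -
    have "q' (v + w) - (q (w + t *\<^sub>R a) - t * q a) \<le> q' v" if t: "0 \<le> t" for t
    proof (rule greatest)
      fix s :: real assume s: "0 \<le> s"
      have "q' (v + w) \<le> q ((v + w) + (s + t) *\<^sub>R a) - (s + t) * q a"
        using s t by (intro upper) simp
      also have "(v + w) + (s + t) *\<^sub>R a = (v + s *\<^sub>R a) + (w + t *\<^sub>R a)"
        by (simp add: algebra_simps)
      finally show "q' (v + w) - (q (w + t *\<^sub>R a) - t * q a) \<le> q (v + s *\<^sub>R a) - s * q a"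
        using sublinear_add[OF q, of "v + s *\<^sub>R a" "w + t *\<^sub>R a"] by (simp add: algebra_simps)
    qed
    then have "q' (v + w) - q' v \<le> q' w" by (intro greatest) (simp add: algebra_simps)
    then show ?thesis by simp
  qed
  moreover have "q' (c *\<^sub>R v) \<le> c * q' v" if c: "0 < c" for c v
  proof -
    have "q' (c *\<^sub>R v) / c \<le> q' v"
    proof (rule greatest)
      fix t :: real assume t: "0 \<le> t"
      have "q' (c *\<^sub>R v) \<le> q (c *\<^sub>R v + (c * t) *\<^sub>R a) - (c * t) * q a"
        using c t by (intro upper) simp
      also have "c *\<^sub>R v + (c * t) *\<^sub>R a = c *\<^sub>R (v + t *\<^sub>R a)" by (simp add: algebra_simps)
      finally show "q' (c *\<^sub>R v) / c \<le> q (v + t *\<^sub>R a) - t * q a"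
        using c sublinear_scale[OF q, of c "v + t *\<^sub>R a"] by (simp add: field_simps)
    qed
    then show ?thesis using c by (simp add: field_simps)
  qed
  ultimately have "sublinear q'" unfolding sublinear_def by blast
  moreover have "q' v \<le> q v" for v using upper[of 0 v] by simp
  moreover have "q' (- a) \<le> - q a" using upper[of 1 "- a"] sublinear_zero[OF q] by simp
  ultimately show thesis using that by blast
qed

lemma sublinear_linear:
  assumes q: "sublinear q" and neg: "\<And>v. q (- v) \<le> - q v"
  shows "linear q"
proof (rule linearI)
  have neg': "q (- v) = - q v" for v
    using neg[of v] sublinear_minus[OF q, of "- v"] sublinear_minus[OF q, of v] by simp
  show "q (v + w) = q v + q w" for v w
    using sublinear_add[OF q, of v w] sublinear_add[OF q, of "- v" "- w"] neg'[of "v + w"]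
      neg'[of v] neg'[of w] by simp
  show "q (c *\<^sub>R v) = c *\<^sub>R q v" for c v
  proof (cases "0 \<le> c")
    case True then show ?thesis using sublinear_scale[OF q] by simp
  next
    case False
    then have "q ((- c) *\<^sub>R v) = (- c) * q v" by (intro sublinear_scale[OF q]) simp
    then show ?thesis using neg'[of "c *\<^sub>R v"] by simp
  qed
qed

theorem Hahn_Banach:
  fixes q :: "'a::real_vector \<Rightarrow> real"
  assumes q: "sublinear q"
  obtains \<phi> where "linear \<phi>" "\<And>v. \<phi> v \<le> q v"
proof -
  define A where "A = {p. sublinear p \<and> (\<forall>v. p v \<le> q v)}"
  define R where "R p r \<longleftrightarrow> (\<forall>v. r v \<le> p v)" for p r :: "'a \<Rightarrow> real"
  have "\<exists>m\<in>A. \<forall>p\<in>A. R m p \<longrightarrow> p = m"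
  proof (rule predicate_Zorn)
    have "p = r" if "\<forall>v. r v \<le> p v" "\<forall>v. p v \<le> r v" for p r :: "'a \<Rightarrow> real"
      using that by (intro ext order_antisym) auto
    then show "partial_order_on A (relation_of R A)"
      by (intro partial_order_on_relation_ofI) (auto simp: R_def intro: order_trans)
  next
    fix C assume C: "C \<in> Chains (relation_of R A)"
    have CA: "C \<subseteq> A" using C unfolding Chains_def relation_of_def by auto
    have total: "R p r \<or> R r p" if "p \<in> C" "r \<in> C" for p r
      using C that unfolding Chains_def relation_of_def by auto
    show "\<exists>u\<in>A. \<forall>p\<in>C. R p u"
    proof (cases "C = {}")
      case True then show ?thesis using q unfolding A_def by auto
    next
      case False
      define u where "u v = (INF p\<in>C. p v)" for v
      have "- q (- v) \<le> p v" if "p \<in> C" for p v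
      proof -
        have "sublinear p" "p (- v) \<le> q (- v)" using that CA unfolding A_def by auto
        then show ?thesis using sublinear_minus[of p v] by simp
      qed
      then have bdd: "bdd_below ((\<lambda>p. p v) ` C)" for v by (intro bdd_belowI2)
      have upper: "u v \<le> p v" if "p \<in> C" for v p
        unfolding u_def by (rule cINF_lower[OF bdd that])
      have greatest: "b \<le> u v" if "\<And>p. p \<in> C \<Longrightarrow> b \<le> p v" for v b
        unfolding u_def by (rule cINF_greatest[OF False]) (use that in auto)
      have sub: "sublinear p" if "p \<in> C" for p using that CA unfolding A_def by auto
      have "u (v + w) \<le> u v + u w" for v w
      proof -
        have "u (v + w) \<le> p v + r w" if p: "p \<in> C" and r: "r \<in> C" for p r
        proof -
          obtain s where s: "s \<in> C" "\<And>v. s v \<le> p v" "\<And>v. s v \<le> r v"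
            using total[OF p r] p r unfolding R_def by (metis order_refl)
          show ?thesis
            using upper[OF s(1), of "v + w"] sublinear_add[OF sub[OF s(1)], of v w] s(2)[of v] s(3)[of w]
            by simp
        qed
        then have "u (v + w) - r w \<le> u v" if "r \<in> C" for r
          using that by (intro greatest) (simp add: algebra_simps)
        then have "u (v + w) - u v \<le> u w" by (intro greatest) (simp add: algebra_simps)
        then show ?thesis by simp
      qed
      moreover have "u (c *\<^sub>R v) \<le> c * u v" if c: "0 < c" for c v
      proof -
        have "u (c *\<^sub>R v) / c \<le> u v"
        proof (rule greatest)
          fix p assume p: "p \<in> C"
          show "u (c *\<^sub>R v) / c \<le> p v"
            using upper[OF p, of "c *\<^sub>R v"] sublinear_scale[OF sub[OF p], of c v] c
            by (simp add: field_simps)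
        qed
        then show ?thesis using c by (simp add: field_simps)
      qed
      ultimately have "sublinear u" unfolding sublinear_def by blast
      moreover have "u v \<le> q v" for v
      proof -
        obtain p where p: "p \<in> C" using False by auto
        then have "p v \<le> q v" using CA unfolding A_def by auto
        then show ?thesis using upper[OF p, of v] by simp
      qed
      ultimately have "u \<in> A" unfolding A_def by blast
      then show ?thesis using upper unfolding R_def by blast
    qed
  qed
  then obtain m where m: "m \<in> A" and minimal: "\<And>p. p \<in> A \<Longrightarrow> R m p \<Longrightarrow> p = m" by blast
  have sub: "sublinear m" and below: "\<And>v. m v \<le> q v" using m unfolding A_def by auto
  have "m (- v) \<le> - m v" for v
  proof -
    obtain p where p: "sublinear p" "\<And>w. p w \<le> m w" "p (- v) \<le> - m v"
      using sublinear_smaller_in_direction[OF sub] by blast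
    have "p \<in> A" using p(1,2) below unfolding A_def by (auto intro: order_trans)
    then have "p = m" using minimal p(2) unfolding R_def by blast
    then show ?thesis using p(3) by simp
  qed
  then have "linear m" using sublinear_linear[OF sub] by blast
  then show thesis using below that by blast
qed

text \<open>
  The distance to \<open>W\<close> is sublinear, vanishes on \<open>W\<close> and is bounded by the norm, so any linear functional
  below it is continuous and zero on \<open>W\<close>. Lowering it first in direction \<open>a\<close> keeps the functional nonzero there.
\<close>

lemma bounded_functional_vanishing_on_subspace:
  fixes W :: "'a::real_normed_vector set"
  assumes W: "subspace W" and a: "a \<notin> closure W"
  obtains \<Phi> :: "'a dual" where "\<And>w. w \<in> W \<Longrightarrow> \<Phi> w = 0" "\<Phi> a \<noteq> 0"
proof -
  define q where "q v = infdist v W" for v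
  have ne: "W \<noteq> {}" using W subspace_0 by blast
  have near: "\<exists>w\<in>W. norm (v - w) < q v + e" if "0 < e" for v e
  proof (rule ccontr)
    assume "\<not> ?thesis"
    then have "q v + e \<le> infdist v W"
      unfolding infdist_notempty[OF ne] by (intro cINF_greatest ne) (auto simp: dist_norm not_less)
    then show False using that unfolding q_def by simp
  qed
  have le: "q v \<le> norm (v - w)" if "w \<in> W" for v w
    using infdist_le[OF that, of v] unfolding q_def by (simp add: dist_norm)
  have "q (v + w) \<le> q v + q w" for v w
  proof (rule field_le_epsilon)
    fix e :: real assume e: "0 < e"
    obtain v' where v': "v' \<in> W" "norm (v - v') < q v + e / 2" using near[of "e/2" v] e by auto
    obtain w' where w': "w' \<in> W" "norm (w - w') < q w + e / 2" using near[of "e/2" w] e by auto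
    have "q (v + w) \<le> norm ((v + w) - (v' + w'))" using le subspace_add[OF W v'(1) w'(1)] by blast
    also have "\<dots> \<le> norm (v - v') + norm (w - w')" by (rule norm_diff_triangle_ineq)
    finally show "q (v + w) \<le> q v + q w + e" using v'(2) w'(2) by (simp add: field_simps)
  qed
  moreover have "q (c *\<^sub>R v) \<le> c * q v" if c: "0 < c" for c v
  proof (rule field_le_epsilon)
    fix e :: real assume e: "0 < e"
    obtain w where w: "w \<in> W" "norm (v - w) < q v + e / c" using near[of "e/c" v] e c by auto
    have "q (c *\<^sub>R v) \<le> norm (c *\<^sub>R v - c *\<^sub>R w)" using le subspace_scale[OF W w(1)] by blast
    also have "\<dots> = c * norm (v - w)" using c by (metis abs_of_pos norm_scaleR scaleR_right_diff_distrib)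
    also have "\<dots> \<le> c * (q v + e / c)" using w(2) c by simp
    also have "\<dots> = c * q v + e" using c by (simp add: field_simps)
    finally show "q (c *\<^sub>R v) \<le> c * q v + e" .
  qed
  ultimately have "sublinear q" unfolding sublinear_def by blast
  then obtain q' where q': "sublinear q'" "\<And>v. q' v \<le> q v" "q' (- a) \<le> - q a"
    using sublinear_smaller_in_direction by blast
  obtain \<phi> where lin: "linear \<phi>" and \<phi>: "\<And>v. \<phi> v \<le> q' v" using Hahn_Banach[OF q'(1)] by blast
  have \<phi>q: "\<phi> v \<le> q v" for v using \<phi>[of v] q'(2)[of v] by simp
  have qn: "q v \<le> norm v" for v using le[OF subspace_0[OF W], of v] by simp
  have neg: "\<phi> (- v) = - \<phi> v" for v using linear_neg[OF lin] by blast
  have "norm (\<phi> v) \<le> norm v * 1" for v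
    using \<phi>q[of v] qn[of v] \<phi>q[of "- v"] qn[of "- v"] neg[of v] by simp
  then have bl: "bounded_linear \<phi>"
    using lin unfolding bounded_linear_def bounded_linear_axioms_def by blast
  have zero: "\<phi> w = 0" if w: "w \<in> W" for w
  proof -
    have "q w \<le> 0" "q (- w) \<le> 0" using le[OF w, of w] le[OF subspace_neg[OF W w], of "- w"] by simp_all
    then show ?thesis using \<phi>q[of w] \<phi>q[of "- w"] neg[of w] by simp
  qed
  have "0 < q a" using a ne in_closure_iff_infdist_zero[OF ne, of a] infdist_nonneg[of a W]
    unfolding q_def by simp
  moreover have "\<phi> (- a) \<le> - q a" using \<phi>[of "- a"] q'(3) by simp
  ultimately have "\<phi> a \<noteq> 0" using neg[of a] by simp
  then show thesis using that[of "Blinfun \<phi>"] zero by (simp add: bounded_linear_Blinfun_apply[OF bl])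
qed

section \<open>Extended-valued convex functions and their gradients\<close>

abbreviation fval :: "('a \<Rightarrow> ereal) \<Rightarrow> 'a \<Rightarrow> real" where
  "fval f x \<equiv> real_of_ereal (f x)"

definition extended_convex :: "('a::real_vector \<Rightarrow> ereal) \<Rightarrow> bool" where
  "extended_convex f \<longleftrightarrow> (\<forall>x. f x \<noteq> -\<infinity>) \<and> convex_fun f"

lemma Gamma0_extended_convex: "f \<in> Gamma0 \<Longrightarrow> extended_convex f"
  by (simp add: Gamma0_def proper_fun_def extended_convex_def)

lemma Gamma0_lsc: "f \<in> Gamma0 \<Longrightarrow> lsc_fun f"
  by (simp add: Gamma0_def)

lemma fval_ereal:
  assumes "extended_convex f" "x \<in> edom f" shows "f x = ereal (fval f x)"
  using assms by (cases "f x") (auto simp: extended_convex_def edom_def)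

lemma convex_on_fval:
  assumes f: "extended_convex f" shows "convex_on (edom f) (fval f)"
proof (rule convex_onI)
  have *: "(1 - t) *\<^sub>R x + t *\<^sub>R y \<in> edom f \<and>
      fval f ((1 - t) *\<^sub>R x + t *\<^sub>R y) \<le> (1 - t) * fval f x + t * fval f y"
    if t: "0 < t" "t < 1" and x: "x \<in> edom f" and y: "y \<in> edom f" for t x y
  proof -
    have "f ((1 - t) *\<^sub>R x + t *\<^sub>R y) \<le> ereal (1 - t) * f x + ereal t * f y"
      using f t unfolding extended_convex_def convex_fun_def by blast
    also have "\<dots> = ereal ((1 - t) * fval f x + t * fval f y)"
      by (subst (1 2) fval_ereal[OF f]) (use x y in auto)
    finally have le: "f ((1 - t) *\<^sub>R x + t *\<^sub>R y) \<le> ereal ((1 - t) * fval f x + t * fval f y)" .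
    then have "(1 - t) *\<^sub>R x + t *\<^sub>R y \<in> edom f" unfolding edom_def by auto
    then show ?thesis using le fval_ereal[OF f, of "(1 - t) *\<^sub>R x + t *\<^sub>R y"] by (metis ereal_less_eq(3))
  qed
  show "fval f ((1 - t) *\<^sub>R x + t *\<^sub>R y) \<le> (1 - t) * fval f x + t * fval f y"
    if "0 < t" "t < 1" "x \<in> edom f" "y \<in> edom f" for t x y
    using * that by blast
  show "convex (edom f)" unfolding convex_alt
  proof (intro ballI allI impI)
    fix x y and u :: real assume "x \<in> edom f" "y \<in> edom f" "0 \<le> u \<and> u \<le> 1"
    then show "(1 - u) *\<^sub>R x + u *\<^sub>R y \<in> edom f"
      using *[of u x y] by (cases "u = 0 \<or> u = 1") auto
  qed
qed

lemma convex_edom: "extended_convex f \<Longrightarrow> convex (edom f)"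
  using convex_on_fval convex_on_imp_convex by blast

lemma convex_on_difference_quotient_le:
  fixes k :: "'a::real_vector \<Rightarrow> real"
  assumes k: "convex_on S k" and S: "x \<in> S" "y \<in> S" and t: "0 < t" "t \<le> 1"
  shows "(k (y + t *\<^sub>R (x - y)) - k y) / t \<le> k x - k y"
proof -
  have "k ((1 - t) *\<^sub>R y + t *\<^sub>R x) \<le> (1 - t) * k y + t * k x"
    using convex_onD[OF k] S t by simp
  moreover have "(1 - t) *\<^sub>R y + t *\<^sub>R x = y + t *\<^sub>R (x - y)" by (simp add: algebra_simps)
  ultimately show ?thesis using t by (simp add: field_simps)
qed

text \<open>
  Only the derivative along the segment is involved, so the lemma applies equally to a convex function and to
  a difference \<open>L\<phi> - F\<close> that is convex on a smaller set.
\<close>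

lemma convex_on_directional_derivative_le:
  fixes k :: "'a::real_vector \<Rightarrow> real"
  assumes k: "convex_on S k" and S: "x \<in> S" "y \<in> S"
    and D: "((\<lambda>t. k (y + t *\<^sub>R (x - y))) has_real_derivative D) (at 0)"
  shows "D \<le> k x - k y"
proof (rule tendsto_upperbound)
  show "((\<lambda>t. (k (y + t *\<^sub>R (x - y)) - k y) / t) \<longlongrightarrow> D) (at_right 0)"
    using D unfolding DERIV_def by (simp add: filterlim_at_split)
  show "eventually (\<lambda>t. (k (y + t *\<^sub>R (x - y)) - k y) / t \<le> k x - k y) (at_right 0)"
    by (rule eventually_at_rightI[of 0 1])
      (use convex_on_difference_quotient_le[OF k S] in auto)
qed auto

lemma gateaux_gradient_unique:
  assumes "has_gateaux_gradient f u x" "has_gateaux_gradient f v x" shows "u = v"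
  using assms unfolding has_gateaux_gradient_def by (intro blinfun_eqI) (blast intro: DERIV_unique)

lemma grad_eq: "has_gateaux_gradient f u x \<Longrightarrow> grad f x = u"
  unfolding grad_def using gateaux_gradient_unique by blast

lemma has_gateaux_gradient_grad:
  "gateaux_differentiable_on f S \<Longrightarrow> x \<in> S \<Longrightarrow> has_gateaux_gradient f (grad f x) x"
  unfolding gateaux_differentiable_on_def using grad_eq by metis

lemma gateaux_gradient_le:
  assumes f: "extended_convex f" and u: "has_gateaux_gradient f u y" and x: "x \<in> edom f"
  shows "u (x - y) \<le> fval f x - fval f y"
proof (rule convex_on_directional_derivative_le[OF convex_on_fval[OF f] x])
  show "y \<in> edom f" using u interior_subset unfolding has_gateaux_gradient_def by blast
  show "((\<lambda>t. fval f (y + t *\<^sub>R (x - y))) has_real_derivative u (x - y)) (at 0)"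
    using u unfolding has_gateaux_gradient_def by blast
qed

lemma subdiffI:
  assumes f: "extended_convex f" and x: "x \<in> edom f"
    and le: "\<And>y. y \<in> edom f \<Longrightarrow> fval f x + blinfun_apply u (y - x) \<le> fval f y"
  shows "u \<in> subdiff f x"
proof -
  have "f x + ereal (u (y - x)) \<le> f y" for y
  proof (cases "y \<in> edom f")
    case True
    then show ?thesis using le fval_ereal[OF f x] fval_ereal[OF f True] by (metis ereal_less_eq(3) plus_ereal.simps(1))
  qed (simp add: edom_def)
  then show ?thesis using x unfolding subdiff_def by simp
qed

lemma subdiffD:
  assumes f: "extended_convex f" and u: "u \<in> subdiff f x" and y: "y \<in> edom f"
  shows "fval f x + u (y - x) \<le> fval f y"
proof -
  have "x \<in> edom f" "f x + ereal (u (y - x)) \<le> f y"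
    using u unfolding subdiff_def by auto
  then show ?thesis using fval_ereal[OF f] y by (metis ereal_less_eq(3) plus_ereal.simps(1))
qed

lemma subdiff_edom: "u \<in> subdiff f x \<Longrightarrow> x \<in> edom f"
  by (simp add: subdiff_def)

lemma gateaux_gradient_in_subdiff:
  assumes f: "extended_convex f" and u: "has_gateaux_gradient f u y"
  shows "u \<in> subdiff f y"
proof (rule subdiffI[OF f])
  show "y \<in> edom f" using u interior_subset unfolding has_gateaux_gradient_def by blast
  show "fval f y + u (x - y) \<le> fval f x" if "x \<in> edom f" for x
    using gateaux_gradient_le[OF f u that] by simp
qed

subsection \<open>Semicontinuity, continuity and weakly continuous gradients\<close>

lemma open_superlevel:
  fixes f :: "'a::topological_space \<Rightarrow> ereal"
  assumes "lsc_fun f" shows "open {x. a < f x}"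
proof (subst open_subopen, intro ballI)
  fix x assume x: "x \<in> {x. a < f x}"
  then have "a < Liminf (at x) f" using assms unfolding lsc_fun_def by (auto intro: less_le_trans)
  then have "eventually (\<lambda>y. a < f y) (nhds x)"
    using x less_LiminfD[of a "at x" f] unfolding eventually_at_filter
    by (auto elim!: eventually_mono)
  then show "\<exists>S. open S \<and> x \<in> S \<and> S \<subseteq> {x. a < f x}"
    unfolding eventually_nhds by auto
qed

lemma closed_sublevel:
  fixes f :: "'a::topological_space \<Rightarrow> ereal"
  assumes "lsc_fun f" shows "closed {x. f x \<le> a}"
proof -
  have "{x. f x \<le> a} = - {x. a < f x}" by auto
  then show ?thesis using open_superlevel[OF assms, of a] by (simp add: closed_def)
qed

text \<open>
  A ball in the domain is the union of the closed sublevel sets \<open>f \<le> n\<close>, so by Baire one of them contains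
  a ball, centred possibly elsewhere. Convexity transports this upper bound to \<open>x\<close> by shrinking towards a point \<open>w\<close>
  on the other side of \<open>x\<close>, and reflection at \<open>x\<close> turns it into a lower bound.
\<close>

lemma Gamma0_bounded_near_interior:
  fixes f :: "'a::banach \<Rightarrow> ereal"
  assumes f: "f \<in> Gamma0" and x: "x \<in> interior (edom f)"
  obtains r B where "0 < r" "ball x r \<subseteq> edom f" "\<And>y. y \<in> ball x r \<Longrightarrow> \<bar>fval f y\<bar> \<le> B"
proof -
  have fc: "extended_convex f" using f by (rule Gamma0_extended_convex)
  note cvx = convex_on_fval[OF fc]
  obtain \<rho> where \<rho>: "0 < \<rho>" "cball x \<rho> \<subseteq> edom f" using x unfolding mem_interior_cball by blast
  define L where "L n = {y. f y \<le> ereal (real n)} \<inter> cball x \<rho>" for n :: nat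
  have clL: "closed (L n)" for n
    unfolding L_def using closed_sublevel[OF Gamma0_lsc[OF f]] by blast
  have union: "(\<Union>n. L n) = cball x \<rho>"
  proof -
    have "\<exists>n. f y \<le> ereal (real n)" if "y \<in> cball x \<rho>" for y
    proof -
      obtain n where "fval f y \<le> real n" using real_arch_simple by blast
      moreover have "f y = ereal (fval f y)" using fval_ereal[OF fc] that \<rho>(2) by blast
      ultimately show ?thesis by (metis ereal_less_eq(3))
    qed
    then show ?thesis unfolding L_def by blast
  qed
  have "\<exists>n. interior (L n) \<noteq> {}"
  proof (rule ccontr)
    assume "\<nexists>n. interior (L n) \<noteq> {}"
    then have "euclidean interior_of \<Union>(range L) = {}"
      using clL by (intro Baire_category_alt) (auto simp: completely_metrizable_space_euclidean)
    then have "interior (cball x \<rho>) = {}" using union by simp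
    then show False using \<rho>(1) ball_subset_cball interior_maximal[OF ball_subset_cball open_ball, of x \<rho>]
      by force
  qed
  then obtain n z s where s: "0 < s" "ball z s \<subseteq> L n"
    unfolding mem_interior[symmetric] by (metis ex_in_conv mem_interior)
  \<comment> \<open>\<open>x\<close> is a convex combination of \<open>z\<close> and \<open>w = x + \<theta>(x - z)\<close>, with weight \<open>a\<close> on \<open>z\<close>.\<close>
  define \<theta> where "\<theta> = \<rho> / (norm (x - z) + 1)"
  have \<theta>: "0 < \<theta>" using \<rho>(1) unfolding \<theta>_def by (simp add: add_nonneg_pos)
  have "\<theta> * norm (x - z) \<le> \<rho>"
    using \<rho>(1) unfolding \<theta>_def by (simp add: divide_le_eq add_nonneg_pos mult_left_mono)
  then have w: "x + \<theta> *\<^sub>R (x - z) \<in> edom f" (is "?w \<in> _")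
    using \<rho>(2) \<theta> by (intro subsetD[OF \<rho>(2)]) (simp add: dist_norm)
  define a where "a = \<theta> / (1 + \<theta>)"
  have a: "0 < a" "a < 1" "a * (1 + \<theta>) = \<theta>" using \<theta> unfolding a_def by auto
  define fw where "fw = fval f ?w"
  define K where "K = \<bar>fw\<bar> + real n"
  define r where "r = min \<rho> (s * a)"
  have r: "0 < r" "r \<le> \<rho>" "r \<le> s * a" using \<rho>(1) s(1) a unfolding r_def by auto
  have up: "fval f y \<le> K" if y: "y \<in> ball x r" for y
  proof -
    define z' where "z' = z + (1/a) *\<^sub>R (y - x)"
    have "norm (y - x) < s * a" using y r by (simp add: dist_norm norm_minus_commute)
    then have "norm ((1/a) *\<^sub>R (y - x)) < s" using a by (simp add: divide_less_eq)
    then have "z' \<in> ball z s" unfolding z'_def by (simp add: dist_norm norm_minus_commute)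
    then have z': "z' \<in> edom f" "f z' \<le> ereal (real n)" using s(2) \<rho>(2) unfolding L_def by auto
    have fz': "fval f z' \<le> real n" using z' fval_ereal[OF fc z'(1)] by (metis ereal_less_eq(3))
    have "(1 - a) *\<^sub>R ?w + a *\<^sub>R z' = (1 - a) *\<^sub>R x + ((1 - a) * \<theta>) *\<^sub>R (x - z) + a *\<^sub>R z + (y - x)"
      using a unfolding z'_def by (simp add: algebra_simps)
    also have "(1 - a) * \<theta> = a" using a by (simp add: algebra_simps)
    finally have "(1 - a) *\<^sub>R ?w + a *\<^sub>R z' = y" by (simp add: algebra_simps)
    then have "fval f y \<le> (1 - a) * fw + a * fval f z'"
      using convex_onD[OF cvx, of a ?w z'] a w z'(1) unfolding fw_def by simp
    also have "\<dots> \<le> (1 - a) * \<bar>fw\<bar> + a * real n"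
      using a fz' by (intro add_mono mult_left_mono) auto
    also have "\<dots> \<le> K" unfolding K_def using a
      by (intro add_mono mult_left_le_one_le) auto
    finally show ?thesis .
  qed
  have sub: "ball x r \<subseteq> edom f" using r \<rho>(2) by force
  have "\<bar>fval f y\<bar> \<le> K + 2 * \<bar>fval f x\<bar>" if y: "y \<in> ball x r" for y
  proof -
    have y': "2 *\<^sub>R x - y \<in> ball x r"
      using y by (simp add: dist_norm scaleR_2 norm_minus_commute algebra_simps)
    have "(1 - 1/2) *\<^sub>R y + (1/2) *\<^sub>R (2 *\<^sub>R x - y) = x" by (simp add: algebra_simps)
    then have "fval f x \<le> (1 - 1/2) * fval f y + (1/2) * fval f (2 *\<^sub>R x - y)"
      using convex_onD[OF cvx, of "1/2" y "2 *\<^sub>R x - y"] sub y y' by (auto simp: subset_eq)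
    then have "2 * fval f x - K \<le> fval f y" using up[OF y'] by (simp add: field_simps)
    then show ?thesis using up[OF y] by linarith
  qed
  then show thesis using that[OF r(1) sub] by blast
qed

lemma Gamma0_continuous_interior:
  fixes f :: "'a::banach \<Rightarrow> ereal"
  assumes f: "f \<in> Gamma0" shows "continuous_on (interior (edom f)) (fval f)"
proof -
  have "isCont (fval f) x" if x: "x \<in> interior (edom f)" for x
  proof -
    obtain r B where r: "0 < r" "ball x r \<subseteq> edom f" "\<And>y. y \<in> ball x r \<Longrightarrow> \<bar>fval f y\<bar> \<le> B"
      using Gamma0_bounded_near_interior[OF f x] by blast
    have "convex_on (ball x r) (fval f)"
      using convex_on_subset[OF convex_on_fval[OF Gamma0_extended_convex[OF f]] r(2)] by simp
    then have "continuous_on (ball x r) (fval f)"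
      using r(3) by (intro convex_on_bounded_continuous) auto
    then show ?thesis using r(1) continuous_on_eq_continuous_at[OF open_ball] by (metis centre_in_ball)
  qed
  then show ?thesis by (simp add: continuous_at_imp_continuous_on)
qed

text \<open>
  The gradient is continuous from the norm to the weak* topology. Its pairing with a direction is an infimum of
  difference quotients, which are continuous in the base point; this makes the pairing upper semicontinuous, and
  the opposite direction gives lower semicontinuity. Letting the direction vary continuously with the base point
  costs nothing and covers the term \<open>\<langle>\<nabla>\<phi>(y), a - y\<rangle>\<close> of a Bregman divergence.
\<close>

lemma continuous_on_gradient_pairing:
  fixes f :: "'a::banach \<Rightarrow> ereal"
  assumes f: "f \<in> Gamma0" and U: "open U"
    and diff: "gateaux_differentiable_on f U" and v: "continuous_on U v"
  shows "continuous_on U (\<lambda>y. (grad f y) (v y))"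
proof -
  have fc: "extended_convex f" using f by (rule Gamma0_extended_convex)
  have G: "has_gateaux_gradient f (grad f y) y" if "y \<in> U" for y
    using has_gateaux_gradient_grad[OF diff that] .
  then have Ui: "U \<subseteq> interior (edom f)" unfolding has_gateaux_gradient_def by blast
  have cont: "continuous_on U (fval f)"
    using Gamma0_continuous_interior[OF f] Ui continuous_on_subset by blast
  have upper: "eventually (\<lambda>y. (grad f y) (w y) < (grad f x) (w x) + e) (at x)"
    if x: "x \<in> U" and w: "continuous_on U w" and e: "0 < e" for x w and e :: real
  proof -
    have wx: "isCont w x" using w x unfolding continuous_on_eq_continuous_at[OF U] by blast
    have fx: "isCont (fval f) x" using cont x unfolding continuous_on_eq_continuous_at[OF U] by blast
    have "((\<lambda>t. fval f (x + t *\<^sub>R w x)) has_real_derivative (grad f x) (w x)) (at 0)"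
      using G[OF x] unfolding has_gateaux_gradient_def by blast
    then have "((\<lambda>t. (fval f (x + t *\<^sub>R w x) - fval f x) / t) \<longlongrightarrow> (grad f x) (w x)) (at 0)"
      unfolding DERIV_def by simp
    then have "((\<lambda>t. (fval f (x + t *\<^sub>R w x) - fval f x) / t) \<longlongrightarrow> (grad f x) (w x)) (at_right 0)"
      using filterlim_at_split by blast
    then have 1: "eventually (\<lambda>t. (fval f (x + t *\<^sub>R w x) - fval f x) / t < (grad f x) (w x) + e) (at_right 0)"
      using e by (intro order_tendstoD) auto
    have "((\<lambda>t. x + t *\<^sub>R w x) \<longlongrightarrow> x + 0 *\<^sub>R w x) (at_right (0::real))" by (intro tendsto_intros)
    then have 2: "eventually (\<lambda>t. x + t *\<^sub>R w x \<in> U) (at_right (0::real))"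
      using U x by (intro topological_tendstoD) auto
    have "eventually (\<lambda>t::real. 0 < t) (at_right 0)" by (simp add: eventually_at_right_less)
    with 1 2 have "eventually (\<lambda>t. 0 < t \<and> x + t *\<^sub>R w x \<in> U \<and>
        (fval f (x + t *\<^sub>R w x) - fval f x) / t < (grad f x) (w x) + e) (at_right 0)"
      by eventually_elim simp
    from eventually_happens[OF this] obtain t :: real where t: "0 < t" "x + t *\<^sub>R w x \<in> U"
      "(fval f (x + t *\<^sub>R w x) - fval f x) / t < (grad f x) (w x) + e"
      by (auto simp: trivial_limit_at_right_real)
    have lim: "((\<lambda>y. y + t *\<^sub>R w y) \<longlongrightarrow> x + t *\<^sub>R w x) (at x)"
      using wx by (intro tendsto_intros) (simp add: isCont_def)
    have "isCont (fval f) (x + t *\<^sub>R w x)" using cont t(2) unfolding continuous_on_eq_continuous_at[OF U] by blast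
    then have "((\<lambda>y. fval f (y + t *\<^sub>R w y)) \<longlongrightarrow> fval f (x + t *\<^sub>R w x)) (at x)"
      by (rule isCont_tendsto_compose[OF _ lim])
    moreover have "(fval f \<longlongrightarrow> fval f x) (at x)" using fx by (simp add: isCont_def)
    ultimately have "((\<lambda>y. (fval f (y + t *\<^sub>R w y) - fval f y) / t) \<longlongrightarrow> (fval f (x + t *\<^sub>R w x) - fval f x) / t) (at x)"
      using t(1) by (intro tendsto_divide tendsto_diff tendsto_const) auto
    then have 3: "eventually (\<lambda>y. (fval f (y + t *\<^sub>R w y) - fval f y) / t < (grad f x) (w x) + e) (at x)"
      using t(3) by (rule order_tendstoD)
    have 4: "eventually (\<lambda>y. y + t *\<^sub>R w y \<in> U) (at x)"
      using lim U t(2) by (intro topological_tendstoD)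
    have 5: "eventually (\<lambda>y. y \<in> U) (at x)" using U x by (simp add: eventually_at_in_open')
    show ?thesis using 3 4 5
    proof eventually_elim
      case (elim y)
      have "(grad f y) ((y + t *\<^sub>R w y) - y) \<le> fval f (y + t *\<^sub>R w y) - fval f y"
        using elim Ui interior_subset by (intro gateaux_gradient_le[OF fc G]) blast+
      then have "(grad f y) (w y) \<le> (fval f (y + t *\<^sub>R w y) - fval f y) / t"
        using t(1) by (simp add: blinfun.scaleR_right field_simps)
      then show ?case using elim by simp
    qed
  qed
  have "isCont (\<lambda>y. (grad f y) (v y)) x" if x: "x \<in> U" for x
    unfolding isCont_def
  proof (rule tendstoI)
    fix e :: real assume e: "0 < e"
    have "continuous_on U (\<lambda>y. - v y)" using v by (intro continuous_intros)
    from upper[OF x v e] upper[OF x this e]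
    show "eventually (\<lambda>y. dist ((grad f y) (v y)) ((grad f x) (v x)) < e) (at x)"
      by eventually_elim (auto simp: dist_real_def blinfun.minus_right abs_if)
  qed
  then show ?thesis by (simp add: continuous_at_imp_continuous_on)
qed

section \<open>A subdifferential sum rule at minimisers\<close>

text \<open>
  The subdifferential sum rule at a minimiser of \<open>f + b + g\<close> over \<open>C\<close>, restricted to what it says about \<open>g\<close>.
  The positively homogeneous hull \<open>q\<close> of the perturbation function
  \<open>v \<mapsto> inf {f(z) + b(z) + g(y) | z - y = v} - min\<close> is finite and sublinear: it is bounded below because
  \<open>xs\<close> is a minimiser, and above by a multiple of the norm because \<open>f\<close> is bounded near the interior point \<open>a\<close>, which lies in
  the domain of \<open>g\<close>. The negative of a linear functional below \<open>q\<close> is a subgradient of \<open>g\<close>.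
\<close>

lemma minimiser_of_sum_in_dom_subdiff:
  fixes f g :: "'a::banach \<Rightarrow> ereal" and b :: "'a dual"
  assumes f: "f \<in> Gamma0" and g: "extended_convex g"
    and C: "convex C" "C \<subseteq> edom f"
    and a: "a \<in> interior C" "a \<in> edom g"
    and xs: "xs \<in> C" "xs \<in> edom g"
    and min: "\<And>y. y \<in> C \<Longrightarrow> y \<in> edom g \<Longrightarrow>
      fval f xs + b xs + fval g xs \<le> fval f y + b y + fval g y"
  shows "xs \<in> dom_subdiff g"
proof -
  have fc: "extended_convex f" using f by (rule Gamma0_extended_convex)
  define k where "k y = fval f y + b y" for y
  define E where "E z y = k z + fval g y - (k xs + fval g xs)" for z y
  have k: "convex_on C k"
  proof (rule convex_onI[OF _ C(1)])
    fix t :: real and x y assume t: "0 < t" "t < 1" and xy: "x \<in> C" "y \<in> C"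
    have "fval f ((1 - t) *\<^sub>R x + t *\<^sub>R y) \<le> (1 - t) * fval f x + t * fval f y"
      using convex_onD[OF convex_on_fval[OF fc]] t xy C(2) by (simp add: subset_eq)
    moreover have "b ((1 - t) *\<^sub>R x + t *\<^sub>R y) = (1 - t) * b x + t * b y"
      by (simp add: blinfun.add_right blinfun.scaleR_right)
    ultimately show "k ((1 - t) *\<^sub>R x + t *\<^sub>R y) \<le> (1 - t) * k x + t * k y"
      unfolding k_def by (simp add: distrib_left)
  qed
  have E_convex: "E ((1 - s) *\<^sub>R z + s *\<^sub>R z') ((1 - s) *\<^sub>R y + s *\<^sub>R y') \<le> (1 - s) * E z y + s * E z' y'"
    and E_dom: "(1 - s) *\<^sub>R z + s *\<^sub>R z' \<in> C" "(1 - s) *\<^sub>R y + s *\<^sub>R y' \<in> edom g"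
    if s: "0 \<le> s" "s \<le> 1" and z: "z \<in> C" "z' \<in> C" and y: "y \<in> edom g" "y' \<in> edom g" for s z z' y y'
  proof -
    have "k ((1 - s) *\<^sub>R z + s *\<^sub>R z') \<le> (1 - s) * k z + s * k z'"
      using convex_onD[OF k] s z by simp
    moreover have "fval g ((1 - s) *\<^sub>R y + s *\<^sub>R y') \<le> (1 - s) * fval g y + s * fval g y'"
      using convex_onD[OF convex_on_fval[OF g]] s y by simp
    ultimately show "E ((1 - s) *\<^sub>R z + s *\<^sub>R z') ((1 - s) *\<^sub>R y + s *\<^sub>R y') \<le> (1 - s) * E z y + s * E z' y'"
      unfolding E_def by (simp add: algebra_simps)
    show "(1 - s) *\<^sub>R z + s *\<^sub>R z' \<in> C" "(1 - s) *\<^sub>R y + s *\<^sub>R y' \<in> edom g"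
      using C(1) convex_edom[OF g] s z y by (simp_all add: convex_alt)
  qed
  \<comment> \<open>Difference quotients of the perturbation function at \<open>0\<close> in direction \<open>v\<close>; \<open>q\<close> below is their infimum.\<close>
  define A where "A v = {E z y / t | z y t. z \<in> C \<and> y \<in> edom g \<and> 0 < t \<and> z - y = t *\<^sub>R v}" for v
  have A_memI: "E z y / t \<in> A v" if "z \<in> C" "y \<in> edom g" "0 < t" "z - y = t *\<^sub>R v" for z y t v
    using that unfolding A_def by blast
  \<comment> \<open>Two representations of \<open>v\<close> and \<open>w\<close> mix to one of \<open>v + w\<close>, with the weights that clear \<open>t\<close> and \<open>t'\<close>.\<close>
  have mix: "\<exists>z'' y'' t''. z'' \<in> C \<and> y'' \<in> edom g \<and> 0 < t'' \<and> z'' - y'' = t'' *\<^sub>R (v + w) \<and>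
      E z'' y'' / t'' \<le> E z y / t + E z' y' / t'"
    if z: "z \<in> C" "y \<in> edom g" "0 < t" "z - y = t *\<^sub>R v"
      and z': "z' \<in> C" "y' \<in> edom g" "0 < t'" "z' - y' = t' *\<^sub>R w" for z y t v z' y' t' w
  proof -
    define s where "s = t / (t + t')"
    have s: "0 \<le> s" "s \<le> 1" "1 - s = t' / (t + t')" using z z' unfolding s_def by (auto simp: field_simps)
    define t'' where "t'' = t * t' / (t + t')"
    have t'': "0 < t''" using z z' unfolding t''_def by simp
    have st: "(1 - s) * t = t''" "s * t' = t''" unfolding s(3) unfolding t''_def s_def by simp_all
    let ?z = "(1 - s) *\<^sub>R z + s *\<^sub>R z'" and ?y = "(1 - s) *\<^sub>R y + s *\<^sub>R y'"
    have "?z - ?y = (1 - s) *\<^sub>R (z - y) + s *\<^sub>R (z' - y')" by (simp add: algebra_simps)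
    also have "\<dots> = t'' *\<^sub>R (v + w)" unfolding z z' by (simp add: st scaleR_add_right)
    finally have 1: "?z - ?y = t'' *\<^sub>R (v + w)" .
    have "E ?z ?y / t'' \<le> ((1 - s) * E z y + s * E z' y') / t''"
      using E_convex[OF s(1,2) z(1) z'(1) z(2) z'(2)] t'' by (simp add: divide_right_mono)
    also have "\<dots> = (1 - s) * E z y / t'' + s * E z' y' / t''" by (simp add: add_divide_distrib)
    also have "(1 - s) * E z y / t'' = E z y / t"
      using z(3) z'(3) unfolding s(3) t''_def by simp
    also have "s * E z' y' / t'' = E z' y' / t'" using z(3) z'(3) unfolding s_def t''_def by simp
    finally show ?thesis using 1 t'' E_dom[OF s(1,2) z(1) z'(1) z(2) z'(2)] by blast
  qed
  have E_diag: "0 \<le> E y y" if "y \<in> C" "y \<in> edom g" for y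
    using min[OF that] unfolding E_def k_def by simp
  have opposite: "0 \<le> r + r'" if "r \<in> A v" "r' \<in> A (- v)" for r r' v
  proof -
    obtain z y t where 1: "z \<in> C" "y \<in> edom g" "0 < t" "z - y = t *\<^sub>R v" "r = E z y / t"
      using \<open>r \<in> A v\<close> unfolding A_def by blast
    obtain z' y' t' where 2: "z' \<in> C" "y' \<in> edom g" "0 < t'" "z' - y' = t' *\<^sub>R (- v)" "r' = E z' y' / t'"
      using \<open>r' \<in> A (- v)\<close> unfolding A_def by blast
    obtain z'' y'' t'' where 3: "z'' \<in> C" "y'' \<in> edom g" "0 < t''" "z'' - y'' = t'' *\<^sub>R (v + - v)"
      "E z'' y'' / t'' \<le> E z y / t + E z' y' / t'"
      using mix[OF 1(1-4) 2(1-4)] by blast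
    then have "y'' = z''" by simp
    then have "0 \<le> E z'' y''" using E_diag 3 by blast
    then have "0 \<le> E z'' y'' / t''" using 3 by simp
    then show ?thesis using 3(5) 1(5) 2(5) by linarith
  qed
  obtain r1 B where r1: "0 < r1" "\<And>y. y \<in> ball a r1 \<Longrightarrow> \<bar>fval f y\<bar> \<le> B"
    using Gamma0_bounded_near_interior[OF f] a(1) C(2) interior_mono by (metis subsetD)
  obtain r2 where r2: "0 < r2" "ball a r2 \<subseteq> C" using a(1) unfolding mem_interior by blast
  define r where "r = min r1 r2 / 2"
  have r: "0 < r" "r < r1" "r < r2" using r1(1) r2(1) unfolding r_def by (auto simp: min_def)
  define K where "K = \<bar>B\<bar> + \<bar>b a\<bar> + norm b * r + \<bar>fval g a\<bar> + \<bar>k xs + fval g xs\<bar>"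
  have A_bound: "\<exists>e\<in>A v. e \<le> K / r * norm v" if v: "v \<noteq> 0" for v
  proof -
    define t where "t = r / norm v"
    have t: "0 < t" "t * norm v = r" using r v unfolding t_def by auto
    have n: "norm (t *\<^sub>R v) = r" using t by simp
    have "a + t *\<^sub>R v \<in> ball a r1" "a + t *\<^sub>R v \<in> ball a r2" using r n by (simp_all add: dist_norm)
    then have f1: "\<bar>fval f (a + t *\<^sub>R v)\<bar> \<le> B" and c: "a + t *\<^sub>R v \<in> C" using r1(2) r2(2) by auto
    have "b (t *\<^sub>R v) \<le> norm b * r" using norm_blinfun[of b "t *\<^sub>R v"] n by simp
    then have "E (a + t *\<^sub>R v) a \<le> K"
      using f1 unfolding E_def k_def K_def blinfun.add_right by linarith
    then have "E (a + t *\<^sub>R v) a / t \<le> K / t" using t(1) by (simp add: divide_right_mono)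
    also have "K / t = K / r * norm v" using v unfolding t_def by simp
    finally show ?thesis using A_memI[OF c a(2) t(1), of v] by auto
  qed
  have A0: "0 \<in> A 0" using A_memI[OF xs(1,2), of 1 0] unfolding E_def by simp
  have ne: "A v \<noteq> {}" for v using A_bound[of v] A0 by (cases "v = 0") auto
  have bdd: "bdd_below (A v)" for v
  proof -
    obtain r' where "r' \<in> A (- v)" using ne by blast
    then have "- r' \<le> e" if "e \<in> A v" for e using opposite[OF that] by fastforce
    then show ?thesis by (rule bdd_belowI)
  qed
  define q where "q v = Inf (A v)" for v
  have q_le: "q v \<le> e" if "e \<in> A v" for v e unfolding q_def using cInf_lower[OF that bdd] .
  have q_ge: "e \<le> q v" if "\<And>r. r \<in> A v \<Longrightarrow> e \<le> r" for v e
    unfolding q_def using that by (intro cInf_greatest ne)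
  have "q (v + w) \<le> q v + q w" for v w
  proof -
    have "q (v + w) \<le> e + e'" if "e \<in> A v" "e' \<in> A w" for e e'
    proof -
      obtain z y t where 1: "z \<in> C" "y \<in> edom g" "0 < t" "z - y = t *\<^sub>R v" "e = E z y / t"
        using \<open>e \<in> A v\<close> unfolding A_def by blast
      obtain z' y' t' where 2: "z' \<in> C" "y' \<in> edom g" "0 < t'" "z' - y' = t' *\<^sub>R w" "e' = E z' y' / t'"
        using \<open>e' \<in> A w\<close> unfolding A_def by blast
      show ?thesis using mix[OF 1(1-4) 2(1-4)] q_le A_memI 1(5) 2(5) by (meson order_trans)
    qed
    then have "q (v + w) - e' \<le> q v" if "e' \<in> A w" for e'
      using that by (intro q_ge) (simp add: algebra_simps)
    then have "q (v + w) - q v \<le> q w" by (intro q_ge) (simp add: algebra_simps)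
    then show ?thesis by simp
  qed
  moreover have "q (c *\<^sub>R v) \<le> c * q v" if c: "0 < c" for c v
  proof -
    have "q (c *\<^sub>R v) / c \<le> e" if "e \<in> A v" for e
    proof -
      obtain z y t where 1: "z \<in> C" "y \<in> edom g" "0 < t" "z - y = t *\<^sub>R v" "e = E z y / t"
        using \<open>e \<in> A v\<close> unfolding A_def by blast
      have "E z y / (t / c) \<in> A (c *\<^sub>R v)" using 1 c by (intro A_memI) auto
      then show ?thesis using q_le[of "E z y / (t / c)"] c 1(5) by (simp add: field_simps)
    qed
    then have "q (c *\<^sub>R v) / c \<le> q v" by (rule q_ge)
    then show ?thesis using c by (simp add: field_simps)
  qed
  ultimately have "sublinear q" unfolding sublinear_def by blast
  then obtain \<phi> where lin: "linear \<phi>" and \<phi>: "\<And>v. \<phi> v \<le> q v" using Hahn_Banach by blast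
  have \<phi>A: "\<phi> v \<le> e" if "e \<in> A v" for v e using \<phi>[of v] q_le[OF that] by simp
  have up: "\<phi> v \<le> K / r * norm v" for v
  proof (cases "v = 0")
    case True then show ?thesis using linear_0[OF lin] by simp
  next
    case False then show ?thesis using A_bound[OF False] \<phi>A by (meson order_trans)
  qed
  have "norm (\<phi> v) \<le> norm v * (K / r)" for v
    using up[of v] up[of "- v"] linear_neg[OF lin, of v] by (simp add: mult.commute abs_le_iff)
  then have bl: "bounded_linear \<phi>"
    using lin unfolding bounded_linear_def bounded_linear_axioms_def by blast
  define u where "u = - Blinfun \<phi>"
  have "u \<in> subdiff g xs"
  proof (rule subdiffI[OF g xs(2)])
    fix y assume y: "y \<in> edom g"
    have "E xs y / 1 \<in> A (xs - y)" using xs(1) y by (intro A_memI) auto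
    then have "\<phi> (xs - y) \<le> fval g y - fval g xs" using \<phi>A unfolding E_def by fastforce
    moreover have "u (y - xs) = \<phi> (xs - y)"
      unfolding u_def using linear_diff[OF lin]
      by (simp add: blinfun.minus_left bounded_linear_Blinfun_apply[OF bl])
    ultimately show "fval g xs + u (y - xs) \<le> fval g y" by simp
  qed
  then show ?thesis unfolding dom_subdiff_def by blast
qed

section \<open>Bregman divergences\<close>

text \<open>
  The real value of \<open>bregman\<close> on \<open>dom \<phi> \<times> int dom \<phi>\<close>; outside this set it is meaningless.
\<close>

definition breg :: "('a::real_normed_vector \<Rightarrow> ereal) \<Rightarrow> 'a \<Rightarrow> 'a \<Rightarrow> real" where
  "breg \<phi> x y = fval \<phi> x - fval \<phi> y - grad \<phi> y (x - y)"

lemma bregman_eq_breg: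
  assumes "extended_convex \<phi>" "x \<in> edom \<phi>" "y \<in> interior (edom \<phi>)"
  shows "bregman \<phi> x y = ereal (breg \<phi> x y)"
proof -
  have "y \<in> edom \<phi>" using assms(3) interior_subset by blast
  from fval_ereal[OF assms(1) this] fval_ereal[OF assms(1,2)]
  have "\<phi> x - \<phi> y = ereal (fval \<phi> x - fval \<phi> y)" by (metis ereal_minus(1))
  then show ?thesis using assms(2,3) unfolding bregman_def breg_def by simp
qed

lemma breg_refl [simp]: "breg \<phi> y y = 0"
  by (simp add: breg_def)

lemma breg_nonneg:
  assumes \<phi>: "extended_convex \<phi>" and d: "gateaux_differentiable_on \<phi> S" and y: "y \<in> S"
    and x: "x \<in> edom \<phi>"
  shows "0 \<le> breg \<phi> x y"
  using gateaux_gradient_le[OF \<phi> has_gateaux_gradient_grad[OF d y] x] by (simp add: breg_def)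

lemma breg_three_point:
  "(grad \<phi> y - grad \<phi> z) (x - z) = breg \<phi> x z + breg \<phi> z y - breg \<phi> x y"
  unfolding breg_def by (simp add: blinfun.diff_left blinfun.diff_right)

lemma breg_segment_le:
  assumes \<phi>: "extended_convex \<phi>" and x: "x \<in> edom \<phi>" and y: "y \<in> edom \<phi>" and t: "0 \<le> t" "t \<le> 1"
  shows "breg \<phi> (y + t *\<^sub>R (x - y)) y \<le> t * breg \<phi> x y"
proof -
  have "fval \<phi> ((1 - t) *\<^sub>R y + t *\<^sub>R x) \<le> (1 - t) * fval \<phi> y + t * fval \<phi> x"
    using convex_onD[OF convex_on_fval[OF \<phi>]] x y t by simp
  moreover have "(1 - t) *\<^sub>R y + t *\<^sub>R x = y + t *\<^sub>R (x - y)" by (simp add: algebra_simps)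
  ultimately have *: "fval \<phi> (y + t *\<^sub>R (x - y)) \<le> (1 - t) * fval \<phi> y + t * fval \<phi> x" by simp
  have "grad \<phi> y (y + t *\<^sub>R (x - y) - y) = t * grad \<phi> y (x - y)" by (simp add: blinfun.scaleR_right)
  then show ?thesis using * unfolding breg_def by (simp add: right_diff_distrib left_diff_distrib)
qed

subsection \<open>Relative smoothness\<close>

lemma relatively_smooth_breg_le:
  assumes F: "extended_convex F" and \<phi>: "extended_convex \<phi>"
    and d: "gateaux_differentiable_on \<phi> (interior (edom \<phi>))"
    and sm: "relatively_smooth L F \<phi>"
    and x: "x \<in> interior (edom \<phi>)" and y: "y \<in> interior (edom \<phi>)"
  shows "breg F x y \<le> L * breg \<phi> x y"
proof -
  have dF: "gateaux_differentiable_on F (interior (edom \<phi>))"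
    and cvx: "convex_on (interior (edom \<phi>)) (\<lambda>x. L * fval \<phi> x - fval F x)"
    using sm unfolding relatively_smooth_def by auto
  have "((\<lambda>t. L * fval \<phi> (y + t *\<^sub>R (x - y)) - fval F (y + t *\<^sub>R (x - y)))
      has_real_derivative L * grad \<phi> y (x - y) - grad F y (x - y)) (at 0)"
    using has_gateaux_gradient_grad[OF d y] has_gateaux_gradient_grad[OF dF y]
    unfolding has_gateaux_gradient_def by (intro DERIV_diff DERIV_cmult) auto
  from convex_on_directional_derivative_le[OF cvx x y this]
  show ?thesis unfolding breg_def by (simp add: right_diff_distrib)
qed

lemma segment_in_interior:
  fixes S :: "'a::real_normed_vector set"
  assumes S: "convex S" and x: "x \<in> S" and y: "y \<in> interior S" and t: "0 \<le> t" "t < 1"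
  shows "y + t *\<^sub>R (x - y) \<in> interior S"
proof -
  obtain r where r: "0 < r" "ball y r \<subseteq> S" using y unfolding mem_interior by blast
  have "ball (y + t *\<^sub>R (x - y)) ((1 - t) * r) \<subseteq> S"
  proof
    fix z assume z: "z \<in> ball (y + t *\<^sub>R (x - y)) ((1 - t) * r)"
    define w where "w = y + (1 / (1 - t)) *\<^sub>R (z - (y + t *\<^sub>R (x - y)))"
    have "norm ((1 / (1 - t)) *\<^sub>R (z - (y + t *\<^sub>R (x - y)))) < r"
      using z t by (simp add: dist_norm norm_minus_commute divide_less_eq mult.commute)
    then have "w \<in> S" using r(2) unfolding w_def by (intro subsetD[OF r(2)]) (simp add: dist_norm)
    moreover have "(1 - t) *\<^sub>R w + t *\<^sub>R x = z"
      using t unfolding w_def by (simp add: scaleR_add_right) (simp add: algebra_simps)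
    ultimately show "z \<in> S" using S x t unfolding convex_alt by (metis less_eq_real_def)
  qed
  moreover have "0 < (1 - t) * r" using r t by simp
  ultimately show ?thesis unfolding mem_interior by blast
qed

text \<open>
  A nonnegative \<open>L\<close> is not guaranteed. If \<open>L < 0\<close>, then \<open>\<phi>\<close> is affine on the interior of its domain, where
  \<open>0 \<le> D\<^sub>F \<le> L D\<^sub>\<phi>\<close>; lower semicontinuity along a segment extends \<open>D\<^sub>\<phi>(\<cdot>, y) \<le> 0\<close> to the boundary, where the
  saddle point may lie.
\<close>

lemma relatively_smooth_breg_nonneg:
  assumes F: "extended_convex F" and \<phi>: "\<phi> \<in> Gamma0"
    and d: "gateaux_differentiable_on \<phi> (interior (edom \<phi>))"
    and sm: "relatively_smooth L F \<phi>"
    and x: "x \<in> edom \<phi>" and y: "y \<in> interior (edom \<phi>)"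
  shows "0 \<le> L * breg \<phi> x y"
proof (cases "0 \<le> L")
  case True
  then show ?thesis using breg_nonneg[OF Gamma0_extended_convex[OF \<phi>] d y x] by simp
next
  case False
  have \<phi>c: "extended_convex \<phi>" using \<phi> by (rule Gamma0_extended_convex)
  have dF: "gateaux_differentiable_on F (interior (edom \<phi>))"
    using sm unfolding relatively_smooth_def by auto
  define \<xi> where "\<xi> n = y + (1 - inverse (real (Suc n))) *\<^sub>R (x - y)" for n
  have \<xi>: "\<xi> n \<in> interior (edom \<phi>)" for n
    unfolding \<xi>_def by (intro segment_in_interior convex_edom \<phi>c x y) (auto simp: inverse_le_1_iff)
  have zero: "breg \<phi> (\<xi> n) y \<le> 0" for n
  proof -
    have "has_gateaux_gradient F (grad F (\<xi> n)) (\<xi> n)" using has_gateaux_gradient_grad[OF dF \<xi>] .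
    then have "\<xi> n \<in> edom F" using interior_subset unfolding has_gateaux_gradient_def by blast
    then have "0 \<le> breg F (\<xi> n) y" using breg_nonneg[OF F dF y] by blast
    then have "0 \<le> L * breg \<phi> (\<xi> n) y" using relatively_smooth_breg_le[OF F \<phi>c d sm \<xi> y] by (meson order_trans)
    then show ?thesis using False by (simp add: zero_le_mult_iff)
  qed
  have inv: "(\<lambda>n. inverse (real (Suc n))) \<longlonglongrightarrow> 0" by (rule LIMSEQ_inverse_real_of_nat)
  then have lim: "\<xi> \<longlonglongrightarrow> y + (1 - 0) *\<^sub>R (x - y)" unfolding \<xi>_def by (intro tendsto_intros)
  have "breg \<phi> x y \<le> e" if e: "0 < e" for e
  proof -
    define b where "b = fval \<phi> y + grad \<phi> y (x - y) + e"
    have "(\<lambda>n. grad \<phi> y (\<xi> n - y)) \<longlonglongrightarrow> grad \<phi> y (x - y)"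
      using lim by (intro blinfun.tendsto tendsto_intros) simp
    then have "eventually (\<lambda>n. grad \<phi> y (\<xi> n - y) < grad \<phi> y (x - y) + e) sequentially"
      using e by (intro order_tendstoD) auto
    then have ev: "eventually (\<lambda>n. \<xi> n \<in> {z. \<phi> z \<le> ereal b}) sequentially"
    proof eventually_elim
      case (elim n)
      then have "fval \<phi> (\<xi> n) \<le> b" using zero[of n] unfolding b_def breg_def by simp
      moreover have "\<phi> (\<xi> n) = ereal (fval \<phi> (\<xi> n))"
        using fval_ereal[OF \<phi>c] \<xi> interior_subset by blast
      ultimately show ?case by (metis ereal_less_eq(3) mem_Collect_eq)
    qed
    have "x \<in> {z. \<phi> z \<le> ereal b}"
      using Lim_in_closed_set[OF closed_sublevel[OF Gamma0_lsc[OF \<phi>]] ev _ lim] by simp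
    then have "fval \<phi> x \<le> b" using fval_ereal[OF \<phi>c x] by (metis ereal_less_eq(3) mem_Collect_eq)
    then show ?thesis unfolding b_def breg_def by simp
  qed
  then have "breg \<phi> x y \<le> 0" by (rule field_le_epsilon[of _ 0, simplified])
  then show ?thesis using False by (simp add: zero_le_mult_iff)
qed

lemma relatively_strongly_convex_onD:
  assumes F: "extended_convex F" and \<psi>: "extended_convex \<psi>"
    and sc: "relatively_strongly_convex_on m C F \<psi>"
    and x: "x \<in> C" "x \<in> edom F" "x \<in> edom \<psi>"
    and y: "y \<in> C" "y \<in> interior (edom \<psi>)" and u: "u \<in> subdiff F y"
  shows "m * breg \<psi> x y \<le> fval F x - fval F y - u (x - y)"
proof -
  have "y \<in> dom_subdiff F" using u unfolding dom_subdiff_def by blast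
  then have "ereal m * bregman \<psi> x y \<le> F x - F y - ereal (u (x - y))"
    using sc x(1) y u unfolding relatively_strongly_convex_on_def by blast
  moreover have "F x - F y = ereal (fval F x - fval F y)"
    using fval_ereal[OF F x(2)] fval_ereal[OF F subdiff_edom[OF u]] by (metis ereal_minus(1))
  ultimately show ?thesis using bregman_eq_breg[OF \<psi> x(3) y(2)] by simp
qed

subsection \<open>Sequential consistency\<close>

text \<open>
  The bounded sublevel set that contains all \<open>w k\<close> is what makes the modulus uniform. A point \<open>w k\<close> at distance
  at least \<open>t\<close> from \<open>xs\<close> is compared with the point at distance exactly \<open>t\<close> on the segment to \<open>xs\<close>, because
  divergences do not decrease along that segment.
\<close>

lemma sequentially_consistent_convergence:
  assumes \<psi>: "convex_entropy \<psi>" and sc: "sequentially_consistent_on \<psi> X"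
    and w: "\<And>k. w k \<in> X" and xs: "xs \<in> edom \<psi>"
    and bdd: "bounded_sublevel_sets (bregman \<psi> xs)"
    and lim: "(\<lambda>k. breg \<psi> xs (w k)) \<longlonglongrightarrow> 0"
  shows "w \<longlonglongrightarrow> xs"
proof (rule ccontr)
  have \<psi>c: "extended_convex \<psi>" and d: "gateaux_differentiable_on \<psi> (interior (edom \<psi>))"
    using \<psi> unfolding convex_entropy_def extended_convex_def by auto
  have X: "X \<subseteq> interior (edom \<psi>)" using sc unfolding sequentially_consistent_on_def by blast
  have wi: "w k \<in> interior (edom \<psi>)" for k using w X by blast
  have beq: "bregman \<psi> xs (w k) = ereal (breg \<psi> xs (w k))" for k
    using bregman_eq_breg[OF \<psi>c xs wi] .
  obtain B where B: "\<And>k. \<bar>breg \<psi> xs (w k)\<bar> \<le> B"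
    using convergent_imp_Bseq[of "\<lambda>k. breg \<psi> xs (w k)"] lim unfolding Bseq_def convergent_def by auto
  have "range w \<subseteq> {y. bregman \<psi> xs y \<le> ereal B}"
    using beq B by (auto simp: abs_le_iff)
  then have bw: "bounded (range w)"
    using bdd bounded_subset unfolding bounded_sublevel_sets_def by blast
  assume "\<not> w \<longlonglongrightarrow> xs"
  then obtain t where t: "0 < t" and far: "\<And>N. \<exists>k\<ge>N. t \<le> dist (w k) xs"
    unfolding lim_sequentially by (meson not_less)
  define c where "c = (INF x\<in>range w. bregman_modulus \<psi> x t)"
  have c: "0 < c"
    using sc bw t w unfolding sequentially_consistent_on_def c_def by (metis image_subsetI)
  have "c \<le> ereal (breg \<psi> xs (w k))" if far: "t \<le> dist (w k) xs" for k
  proof -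
    define s where "s = t / norm (xs - w k)"
    have n: "t \<le> norm (xs - w k)" using far by (simp add: dist_norm norm_minus_commute)
    have "0 < norm (xs - w k)" using n t by linarith
    then have s: "0 \<le> s" "s \<le> 1" "s * norm (xs - w k) = t"
      using n t unfolding s_def by (simp_all add: divide_le_eq)
    define z where "z = w k + s *\<^sub>R (xs - w k)"
    have "norm (w k - z) = t" unfolding z_def using s by simp
    moreover have wk: "w k \<in> edom \<psi>" using wi interior_subset by blast
    then have "(1 - s) *\<^sub>R w k + s *\<^sub>R xs \<in> edom \<psi>"
      using convex_edom[OF \<psi>c] xs s(1,2) unfolding convex_alt by blast
    then have z: "z \<in> edom \<psi>" unfolding z_def by (simp add: algebra_simps)
    ultimately have "bregman_modulus \<psi> (w k) t \<le> bregman \<psi> z (w k)"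
      unfolding bregman_modulus_def by (intro Inf_lower) blast
    moreover have "c \<le> bregman_modulus \<psi> (w k) t" unfolding c_def by (intro INF_lower) auto
    moreover have "bregman \<psi> z (w k) = ereal (breg \<psi> z (w k))" using bregman_eq_breg[OF \<psi>c z wi] .
    moreover have "breg \<psi> z (w k) \<le> s * breg \<psi> xs (w k)"
      unfolding z_def by (rule breg_segment_le[OF \<psi>c xs wk s(1,2)])
    moreover have "s * breg \<psi> xs (w k) \<le> breg \<psi> xs (w k)"
      using s breg_nonneg[OF \<psi>c d wi xs] by (simp add: mult_left_le_one_le)
    ultimately show ?thesis by (metis ereal_less_eq(3) order_trans)
  qed
  moreover have "\<exists>e>0. ereal e \<le> c" using c ereal_dense2[of 0 c] by (metis ereal_less(2) less_imp_le)
  ultimately obtain e where e: "0 < e" "\<And>k. t \<le> dist (w k) xs \<Longrightarrow> e \<le> breg \<psi> xs (w k)"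
    by (metis ereal_less_eq(3) order_trans)
  have "eventually (\<lambda>k. breg \<psi> xs (w k) < e) sequentially" using lim e(1) by (rule order_tendstoD)
  then obtain N where "\<And>k. N \<le> k \<Longrightarrow> breg \<psi> xs (w k) < e" unfolding eventually_sequentially by blast
  then show False using far[of N] e(2) by (meson not_less)
qed

section \<open>One Bregman proximal gradient step\<close>

text \<open>
  The subgradient of \<open>G\<close> at the new point \<open>z\<close> that the optimality condition of a step from \<open>y\<close> provides. The
  functional \<open>c\<close> collects the error and the coupling term, so that the primal and the dual step are both instances.
\<close>

definition step_subgradient ::
    "('a::real_normed_vector \<Rightarrow> ereal) \<Rightarrow> real \<Rightarrow> ('a \<Rightarrow> ereal) \<Rightarrow> 'a dual \<Rightarrow> 'a \<Rightarrow> 'a \<Rightarrow> 'a dual" where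
  "step_subgradient \<phi> t F c y z = (1 / t) *\<^sub>R (grad \<phi> y - grad \<phi> z) - grad F y - c"

text \<open>
  The total gap, at the comparison point \<open>x\<close>, in the two convexity inequalities used in a step: that of \<open>F\<close> at
  \<open>y\<close> and that of \<open>G\<close> at \<open>z\<close>.
\<close>

definition step_excess ::
    "('a::real_normed_vector \<Rightarrow> ereal) \<Rightarrow> ('a \<Rightarrow> ereal) \<Rightarrow> ('a \<Rightarrow> ereal) \<Rightarrow> real \<Rightarrow> 'a dual \<Rightarrow>
     'a \<Rightarrow> 'a \<Rightarrow> 'a \<Rightarrow> real" where
  "step_excess F G \<phi> t c x y z =
     breg F x y + (fval G x - fval G z - step_subgradient \<phi> t F c y z (x - z))"

lemma resolvent_subgradient:
  assumes z: "z \<in> bregman_resolvent \<phi> t G (grad \<phi> y - t *\<^sub>R (grad F y + c))" and t: "0 < t"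
  shows "step_subgradient \<phi> t F c y z \<in> subdiff G z"
    and "has_gateaux_gradient \<phi> (grad \<phi> z) z"
proof -
  obtain v u where v: "has_gateaux_gradient \<phi> v z" and u: "u \<in> subdiff G z"
    and eq: "grad \<phi> y - t *\<^sub>R (grad F y + c) = v + t *\<^sub>R u"
    using z unfolding bregman_resolvent_def by blast
  have gv: "grad \<phi> z = v" using grad_eq[OF v] .
  show "has_gateaux_gradient \<phi> (grad \<phi> z) z" using v gv by simp
  have "t *\<^sub>R u = grad \<phi> y - grad \<phi> z - t *\<^sub>R (grad F y + c)" using eq gv by (simp add: algebra_simps)
  then have "(1 / t) *\<^sub>R (t *\<^sub>R u) = (1 / t) *\<^sub>R (grad \<phi> y - grad \<phi> z - t *\<^sub>R (grad F y + c))" by simp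
  then have "u = step_subgradient \<phi> t F c y z"
    using t unfolding step_subgradient_def by (simp add: scaleR_diff_right algebra_simps)
  then show "step_subgradient \<phi> t F c y z \<in> subdiff G z" using u by simp
qed

text \<open>
  The algorithm is defined by minimisation and its well-posedness by resolvents. Since a resolvent point is a
  minimiser, uniqueness of the minimiser identifies the two, without a converse optimality condition.
\<close>

lemma resolvent_in_argmin:
  assumes \<phi>: "extended_convex \<phi>" and G: "extended_convex G" and t: "0 < t"
    and y: "y \<in> interior (edom \<phi>)"
    and z: "z \<in> bregman_resolvent \<phi> t G (grad \<phi> y - t *\<^sub>R (grad F y + c))"
  shows "z \<in> argmin_on (edom \<phi>)
    (\<lambda>w. G w + ereal ((grad F y + c) w) + ereal (1 / t) * bregman \<phi> w y)"
proof -
  note u = resolvent_subgradient(1)[OF z t] and gz = resolvent_subgradient(2)[OF z t]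
  have zd: "z \<in> edom \<phi>" using gz interior_subset unfolding has_gateaux_gradient_def by blast
  have zG: "z \<in> edom G" using u subdiff_edom by blast
  have val: "G w + ereal ((grad F y + c) w) + ereal (1 / t) * bregman \<phi> w y
      = ereal (fval G w + (grad F y + c) w + (1 / t) * breg \<phi> w y)"
    if "w \<in> edom \<phi>" "w \<in> edom G" for w
    using bregman_eq_breg[OF \<phi> that(1) y] by (subst fval_ereal[OF G that(2)]) simp
  have "G z + ereal ((grad F y + c) z) + ereal (1 / t) * bregman \<phi> z y
      \<le> G w + ereal ((grad F y + c) w) + ereal (1 / t) * bregman \<phi> w y"
    if w: "w \<in> edom \<phi>" for w
  proof (cases "w \<in> edom G")
    case True
    have 1: "fval G z + step_subgradient \<phi> t F c y z (w - z) \<le> fval G w"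
      using subdiffD[OF G u True] .
    have 2: "0 \<le> breg \<phi> w z" using gateaux_gradient_le[OF \<phi> gz w] by (simp add: breg_def)
    have "(1 / t) * (breg \<phi> w z + breg \<phi> z y - breg \<phi> w y) - (grad F y + c) (w - z) \<le> fval G w - fval G z"
      using 1 unfolding breg_three_point[symmetric] step_subgradient_def
      by (simp add: blinfun.diff_left blinfun.add_left blinfun.scaleR_left algebra_simps)
    moreover have "0 \<le> (1 / t) * breg \<phi> w z" using 2 t by simp
    ultimately have "fval G z + (grad F y + c) z + (1 / t) * breg \<phi> z y
        \<le> fval G w + (grad F y + c) w + (1 / t) * breg \<phi> w y"
      by (simp add: blinfun.diff_right distrib_left right_diff_distrib)
    then show ?thesis unfolding val[OF zd zG] val[OF w True] by simp
  next
    case False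
    then have "G w = \<infinity>" unfolding edom_def by simp
    then show ?thesis using bregman_eq_breg[OF \<phi> w y] by simp
  qed
  then show ?thesis using zd unfolding argmin_on_def by blast
qed

lemma step_excess_nonneg:
  assumes F: "extended_convex F" and G: "extended_convex G"
    and u: "step_subgradient \<phi> t F c y z \<in> subdiff G z"
    and dF: "gateaux_differentiable_on F S" and y: "y \<in> S"
    and x: "x \<in> edom F" "x \<in> edom G"
  shows "0 \<le> step_excess F G \<phi> t c x y z"
  using subdiffD[OF G u x(2)] breg_nonneg[OF F dF y x(1)] unfolding step_excess_def by simp

text \<open>
  The inequality of a single Bregman proximal gradient step with all gaps retained: apart from relative smoothness,
  which bounds \<open>D\<^sub>F(z, y)\<close>, it is the three-point identity.
\<close>

lemma step_descent:
  assumes F: "extended_convex F" and \<phi>: "extended_convex \<phi>"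
    and d: "gateaux_differentiable_on \<phi> (interior (edom \<phi>))"
    and sm: "relatively_smooth L F \<phi>"
    and y: "y \<in> interior (edom \<phi>)" and z: "z \<in> interior (edom \<phi>)"
  shows "step_excess F G \<phi> t c x y z + (1 / t) * (breg \<phi> x z + breg \<phi> z y - breg \<phi> x y)
      - L * breg \<phi> z y - c (x - z)
    \<le> (fval F x + fval G x) - (fval F z + fval G z)"
proof -
  have "breg F z y \<le> L * breg \<phi> z y" using relatively_smooth_breg_le[OF F \<phi> d sm z y] .
  moreover have "step_subgradient \<phi> t F c y z (x - z)
      = (1 / t) * (breg \<phi> x z + breg \<phi> z y - breg \<phi> x y) - grad F y (x - z) - c (x - z)"
    unfolding breg_three_point[symmetric] step_subgradient_def
    by (simp add: blinfun.diff_left blinfun.scaleR_left)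
  moreover have "grad F y (x - z) = grad F y (x - y) - grad F y (z - y)"
    by (simp add: blinfun.diff_right)
  ultimately show ?thesis unfolding step_excess_def breg_def[of F] by linarith
qed

text \<open>
  Strong convexity of \<open>F\<close> is felt at the old point and strong convexity of \<open>G\<close> at the new one, since these are
  the points where the respective subgradients are taken; hence the two possible values of \<open>w\<close>.
\<close>

lemma step_excess_strongly_convex:
  assumes F: "extended_convex F" and G: "extended_convex G"
    and ent: "strong_convexity_assumption C F G \<phi> \<psi>"
    and u: "step_subgradient \<phi> t F c y z \<in> subdiff G z"
    and dF: "gateaux_differentiable_on F (interior (edom \<phi>))"
    and y: "y \<in> interior (edom \<phi>)" "y \<in> C" "y \<in> edom G"
    and z: "z \<in> interior (edom \<phi>)" "z \<in> C"
    and x: "x \<in> C" "x \<in> edom F" "x \<in> edom G" "x \<in> edom \<phi>"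
    and m: "relatively_strongly_convex_on m (C \<inter> edom G) F \<psi> \<and> w = y
      \<or> relatively_strongly_convex_on m (C \<inter> edom G) G \<psi> \<and> w = z"
  shows "m * breg \<psi> x w \<le> step_excess F G \<phi> t c x y z"
proof -
  have \<psi>: "extended_convex \<psi>" and dom: "edom \<phi> \<subseteq> edom \<psi>"
    using ent unfolding strong_convexity_assumption_def convex_entropy_def extended_convex_def by auto
  have int: "interior (edom \<phi>) \<subseteq> interior (edom \<psi>)" using dom by (rule interior_mono)
  have zG: "z \<in> edom G" using u subdiff_edom by blast
  have e1: "0 \<le> breg F x y" using breg_nonneg[OF F dF y(1) x(2)] .
  have e2: "0 \<le> fval G x - fval G z - step_subgradient \<phi> t F c y z (x - z)"
    using subdiffD[OF G u x(3)] by simp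
  from m show ?thesis
  proof
    assume m: "relatively_strongly_convex_on m (C \<inter> edom G) F \<psi> \<and> w = y"
    have "grad F y \<in> subdiff F y"
      by (rule gateaux_gradient_in_subdiff[OF F has_gateaux_gradient_grad[OF dF y(1)]])
    then have "m * breg \<psi> x y \<le> fval F x - fval F y - grad F y (x - y)"
      using m x y int dom by (intro relatively_strongly_convex_onD[OF F \<psi>, where C = "C \<inter> edom G"]) auto
    then show ?thesis using e2 m unfolding step_excess_def breg_def[of F] by simp
  next
    assume m: "relatively_strongly_convex_on m (C \<inter> edom G) G \<psi> \<and> w = z"
    then have "m * breg \<psi> x z \<le> fval G x - fval G z - step_subgradient \<phi> t F c y z (x - z)"
      using u x z zG int dom by (intro relatively_strongly_convex_onD[OF G \<psi>, where C = "C \<inter> edom G"]) auto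
    then show ?thesis using e1 m unfolding step_excess_def by simp
  qed
qed

text \<open>
  \<open>\<nabla>\<phi>\<close> is strongly monotone and \<open>\<partial>G\<close> is monotone.
\<close>

lemma resolvent_Lipschitz:
  assumes \<phi>: "extended_convex \<phi>" and G: "extended_convex G"
    and d: "gateaux_differentiable_on \<phi> (interior (edom \<phi>))"
    and \<sigma>: "0 < \<sigma>" "\<And>z y. ereal (\<sigma> / 2 * (norm (z - y))\<^sup>2) \<le> bregman \<phi> z y"
    and t: "0 < t" and z: "z \<in> bregman_resolvent \<phi> t G \<zeta>" and z': "z' \<in> bregman_resolvent \<phi> t G \<zeta>'"
  shows "norm (z - z') \<le> (1 / \<sigma>) * norm (\<zeta> - \<zeta>')"
proof -
  obtain v u where v: "has_gateaux_gradient \<phi> v z" and u: "u \<in> subdiff G z" and \<zeta>: "\<zeta> = v + t *\<^sub>R u"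
    using z unfolding bregman_resolvent_def by blast
  obtain v' u' where v': "has_gateaux_gradient \<phi> v' z'" and u': "u' \<in> subdiff G z'" and \<zeta>': "\<zeta>' = v' + t *\<^sub>R u'"
    using z' unfolding bregman_resolvent_def by blast
  have i: "z \<in> interior (edom \<phi>)" "z' \<in> interior (edom \<phi>)"
    using v v' unfolding has_gateaux_gradient_def by auto
  have strong: "\<sigma> / 2 * (norm (a - b))\<^sup>2 \<le> breg \<phi> a b"
    if "a \<in> interior (edom \<phi>)" "b \<in> interior (edom \<phi>)" for a b
    using \<sigma>(2)[of a b] bregman_eq_breg[OF \<phi> _ that(2), of a] that(1) interior_subset by fastforce
  have "\<sigma> * (norm (z - z'))\<^sup>2 \<le> breg \<phi> z' z + breg \<phi> z z'"
    using strong[OF i] strong[OF i(2,1)] by (simp add: norm_minus_commute)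
  also have "\<dots> = (v - v') (z - z')"
    using grad_eq[OF v] grad_eq[OF v'] unfolding breg_def by (simp add: blinfun.diff_left blinfun.diff_right)
  also have "\<dots> \<le> (v - v') (z - z') + t * ((u - u') (z - z'))"
  proof -
    have "fval G z + u (z' - z) \<le> fval G z'" "fval G z' + u' (z - z') \<le> fval G z"
      using subdiffD[OF G u subdiff_edom[OF u']] subdiffD[OF G u' subdiff_edom[OF u]] by auto
    then have "0 \<le> (u - u') (z - z')" by (simp add: blinfun.diff_left blinfun.diff_right)
    then show ?thesis using t by simp
  qed
  also have "\<dots> = (\<zeta> - \<zeta>') (z - z')"
    unfolding \<zeta> \<zeta>' by (simp add: blinfun.diff_left blinfun.add_left blinfun.scaleR_left algebra_simps)
  also have "\<dots> \<le> norm (\<zeta> - \<zeta>') * norm (z - z')" using norm_blinfun[of "\<zeta> - \<zeta>'" "z - z'"] by simp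
  finally have "\<sigma> * norm (z - z') * norm (z - z') \<le> norm (\<zeta> - \<zeta>') * norm (z - z')"
    by (simp add: power2_eq_square mult.assoc)
  then have "\<sigma> * norm (z - z') \<le> norm (\<zeta> - \<zeta>')"
    by (cases "z = z'") (auto intro: mult_right_le_imp_le)
  then show ?thesis using \<sigma>(1) by (simp add: field_simps)
qed

section \<open>Saddle points\<close>

text \<open>
  A supremum of continuous affine functions.
\<close>

lemma fenchel_conj_Gamma0:
  fixes h :: "'a::real_normed_vector dual \<Rightarrow> ereal"
  assumes h: "h \<in> Gamma0" and ne: "edom (fenchel_conj h) \<noteq> {}"
  shows "fenchel_conj h \<in> Gamma0"
proof -
  have hc: "extended_convex h" using h by (rule Gamma0_extended_convex)
  obtain y0 where y0: "y0 \<in> edom h" using h unfolding Gamma0_def proper_fun_def by blast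
  have upper: "ereal (y x - fval h y) \<le> fenchel_conj h x" if "y \<in> edom h" for y :: "'a dual" and x
    unfolding fenchel_conj_def using fval_ereal[OF hc that]
    by (intro SUP_upper2[of y]) (auto simp: ereal_minus(1)[symmetric] simp del: ereal_minus)
  have least: "fenchel_conj h x \<le> b" if "\<And>y :: 'a dual. y \<in> edom h \<Longrightarrow> ereal (y x - fval h y) \<le> b" for x b
    unfolding fenchel_conj_def
  proof (rule SUP_least)
    fix y :: "'a dual"
    show "ereal (y x) - h y \<le> b"
    proof (cases "y \<in> edom h")
      case True then show ?thesis using that fval_ereal[OF hc True] by (metis ereal_minus(1))
    next
      case False then have "h y = \<infinity>" unfolding edom_def by simp
      then show ?thesis by simp
    qed
  qed
  have "fenchel_conj h x \<noteq> -\<infinity>" for x using upper[OF y0, of x] by auto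
  moreover have "convex_fun (fenchel_conj h)" unfolding convex_fun_def
  proof (intro allI impI, rule least)
    fix x z and y :: "'a dual" and t :: real assume t: "0 < t" "t < 1" and y: "y \<in> edom h"
    have "ereal (y ((1 - t) *\<^sub>R x + t *\<^sub>R z) - fval h y)
        = ereal (1 - t) * ereal (y x - fval h y) + ereal t * ereal (y z - fval h y)"
    proof -
      have "y ((1 - t) *\<^sub>R x + t *\<^sub>R z) = (1 - t) * y x + t * y z"
        by (simp add: blinfun.add_right blinfun.scaleR_right)
      then show ?thesis by (simp add: algebra_simps)
    qed
    also have "\<dots> \<le> ereal (1 - t) * fenchel_conj h x + ereal t * fenchel_conj h z"
      using t by (intro add_mono ereal_mult_left_mono upper y) auto
    finally show "ereal (y ((1 - t) *\<^sub>R x + t *\<^sub>R z) - fval h y)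
        \<le> ereal (1 - t) * fenchel_conj h x + ereal t * fenchel_conj h z" .
  qed
  moreover have "lsc_fun (fenchel_conj h)" unfolding lsc_fun_def
  proof (intro allI, rule least)
    fix x and y :: "'a dual" assume y: "y \<in> edom h"
    show "ereal (y x - fval h y) \<le> Liminf (at x) (fenchel_conj h)"
    proof (cases "at x = bot")
      case True then show ?thesis unfolding le_Liminf_iff by simp
    next
      case False
      have "((\<lambda>z. ereal (y z - fval h y)) \<longlongrightarrow> ereal (y x - fval h y)) (at x)"
        by (intro tendsto_intros)
      then have "ereal (y x - fval h y) = Liminf (at x) (\<lambda>z. ereal (y z - fval h y))"
        using lim_imp_Liminf[OF False] by metis
      also have "\<dots> \<le> Liminf (at x) (fenchel_conj h)"
        using upper[OF y] by (intro Liminf_mono always_eventually) auto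
      finally show ?thesis .
    qed
  qed
  ultimately show ?thesis using ne unfolding Gamma0_def proper_fun_def by blast
qed

text \<open>
  The point of the lemma is finiteness: comparison with feasible points excludes infinite values at a saddle point,
  whatever value \<open>\<infinity> - \<infinity>\<close> is given. Then the two saddle point inequalities can be written with real numbers,
  after cancellation of the terms that are the same on both sides.
\<close>

lemma saddle_point_properties:
  fixes T :: "'x::banach \<Rightarrow>\<^sub>L 'y::banach dual"
  assumes prob: "saddle_problem Cp Cd f g h l T"
    and sad: "(xs, \<mu>s) \<in> saddle_points (lagrangian Cp Cd f g h l T)"
  defines "hs \<equiv> fenchel_conj h" and "ls \<equiv> fenchel_conj l"
  shows "xs \<in> Cp" "xs \<in> edom g" "\<mu>s \<in> Cd" "\<mu>s \<in> edom ls"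
    and "\<And>x. x \<in> Cp \<Longrightarrow> x \<in> edom g \<Longrightarrow>
      fval f xs + fval g xs + T xs \<mu>s \<le> fval f x + fval g x + T x \<mu>s"
    and "\<And>\<mu>. \<mu> \<in> Cd \<Longrightarrow> \<mu> \<in> edom ls \<Longrightarrow>
      T xs \<mu> - fval hs \<mu> - fval ls \<mu> \<le> T xs \<mu>s - fval hs \<mu>s - fval ls \<mu>s"
proof -
  have fc: "extended_convex f" and gc: "extended_convex g"
    using prob Gamma0_extended_convex unfolding saddle_problem_def by blast+
  have "hs \<in> Gamma0" "ls \<in> Gamma0"
    using prob fenchel_conj_Gamma0 unfolding saddle_problem_def hs_def ls_def by blast+
  then have hc: "extended_convex hs" and lc: "extended_convex ls"
    using Gamma0_extended_convex by blast+
  have Cf: "Cp \<subseteq> edom f" and Ch: "Cd \<subseteq> edom hs" using prob unfolding saddle_problem_def hs_def by auto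
  obtain x0 where x0: "x0 \<in> Cp" "x0 \<in> edom g" using prob unfolding saddle_problem_def by blast
  obtain \<mu>0 where \<mu>0: "\<mu>0 \<in> Cd" "\<mu>0 \<in> edom ls" using prob unfolding saddle_problem_def ls_def by blast
  define \<L> where "\<L> = lagrangian Cp Cd f g h l T"
  have \<L>: "\<L> x \<mu> = f x + g x + indicator_fun Cp x + ereal (T x \<mu>) - hs \<mu> - ls \<mu> - indicator_fun Cd \<mu>" for x \<mu>
    unfolding \<L>_def lagrangian_def hs_def ls_def by simp
  have s1: "\<L> xs \<mu> \<le> \<L> xs \<mu>s" and s2: "\<L> xs \<mu>s \<le> \<L> x \<mu>s" for x \<mu>
    using sad unfolding saddle_points_def \<L>_def by auto
  have fin: "\<L> x \<mu> = ereal (fval f x + fval g x + T x \<mu> - fval hs \<mu> - fval ls \<mu>)"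
    if "x \<in> Cp" "x \<in> edom g" "\<mu> \<in> Cd" "\<mu> \<in> edom ls" for x \<mu>
  proof -
    have "f x = ereal (fval f x)" "g x = ereal (fval g x)" "hs \<mu> = ereal (fval hs \<mu>)" "ls \<mu> = ereal (fval ls \<mu>)"
      using that Cf Ch fval_ereal[OF fc] fval_ereal[OF gc] fval_ereal[OF hc] fval_ereal[OF lc] by auto
    then show ?thesis unfolding \<L> using that
      by (metis (no_types, lifting) diff_zero indicator_fun_def add.right_neutral ereal_minus(1) plus_ereal.simps(1) ereal_minus(7))
  qed
  have nm: "f x \<noteq> -\<infinity>" "g x \<noteq> -\<infinity>" "hs \<mu> \<noteq> -\<infinity>" "ls \<mu> \<noteq> -\<infinity>" for x \<mu>
    using fc gc hc lc unfolding extended_convex_def by auto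
  have xs: "xs \<in> Cp \<and> xs \<in> edom g"
  proof (rule ccontr)
    assume "\<not> ?thesis"
    then have "f xs + g xs + indicator_fun Cp xs = \<infinity>"
      using nm unfolding indicator_fun_def edom_def by (cases "f xs"; cases "g xs") auto
    moreover have "hs \<mu>0 = ereal (fval hs \<mu>0)" "ls \<mu>0 = ereal (fval ls \<mu>0)"
      using \<mu>0 Ch fval_ereal[OF hc] fval_ereal[OF lc] by auto
    ultimately have "\<L> xs \<mu>0 = \<infinity>"
      unfolding \<L> indicator_fun_def using \<mu>0 by (cases "hs \<mu>0"; cases "ls \<mu>0") auto
    then have "\<L> x0 \<mu>s = \<infinity>" using s1[of \<mu>0] s2[of x0] by auto
    moreover have "f x0 = ereal (fval f x0)" "g x0 = ereal (fval g x0)"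
      using x0 Cf fval_ereal[OF fc] fval_ereal[OF gc] by auto
    then have "\<L> x0 \<mu>s \<noteq> \<infinity>"
      unfolding \<L> indicator_fun_def using x0 nm(3,4)[of \<mu>s]
      by (cases "f x0"; cases "g x0"; cases "hs \<mu>s"; cases "ls \<mu>s") auto
    ultimately show False by simp
  qed
  then show "xs \<in> Cp" "xs \<in> edom g" by auto
  have \<mu>s: "\<mu>s \<in> Cd \<and> \<mu>s \<in> edom ls"
  proof (rule ccontr)
    assume n: "\<not> ?thesis"
    have "f xs = ereal (fval f xs)" "g xs = ereal (fval g xs)"
      using xs Cf fval_ereal[OF fc] fval_ereal[OF gc] by auto
    then have "\<L> xs \<mu>s = -\<infinity>"
      unfolding \<L> indicator_fun_def using xs n nm(3,4)[of \<mu>s] unfolding edom_def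
      by (cases "f xs"; cases "g xs"; cases "hs \<mu>s"; cases "ls \<mu>s") auto
    then show False using s1[of \<mu>0] fin[of xs \<mu>0] xs \<mu>0 by auto
  qed
  then show "\<mu>s \<in> Cd" "\<mu>s \<in> edom ls" by auto
  show "fval f xs + fval g xs + T xs \<mu>s \<le> fval f x + fval g x + T x \<mu>s" if "x \<in> Cp" "x \<in> edom g" for x
    using s2[of x] fin[of xs \<mu>s] fin[of x \<mu>s] xs \<mu>s that by auto
  show "T xs \<mu> - fval hs \<mu> - fval ls \<mu> \<le> T xs \<mu>s - fval hs \<mu>s - fval ls \<mu>s" if "\<mu> \<in> Cd" "\<mu> \<in> edom ls" for \<mu>
    using s1[of \<mu>] fin[of xs \<mu>s] fin[of xs \<mu>] xs \<mu>s that by auto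
qed

lemma saddle_point_solutions:
  assumes sad: "(xs, \<mu>s) \<in> saddle_points (lagrangian Cp Cd f g h l T)"
    and xs: "xs \<in> Cp" and \<mu>s: "\<mu>s \<in> Cd"
  shows "xs \<in> primal_solutions Cp Cd f g h l T" "\<mu>s \<in> dual_solutions Cp Cd f g h l T"
proof -
  define c where "c = coupling f g h l T"
  have eq: "lagrangian Cp Cd f g h l T x \<mu> = c x \<mu>" if "x \<in> Cp" "\<mu> \<in> Cd" for x \<mu>
    using that unfolding lagrangian_def c_def coupling_def indicator_fun_def by simp
  have s1: "c xs \<mu> \<le> c xs \<mu>s" if "\<mu> \<in> Cd" for \<mu>
    using sad eq[OF xs that] eq[OF xs \<mu>s] unfolding saddle_points_def by auto metis
  have s2: "c xs \<mu>s \<le> c x \<mu>s" if "x \<in> Cp" for x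
    using sad eq[OF that \<mu>s] eq[OF xs \<mu>s] unfolding saddle_points_def by auto metis
  have "(SUP \<mu>\<in>Cd. c xs \<mu>) \<le> (SUP \<mu>\<in>Cd. c x \<mu>)" if "x \<in> Cp" for x
    using s1 s2[OF that] \<mu>s by (intro SUP_least) (meson SUP_upper2 order_trans)
  then show "xs \<in> primal_solutions Cp Cd f g h l T"
    using xs unfolding primal_solutions_def argmin_on_def c_def by blast
  have "(INF x\<in>Cp. c x \<mu>) \<le> (INF x\<in>Cp. c x \<mu>s)" if "\<mu> \<in> Cd" for \<mu>
    using s2 s1[OF that] xs by (intro INF_greatest) (meson INF_lower2 order_trans)
  then show "\<mu>s \<in> dual_solutions Cp Cd f g h l T"
    using \<mu>s unfolding dual_solutions_def argmax_on_def c_def by blast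
qed

text \<open>
  Only nonnegativity of the numerator is extracted. It also holds where the denominator vanishes, because a
  negative number divided by \<open>0\<close> is \<open>-\<infinity>\<close>, and trivially for equal arguments.
\<close>

lemma coercivity_assumptionD:
  assumes co: "coercivity_assumption g l T \<phi>p \<phi>d Lp Ld lamI \<nu>I"
    and \<phi>p: "extended_convex \<phi>p" and \<phi>d: "extended_convex \<phi>d"
    and x: "x1 \<in> dom_region \<phi>p g" "x2 \<in> int_region \<phi>p g"
    and \<mu>: "\<mu>1 \<in> dom_region \<phi>d (fenchel_conj l)" "\<mu>2 \<in> int_region \<phi>d (fenchel_conj l)"
  shows "T (x1 - x2) (\<mu>1 - \<mu>2)
    \<le> (1 / lamI - Lp) * breg \<phi>p x1 x2 + (1 / \<nu>I - Ld) * breg \<phi>d \<mu>1 \<mu>2"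
proof (cases "(x1, \<mu>1) = (x2, \<mu>2)")
  case True then show ?thesis by simp
next
  case False
  define n where "n = (1 / lamI - Lp) * breg \<phi>p x1 x2 + (1 / \<nu>I - Ld) * breg \<phi>d \<mu>1 \<mu>2 - T (x1 - x2) (\<mu>1 - \<mu>2)"
  have b: "bregman \<phi>p x1 x2 = ereal (breg \<phi>p x1 x2)" "bregman \<phi>d \<mu>1 \<mu>2 = ereal (breg \<phi>d \<mu>1 \<mu>2)"
    using x \<mu> unfolding dom_region_def int_region_def
    by (auto intro: bregman_eq_breg[OF \<phi>p] bregman_eq_breg[OF \<phi>d])
  obtain d :: "'a \<times> 'b \<Rightarrow> 'a \<times> 'b \<Rightarrow> real" and \<epsilon> :: real where d: "\<And>w1 w2. 0 \<le> d w1 w2" and \<epsilon>: "0 \<le> \<epsilon>"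
    and le: "ereal \<epsilon> \<le> Inf {(ereal (1 / lamI - Lp) * bregman \<phi>p x1 x2
                           + ereal (1 / \<nu>I - Ld) * bregman \<phi>d \<mu>1 \<mu>2
                           - ereal (T (x1 - x2) (\<mu>1 - \<mu>2))) / ereal (d (x1, \<mu>1) (x2, \<mu>2)) | x1 \<mu>1 x2 \<mu>2.
             x1 \<in> dom_region \<phi>p g \<and> \<mu>1 \<in> dom_region \<phi>d (fenchel_conj l) \<and>
             x2 \<in> int_region \<phi>p g \<and> \<mu>2 \<in> int_region \<phi>d (fenchel_conj l) \<and> (x1, \<mu>1) \<noteq> (x2, \<mu>2)}" (is "_ \<le> Inf ?S")
    using co unfolding coercivity_assumption_def by blast
  have N: "ereal (1 / lamI - Lp) * bregman \<phi>p x1 x2 + ereal (1 / \<nu>I - Ld) * bregman \<phi>d \<mu>1 \<mu>2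
      - ereal (T (x1 - x2) (\<mu>1 - \<mu>2)) = ereal n"
    unfolding b n_def by simp
  have "(ereal (1 / lamI - Lp) * bregman \<phi>p x1 x2 + ereal (1 / \<nu>I - Ld) * bregman \<phi>d \<mu>1 \<mu>2
      - ereal (T (x1 - x2) (\<mu>1 - \<mu>2))) / ereal (d (x1, \<mu>1) (x2, \<mu>2)) \<in> ?S"
    using x \<mu> False by blast
  then have "ereal \<epsilon> \<le> ereal n / ereal (d (x1, \<mu>1) (x2, \<mu>2))"
    unfolding N[symmetric] by (intro order_trans[OF le] Inf_lower)
  then have 0: "0 \<le> ereal n / ereal (d (x1, \<mu>1) (x2, \<mu>2))" using \<epsilon> by (metis ereal_less_eq(5) order_trans)
  have "0 \<le> n"
  proof (cases "d (x1, \<mu>1) (x2, \<mu>2) = 0")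
    case True then show ?thesis using 0 by (cases "n < 0") (auto simp: divide_ereal_def)
  next
    case False then show ?thesis using 0 d[of "(x1, \<mu>1)" "(x2, \<mu>2)"] by (auto simp: zero_le_divide_iff)
  qed
  then show ?thesis unfolding n_def by simp
qed

section \<open>The energy of an iterate\<close>

text \<open>
  A saddle point \<open>(xs, \<mu>s)\<close> with its real-valued inequalities. The functions \<open>hs\<close> and \<open>ls\<close> stand for the
  conjugates \<open>h\<^sup>*\<close> and \<open>l\<^sup>*\<close>, and the constraint sets are the domains of the entropies.
\<close>

locale primal_dual_setting =
  fixes f g \<phi>p :: "'x::banach \<Rightarrow> ereal" and hs ls \<phi>d :: "'y::banach \<Rightarrow> ereal"
    and T :: "'x \<Rightarrow>\<^sub>L 'y dual" and Lp Ld lamI \<nu>I :: real and xs :: 'x and \<mu>s :: 'y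
  assumes f: "f \<in> Gamma0" and g: "g \<in> Gamma0" and \<phi>p: "\<phi>p \<in> Gamma0"
    and hs: "hs \<in> Gamma0" and ls: "ls \<in> Gamma0" and \<phi>d: "\<phi>d \<in> Gamma0"
    and dom_p: "edom \<phi>p \<subseteq> edom f" and dom_d: "edom \<phi>d \<subseteq> edom hs"
    and diff_p: "gateaux_differentiable_on \<phi>p (interior (edom \<phi>p))"
    and diff_d: "gateaux_differentiable_on \<phi>d (interior (edom \<phi>d))"
    and smooth_p: "relatively_smooth Lp f \<phi>p" and smooth_d: "relatively_smooth Ld hs \<phi>d"
    and steps_pos: "0 < lamI" "0 < \<nu>I"
    and nonempty: "int_region \<phi>p g \<noteq> {}" "int_region \<phi>d ls \<noteq> {}"
    and xs: "xs \<in> edom \<phi>p" "xs \<in> edom g" and \<mu>s: "\<mu>s \<in> edom \<phi>d" "\<mu>s \<in> edom ls"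
    and saddle_p: "\<And>x. x \<in> edom \<phi>p \<Longrightarrow> x \<in> edom g \<Longrightarrow>
      fval f xs + fval g xs + T xs \<mu>s \<le> fval f x + fval g x + T x \<mu>s"
    and saddle_d: "\<And>\<mu>. \<mu> \<in> edom \<phi>d \<Longrightarrow> \<mu> \<in> edom ls \<Longrightarrow>
      T xs \<mu> - fval hs \<mu> - fval ls \<mu> \<le> T xs \<mu>s - fval hs \<mu>s - fval ls \<mu>s"
    and coercive: "\<And>x1 x2 \<mu>1 \<mu>2. x1 \<in> dom_region \<phi>p g \<Longrightarrow> x2 \<in> int_region \<phi>p g \<Longrightarrow>
      \<mu>1 \<in> dom_region \<phi>d ls \<Longrightarrow> \<mu>2 \<in> int_region \<phi>d ls \<Longrightarrow>
      T (x1 - x2) (\<mu>1 - \<mu>2) \<le> (1 / lamI - Lp) * breg \<phi>p x1 x2 + (1 / \<nu>I - Ld) * breg \<phi>d \<mu>1 \<mu>2"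
begin

lemma extended_convex:
  "extended_convex f" "extended_convex g" "extended_convex \<phi>p"
  "extended_convex hs" "extended_convex ls" "extended_convex \<phi>d"
  using f g \<phi>p hs ls \<phi>d Gamma0_extended_convex by blast+

lemma diff_f: "gateaux_differentiable_on f (interior (edom \<phi>p))"
  and diff_hs: "gateaux_differentiable_on hs (interior (edom \<phi>d))"
  using smooth_p smooth_d unfolding relatively_smooth_def by auto

lemma saddle_point_in_dom_region: "xs \<in> dom_region \<phi>p g" "\<mu>s \<in> dom_region \<phi>d ls"
proof -
  have dg: "x \<in> edom G" if "x \<in> dom_subdiff G" for x :: "'a::real_normed_vector" and G
    using that subdiff_edom unfolding dom_subdiff_def by blast
  obtain a where a: "a \<in> interior (edom \<phi>p)" "a \<in> edom g"
    using nonempty(1) dg unfolding int_region_def by blast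
  have "xs \<in> dom_subdiff g"
  proof (rule minimiser_of_sum_in_dom_subdiff[OF f extended_convex(2) convex_edom[OF extended_convex(3)] dom_p a xs])
    fix y assume "y \<in> edom \<phi>p" "y \<in> edom g"
    then show "fval f xs + adjoint_map T \<mu>s xs + fval g xs \<le> fval f y + adjoint_map T \<mu>s y + fval g y"
      using saddle_p[of y] by simp
  qed
  then show "xs \<in> dom_region \<phi>p g" using xs unfolding dom_region_def by blast
  obtain b where b: "b \<in> interior (edom \<phi>d)" "b \<in> edom ls"
    using nonempty(2) dg unfolding int_region_def by blast
  have "\<mu>s \<in> dom_subdiff ls"
  proof (rule minimiser_of_sum_in_dom_subdiff[OF hs extended_convex(5) convex_edom[OF extended_convex(6)] dom_d b \<mu>s])
    fix \<mu> assume "\<mu> \<in> edom \<phi>d" "\<mu> \<in> edom ls"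
    then show "fval hs \<mu>s + (- T xs) \<mu>s + fval ls \<mu>s \<le> fval hs \<mu> + (- T xs) \<mu> + fval ls \<mu>"
      using saddle_d[of \<mu>] by (simp add: blinfun.minus_left)
  qed
  then show "\<mu>s \<in> dom_region \<phi>d ls" using \<mu>s unfolding dom_region_def by blast
qed

lemma int_region_interior:
  "x \<in> int_region \<phi>p g \<Longrightarrow> x \<in> interior (edom \<phi>p)" "\<mu> \<in> int_region \<phi>d ls \<Longrightarrow> \<mu> \<in> interior (edom \<phi>d)"
  unfolding int_region_def by auto

lemma int_region_dom_region:
  "x \<in> int_region \<phi>p g \<Longrightarrow> x \<in> dom_region \<phi>p g" "\<mu> \<in> int_region \<phi>d ls \<Longrightarrow> \<mu> \<in> dom_region \<phi>d ls"
  unfolding int_region_def dom_region_def using interior_subset by blast+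

lemma int_region_edom:
  assumes "x \<in> int_region \<phi>p g" shows "x \<in> edom \<phi>p" "x \<in> edom g"
  using assms interior_subset subdiff_edom unfolding int_region_def dom_subdiff_def by blast+

lemma int_region_edom':
  assumes "x \<in> int_region \<phi>d ls" shows "x \<in> edom \<phi>d" "x \<in> edom ls"
  using assms interior_subset subdiff_edom unfolding int_region_def dom_subdiff_def by blast+

lemma breg_p_nonneg: "x \<in> edom \<phi>p \<Longrightarrow> y \<in> int_region \<phi>p g \<Longrightarrow> 0 \<le> breg \<phi>p x y"
  using breg_nonneg[OF extended_convex(3) diff_p] int_region_interior by blast

lemma breg_d_nonneg: "\<mu> \<in> edom \<phi>d \<Longrightarrow> \<eta> \<in> int_region \<phi>d ls \<Longrightarrow> 0 \<le> breg \<phi>d \<mu> \<eta>"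
  using breg_nonneg[OF extended_convex(6) diff_d] int_region_interior by blast

definition energy :: "real \<Rightarrow> real \<Rightarrow> 'x \<Rightarrow> 'y \<Rightarrow> real" where
  "energy a b x \<mu> = (1 / a) * breg \<phi>p xs x + (1 / b) * breg \<phi>d \<mu>s \<mu> - T (xs - x) (\<mu>s - \<mu>)"

lemma energy_antimono:
  assumes "0 < a" "a \<le> a'" "0 < b" "b \<le> b'" "x \<in> int_region \<phi>p g" "\<mu> \<in> int_region \<phi>d ls"
  shows "energy a' b' x \<mu> \<le> energy a b x \<mu>"
proof -
  have "(1 / a') * breg \<phi>p xs x \<le> (1 / a) * breg \<phi>p xs x"
    using assms breg_p_nonneg[OF xs(1), of x] by (intro mult_right_mono) (auto simp: frac_le)
  moreover have "(1 / b') * breg \<phi>d \<mu>s \<mu> \<le> (1 / b) * breg \<phi>d \<mu>s \<mu>"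
    using assms breg_d_nonneg[OF \<mu>s(1), of \<mu>] by (intro mult_right_mono) (auto simp: frac_le)
  ultimately show ?thesis unfolding energy_def by linarith
qed

lemma energy_nonneg:
  assumes "0 < a" "a \<le> lamI" "0 < b" "b \<le> \<nu>I" and x: "x \<in> int_region \<phi>p g" and \<mu>: "\<mu> \<in> int_region \<phi>d ls"
  shows "0 \<le> energy a b x \<mu>"
proof -
  have "0 \<le> Lp * breg \<phi>p xs x"
    using relatively_smooth_breg_nonneg[OF extended_convex(1) \<phi>p diff_p smooth_p xs(1)] int_region_interior x by blast
  moreover have "0 \<le> Ld * breg \<phi>d \<mu>s \<mu>"
    using relatively_smooth_breg_nonneg[OF extended_convex(4) \<phi>d diff_d smooth_d \<mu>s(1)] int_region_interior \<mu> by blast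
  moreover have "T (xs - x) (\<mu>s - \<mu>) \<le> (1 / lamI - Lp) * breg \<phi>p xs x + (1 / \<nu>I - Ld) * breg \<phi>d \<mu>s \<mu>"
    using coercive saddle_point_in_dom_region x \<mu> by blast
  ultimately have "0 \<le> energy lamI \<nu>I x \<mu>" unfolding energy_def by (simp add: left_diff_distrib)
  then show ?thesis using energy_antimono[OF assms] by simp
qed

text \<open>
  The primal and dual step inequalities at the saddle point are added to the saddle point inequalities at
  \<open>(x', \<mu>')\<close>. The divergences between old and new iterates and the remaining bilinear term form exactly the
  expression that the coercivity assumption makes nonnegative, so there is nothing left of the step
  length \<open>D(x', x)\<close>; this is why errors cannot be absorbed into it later.
\<close>

lemma energy_descent:
  assumes a: "0 < a" "a \<le> lamI" and b: "0 < b" "b \<le> \<nu>I"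
    and x: "x \<in> int_region \<phi>p g" "x' \<in> int_region \<phi>p g" and \<mu>: "\<mu> \<in> int_region \<phi>d ls" "\<mu>' \<in> int_region \<phi>d ls"
  shows "energy a b x' \<mu>' + step_excess f g \<phi>p a (dp + adjoint_map T \<mu>) xs x x'
      + step_excess hs ls \<phi>d b (dd - T (2 *\<^sub>R x' - x)) \<mu>s \<mu> \<mu>'
    \<le> energy a b x \<mu> + dp (xs - x') + dd (\<mu>s - \<mu>')"
proof -
  have p: "step_excess f g \<phi>p a (dp + adjoint_map T \<mu>) xs x x'
      + (1 / a) * (breg \<phi>p xs x' + breg \<phi>p x' x - breg \<phi>p xs x) - Lp * breg \<phi>p x' x - (dp + adjoint_map T \<mu>) (xs - x')
    \<le> (fval f xs + fval g xs) - (fval f x' + fval g x')"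
    by (intro step_descent extended_convex diff_p smooth_p int_region_interior x)
  have d: "step_excess hs ls \<phi>d b (dd - T (2 *\<^sub>R x' - x)) \<mu>s \<mu> \<mu>'
      + (1 / b) * (breg \<phi>d \<mu>s \<mu>' + breg \<phi>d \<mu>' \<mu> - breg \<phi>d \<mu>s \<mu>) - Ld * breg \<phi>d \<mu>' \<mu> - (dd - T (2 *\<^sub>R x' - x)) (\<mu>s - \<mu>')
    \<le> (fval hs \<mu>s + fval ls \<mu>s) - (fval hs \<mu>' + fval ls \<mu>')"
    by (intro step_descent extended_convex diff_d smooth_d int_region_interior \<mu>)
  have "T (x' - x) (\<mu>' - \<mu>) \<le> (1 / lamI - Lp) * breg \<phi>p x' x + (1 / \<nu>I - Ld) * breg \<phi>d \<mu>' \<mu>"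
    using coercive int_region_dom_region x \<mu> by blast
  also have "\<dots> \<le> (1 / a - Lp) * breg \<phi>p x' x + (1 / b - Ld) * breg \<phi>d \<mu>' \<mu>"
    using a b breg_p_nonneg[OF int_region_edom(1)] breg_d_nonneg[OF int_region_edom'(1)] x \<mu>
    by (intro add_mono mult_right_mono) (auto simp: frac_le)
  finally have c: "T (x' - x) (\<mu>' - \<mu>) \<le> (1 / a) * breg \<phi>p x' x - Lp * breg \<phi>p x' x
      + ((1 / b) * breg \<phi>d \<mu>' \<mu> - Ld * breg \<phi>d \<mu>' \<mu>)" by (simp add: left_diff_distrib)
  have sp: "fval f xs + fval g xs + T xs \<mu>s \<le> fval f x' + fval g x' + T x' \<mu>s"
    using saddle_p int_region_edom x by blast
  have sd: "T xs \<mu>' - fval hs \<mu>' - fval ls \<mu>' \<le> T xs \<mu>s - fval hs \<mu>s - fval ls \<mu>s"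
    using saddle_d int_region_edom' \<mu> by blast
  \<comment> \<open>The extrapolation \<open>2x' - x\<close> makes the bilinear terms telescope.\<close>
  have bil: "T (xs - x') \<mu> - T (2 *\<^sub>R x' - x) (\<mu>s - \<mu>') + T x' \<mu>s - T xs \<mu>'
      = T (xs - x') (\<mu>s - \<mu>') - T (xs - x) (\<mu>s - \<mu>) + T (x' - x) (\<mu>' - \<mu>)"
    by (simp add: blinfun.diff_left blinfun.diff_right blinfun.scaleR_left blinfun.scaleR_right)
  show ?thesis
    using p d c sp sd bil unfolding energy_def
    by (simp add: blinfun.add_left blinfun.diff_left[of dd] distrib_left right_diff_distrib)
qed

end

section \<open>Quantising maps into the dual of a reflexive space\<close>

lemma countable_dense_subset:
  fixes S :: "'a::metric_space set"
  assumes D: "countable D" and S: "S \<subseteq> closure D"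
  obtains E where "countable E" "E \<subseteq> S" "S \<subseteq> closure E"
proof -
  define p where "p = (\<lambda>(d, n). SOME s. s \<in> S \<and> dist d s < inverse (real (Suc n)))"
  define I where "I = {(d, n). d \<in> D \<and> (\<exists>s\<in>S. dist d s < inverse (real (Suc n)))}"
  have p: "p (d, n) \<in> S \<and> dist d (p (d, n)) < inverse (real (Suc n))" if "(d, n) \<in> I" for d n
  proof -
    have "\<exists>s. s \<in> S \<and> dist d s < inverse (real (Suc n))" using that unfolding I_def by blast
    then show ?thesis unfolding p_def prod.case by (rule someI_ex)
  qed
  have "I \<subseteq> D \<times> UNIV" unfolding I_def by auto
  then have "countable I" by (rule countable_subset) (use D in auto)
  then have "countable (p ` I)" by simp
  moreover have "p ` I \<subseteq> S" using p by auto
  moreover have "S \<subseteq> closure (p ` I)"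
  proof
    fix s assume s: "s \<in> S"
    show "s \<in> closure (p ` I)" unfolding closure_approachable
    proof (intro allI impI)
      fix e :: real assume e: "0 < e"
      obtain n where n: "inverse (real (Suc n)) < e / 2" using reals_Archimedean[of "e / 2"] e by auto
      have "0 < inverse (real (Suc n))" by simp
      then obtain d where d: "d \<in> D" "dist d s < inverse (real (Suc n))"
        using s S unfolding closure_approachable subset_eq by blast
      have "(d, n) \<in> I" using d s unfolding I_def by blast
      moreover have "dist (p (d, n)) s < e"
        using p[OF \<open>(d, n) \<in> I\<close>] d(2) n dist_triangle3[of "p (d, n)" s d] by linarith
      ultimately show "\<exists>y\<in>p ` I. dist y s < e" by blast
    qed
  qed
  ultimately show thesis using that by blast
qed

lemma countable_dense_in_span:
  fixes G :: "'a::real_normed_vector set"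
  assumes G: "countable G"
  obtains Q where "countable Q" "span G \<subseteq> closure Q"
proof -
  define c where "c L = (\<Sum>(r, v)\<leftarrow>L. real_of_rat r *\<^sub>R v)" for L :: "(rat \<times> 'a) list"
  define Q where "Q = c ` lists (UNIV \<times> G)"
  have "countable (UNIV \<times> G :: (rat \<times> 'a) set)" using G by (intro countable_SIGMA) auto
  then have "countable Q" unfolding Q_def by simp
  moreover have "x \<in> closure Q" if "x \<in> span G" for x
    using that
  proof (induction rule: span_induct_alt)
    case base
    have "c [] \<in> Q" unfolding Q_def by blast
    then show ?case using closure_subset unfolding c_def by auto
  next
    case (step r v y)
    show ?case unfolding closure_approachable
    proof (intro allI impI)
      fix e :: real assume e: "0 < e"
      obtain q where q: "q \<in> Q" "dist q y < e / 2" using step(2) e unfolding closure_approachable by (meson half_gt_zero)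
      obtain L where L: "L \<in> lists (UNIV \<times> G)" "q = c L" using q(1) unfolding Q_def by blast
      define \<eta> where "\<eta> = e / (2 * (norm v + 1))"
      have \<eta>: "0 < \<eta>" unfolding \<eta>_def using e by (simp add: add_nonneg_pos)
      obtain s where s: "r < real_of_rat s" "real_of_rat s < r + \<eta>" using of_rat_dense[of r "r + \<eta>"] \<eta> by auto
      have "norm ((real_of_rat s - r) *\<^sub>R v) \<le> \<eta> * (norm v + 1)"
        using s \<eta> by (auto intro!: mult_mono)
      also have "\<dots> = e / 2" unfolding \<eta>_def by (simp add: add_nonneg_eq_0_iff field_simps)
      finally have 1: "norm ((real_of_rat s - r) *\<^sub>R v) \<le> e / 2" .
      have "c ((s, v) # L) = real_of_rat s *\<^sub>R v + q" unfolding c_def L(2) by simp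
      moreover have "(s, v) # L \<in> lists (UNIV \<times> G)" using L(1) step(1) by simp
      ultimately have 2: "real_of_rat s *\<^sub>R v + q \<in> Q" unfolding Q_def by (metis imageI)
      have "dist (real_of_rat s *\<^sub>R v + q) (r *\<^sub>R v + y) = norm ((real_of_rat s - r) *\<^sub>R v + (q - y))"
        by (simp add: dist_norm algebra_simps)
      also have "\<dots> < e" using 1 q(2) norm_triangle_ineq[of "(real_of_rat s - r) *\<^sub>R v" "q - y"]
        by (simp add: dist_norm)
      finally show "\<exists>z\<in>Q. dist z (r *\<^sub>R v + y) < e" using 2 by blast
    qed
  qed
  ultimately show thesis using that by blast
qed

text \<open>
  On a separable set of functionals the norm is a supremum over countably many vectors, and hence measurable as soon as
  the individual pairings are.
\<close>

lemma countable_norming_set: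
  fixes Q :: "'a::real_normed_vector dual set"
  assumes Q: "countable Q"
  obtains V where "countable V" "\<And>v. v \<in> V \<Longrightarrow> norm v \<le> 1"
    "\<And>u e. u \<in> closure Q \<Longrightarrow> 0 < e \<Longrightarrow> \<exists>v\<in>V. norm u - e < u v"
proof -
  have ex: "\<exists>v. norm v \<le> 1 \<and> norm u - e < u v" if e: "0 < e" for u :: "'a dual" and e
  proof (rule ccontr)
    assume n: "\<not> ?thesis"
    then have le: "u v \<le> norm u - e" if "norm v \<le> 1" for v using that by force
    have "0 \<le> norm u - e" using le[of 0] by simp
    moreover have "norm (u v) \<le> (norm u - e) * norm v" for v
    proof (cases "v = 0")
      case False
      have 1: "norm ((1 / norm v) *\<^sub>R v) \<le> 1" "norm (- ((1 / norm v) *\<^sub>R v)) \<le> 1" using False by auto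
      have "\<bar>u ((1 / norm v) *\<^sub>R v)\<bar> \<le> norm u - e"
        using le[OF 1(1)] le[OF 1(2)] unfolding blinfun.minus_right by linarith
      then show ?thesis using False by (simp add: blinfun.scaleR_right abs_mult divide_le_eq)
    qed simp
    ultimately have "norm u \<le> norm u - e" by (rule norm_blinfun_bound)
    then show False using e by simp
  qed
  define v where "v = (\<lambda>(u :: 'a dual, n). SOME v. norm v \<le> 1 \<and> norm u - inverse (real (Suc n)) < blinfun_apply u v)"
  have v: "norm (v (u, n)) \<le> 1" "norm u - inverse (real (Suc n)) < u (v (u, n))" for u n
    using someI_ex[OF ex[of "inverse (real (Suc n))" u]] unfolding v_def by auto
  have "countable (v ` (Q \<times> UNIV))" using Q by (intro countable_image countable_SIGMA) auto
  moreover have "norm w \<le> 1" if "w \<in> v ` (Q \<times> UNIV)" for w using that v by auto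
  moreover have "\<exists>w\<in>v ` (Q \<times> UNIV). norm u - e < u w" if u: "u \<in> closure Q" and e: "0 < e" for u e
  proof -
    obtain q where q: "q \<in> Q" "dist q u < e / 3" using u e unfolding closure_approachable by (metis divide_pos_pos zero_less_numeral)
    obtain n where n: "inverse (real (Suc n)) < e / 3" using reals_Archimedean[of "e / 3"] e by auto
    have "\<bar>(q - u) (v (q, n))\<bar> \<le> norm (q - u) * norm (v (q, n))"
      using norm_blinfun[of "q - u" "v (q, n)"] by simp
    also have "\<dots> \<le> norm (q - u)" using v(1)[of q n] by (simp add: mult_left_le)
    finally have "q (v (q, n)) - u (v (q, n)) \<le> e / 3"
      using q(2) by (simp add: blinfun.diff_left dist_norm)
    moreover have "norm u \<le> norm q + e / 3" using q(2) norm_triangle_ineq3[of u q] by (simp add: dist_norm norm_minus_commute)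
    ultimately have "norm u - e < u (v (q, n))" using v(2)[of q n] n by linarith
    then show ?thesis using q(1) by blast
  qed
  ultimately show thesis using that by blast
qed

text \<open>
  Mazur's theorem in disguise. If \<open>G w\<close> were outside the closed span of the values of \<open>G\<close> on a countable dense
  set, some functional on the dual would separate it from that span. By reflexivity the functional is
  evaluation at a vector \<open>v\<close>, and continuity of \<open>\<langle>G(\<cdot>), v\<rangle>\<close> gives a contradiction.
\<close>

lemma separable_weakly_continuous_image:
  fixes G :: "'w::metric_space \<Rightarrow> 'a::real_normed_vector dual"
  assumes refl: "reflexive_space TYPE('a)" and D: "countable D" and S: "S \<subseteq> closure D"
    and G: "\<And>v. continuous_on S (\<lambda>w. (G w) v)"
  obtains Q where "countable Q" "G ` S \<subseteq> closure Q"
proof -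
  obtain S0 where S0: "countable S0" "S0 \<subseteq> S" "S \<subseteq> closure S0"
    using countable_dense_subset[OF D S] by blast
  define W where "W = span (G ` S0)"
  have GW: "G w \<in> closure W" if w: "w \<in> S" for w
  proof (rule ccontr)
    assume "G w \<notin> closure W"
    then obtain \<Phi> :: "'a dual dual" where \<Phi>: "\<And>u. u \<in> W \<Longrightarrow> \<Phi> u = 0" "\<Phi> (G w) \<noteq> 0"
      using bounded_functional_vanishing_on_subspace[of W "G w"] subspace_span unfolding W_def by metis
    obtain v where v: "\<And>u. \<Phi> u = u v" using refl unfolding reflexive_space_def by blast
    obtain s where s: "\<And>n. s n \<in> S0" "s \<longlonglongrightarrow> w" using w S0(3) unfolding closure_sequential subset_eq by blast
    have "(\<lambda>n. (G (s n)) v) \<longlonglongrightarrow> (G w) v"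
      using continuous_on_tendsto_compose[OF G s(2) w] s(1) S0(2) by (auto intro: always_eventually)
    moreover have "(G (s n)) v = 0" for n
      using \<Phi>(1)[of "G (s n)"] s(1) span_base[of "G (s n)" "G ` S0"] v unfolding W_def by auto
    ultimately have "(G w) v = 0" by (simp add: LIMSEQ_const_iff)
    then show False using \<Phi>(2) v by simp
  qed
  obtain Q where Q: "countable Q" "W \<subseteq> closure Q"
    unfolding W_def by (rule countable_dense_in_span[OF countable_image[OF S0(1)]])
  have "closure W \<subseteq> closure Q" by (rule closure_minimal[OF Q(2) closed_closure])
  then have "G ` S \<subseteq> closure Q" using GW by (intro image_subsetI) (rule subsetD)
  then show thesis using that Q(1) by blast
qed

text \<open>
  The range is norm separable, so \<open>q\<close> may send a point to the first member of a dense sequence that is within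
  \<open>\<eta> / 2\<close> of its image. Measurability of \<open>q\<close> needs a countable norming set, since only the pairings
  with fixed vectors are continuous.
\<close>

lemma quantise_weakly_continuous_map:
  fixes G :: "'w::metric_space \<Rightarrow> 'a::real_normed_vector dual"
  assumes refl: "reflexive_space TYPE('a)" and D: "countable D" and S: "S \<subseteq> closure D" "S \<subseteq> U"
    and U: "open U" and G: "\<And>v. continuous_on U (\<lambda>w. (G w) v)" and \<eta>: "0 < \<eta>"
  obtains q :: "'w \<Rightarrow> nat" where "q \<in> measurable borel (count_space UNIV)"
    "\<And>w w'. w \<in> S \<Longrightarrow> w' \<in> S \<Longrightarrow> q w = q w' \<Longrightarrow> norm (G w - G w') \<le> \<eta>"
proof -
  obtain Q where Q: "countable Q" "G ` S \<subseteq> closure Q"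
    using separable_weakly_continuous_image[OF refl D S(1)] G continuous_on_subset[OF _ S(2)] by blast
  obtain E where E: "countable E" "E \<subseteq> G ` S" "G ` S \<subseteq> closure E"
    using countable_dense_subset[OF Q] by blast
  define e where "e = from_nat_into E"
  define E2 where "E2 = (\<lambda>(a, b). a - b) ` (E \<times> E)"
  have "countable E2" unfolding E2_def using E(1) by (intro countable_image countable_SIGMA)
  then obtain V where V: "countable V" "\<And>v. v \<in> V \<Longrightarrow> norm v \<le> 1"
    "\<And>u \<epsilon>. u \<in> closure E2 \<Longrightarrow> 0 < \<epsilon> \<Longrightarrow> \<exists>v\<in>V. norm u - \<epsilon> < u v"
    using countable_norming_set by blast
  have e_in: "e j \<in> E" if "w \<in> S" for w j
    using that E(3) from_nat_into[of E j] unfolding e_def by fastforce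
  have dense: "\<exists>j. dist (e j) (G w) < \<epsilon>" if w: "w \<in> S" and \<epsilon>: "0 < \<epsilon>" for w \<epsilon>
  proof -
    have "G w \<in> closure E" using w E(3) by blast
    then obtain b where b: "b \<in> E" "dist b (G w) < \<epsilon>" using \<epsilon> unfolding closure_approachable by blast
    then obtain j where "e j = b" using from_nat_into_surj[OF E(1)] unfolding e_def by blast
    then show ?thesis using b by blast
  qed
  define B where "B j w \<longleftrightarrow> (\<forall>v\<in>V. indicator U w * (G w) v - (e j) v \<le> \<eta> / 2)" for j w
  have B_iff: "B j w \<longleftrightarrow> norm (G w - e j) \<le> \<eta> / 2" if w: "w \<in> S" for j w
  proof
    assume B: "B j w"
    have "G w - e j \<in> closure E2" unfolding closure_approachable
    proof (intro allI impI)
      fix \<epsilon> :: real assume "0 < \<epsilon>"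
      then obtain i where i: "dist (e i) (G w) < \<epsilon>" using dense[OF w] by blast
      have "e i - e j \<in> E2" unfolding E2_def using e_in[OF w] by blast
      moreover have "dist (e i - e j) (G w - e j) < \<epsilon>" using i by (simp add: dist_norm)
      ultimately show "\<exists>y\<in>E2. dist y (G w - e j) < \<epsilon>" by blast
    qed
    note cl = this
    have le: "(G w - e j) v \<le> \<eta> / 2" if "v \<in> V" for v
      using B that w S(2) unfolding B_def by (auto simp: blinfun.diff_left subset_eq)
    show "norm (G w - e j) \<le> \<eta> / 2"
    proof (rule field_le_epsilon)
      fix \<epsilon> :: real assume "0 < \<epsilon>"
      then obtain v where v: "v \<in> V" "norm (G w - e j) - \<epsilon> < (G w - e j) v"
        using V(3)[OF cl] by blast
      then show "norm (G w - e j) \<le> \<eta> / 2 + \<epsilon>" using le[OF v(1)] by linarith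
    qed
  next
    assume n: "norm (G w - e j) \<le> \<eta> / 2"
    have "(G w - e j) v \<le> \<eta> / 2" if "v \<in> V" for v
    proof -
      have "(G w - e j) v \<le> norm (G w - e j) * norm v"
        using norm_blinfun[of "G w - e j" v] by simp
      also have "\<dots> \<le> norm (G w - e j)" using V(2)[OF that] by (simp add: mult_left_le)
      finally show ?thesis using n by simp
    qed
    then show "B j w" using w S(2) unfolding B_def by (auto simp: blinfun.diff_left subset_eq)
  qed
  define q where "q w = (LEAST j. B j w)" for w
  have "(\<lambda>w. indicator U w * (G w) v) \<in> borel_measurable borel" for v
    using borel_measurable_continuous_on_indicator[OF _ G, of v] U by simp
  then have "(\<lambda>w. B j w) \<in> measurable borel (count_space UNIV)" for j
    unfolding B_def using V(1) by measurable
  then have "q \<in> measurable borel (count_space UNIV)" unfolding q_def by (rule measurable_Least)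
  moreover have "norm (G w - G w') \<le> \<eta>" if w: "w \<in> S" "w' \<in> S" "q w = q w'" for w w'
  proof -
    have B: "B (q w) w" if "w \<in> S" for w
    proof -
      obtain j where "dist (e j) (G w) < \<eta> / 2" using dense[OF \<open>w \<in> S\<close>, of "\<eta> / 2"] \<eta> by auto
      then have "B j w" unfolding B_iff[OF that] by (simp add: dist_norm norm_minus_commute)
      then show ?thesis unfolding q_def by (rule LeastI)
    qed
    have "norm (G w - e (q w)) \<le> \<eta> / 2" "norm (G w' - e (q w)) \<le> \<eta> / 2"
      using B[OF w(1)] B[OF w(2)] w B_iff by auto
    then show ?thesis using norm_triangle_ineq4[of "G w - e (q w)" "G w' - e (q w)"] by simp
  qed
  ultimately show thesis using that by blast
qed

section \<open>Functionals of Bochner integrals\<close>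

text \<open>
  The approximating simple functions are composed with the functional. Differences of Borel maps into a
  nonseparable space need not be Borel, so measurability of \<open>\<parallel>X - s\<^sub>i\<parallel>\<close> is obtained from the finitely many
  values of \<open>s\<^sub>i\<close>.
\<close>

lemma has_bochner_integral_gen_functional:
  fixes X :: "'w \<Rightarrow> 'b::real_normed_vector" and L :: "'b \<Rightarrow> real"
  assumes X: "has_bochner_integral_gen M X I" and L: "bounded_linear L"
  shows "has_bochner_integral M (\<lambda>\<omega>. L (X \<omega>)) (L I)"
proof -
  interpret L: bounded_linear L by fact
  obtain s where s: "\<And>i. Bochner_Integration.simple_bochner_integrable M (s i)"
    "(\<lambda>i. \<integral>\<^sup>+\<omega>. ennreal (norm (X \<omega> - s i \<omega>)) \<partial>M) \<longlonglongrightarrow> 0"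
    "(\<lambda>i. Bochner_Integration.simple_bochner_integral M (s i)) \<longlonglongrightarrow> I"
    and Xm: "X \<in> borel_measurable M"
    using X unfolding has_bochner_integral_gen_def by blast
  have simp: "simple_function M (s i)" for i using s(1)[of i] by (auto elim: simple_bochner_integrable.cases)
  have meas: "(\<lambda>\<omega>. norm (X \<omega> - s i \<omega>)) \<in> borel_measurable M" for i
  proof (rule measurable_compose_countable'[where f = "\<lambda>c \<omega>. norm (X \<omega> - c)" and I = "s i ` space M"])
    show "(\<lambda>\<omega>. norm (X \<omega> - c)) \<in> borel_measurable M" for c
      using measurable_compose[OF Xm, of "\<lambda>x. norm (x - c)" borel] by (simp add: borel_measurable_continuous_onI continuous_on_norm continuous_on_diff)
    show "s i \<in> measurable M (count_space (s i ` space M))"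
      using measurable_sets[OF measurable_simple_function[OF simp]] by (intro measurableI) auto
    show "countable (s i ` space M)" using simple_functionD(1)[OF simp] by (rule countable_finite)
  qed
  have bound: "\<bar>L (X \<omega>) - L (s i \<omega>)\<bar> \<le> onorm L * norm (X \<omega> - s i \<omega>)" for \<omega> i
    using onorm[OF L, of "X \<omega> - s i \<omega>"] by (simp add: L.diff)
  show ?thesis
  proof (rule has_bochner_integral.intros)
    show "(\<lambda>\<omega>. L (X \<omega>)) \<in> borel_measurable M"
      by (rule measurable_compose[OF Xm]) (intro borel_measurable_continuous_onI L.continuous_on continuous_on_id)
    show "Bochner_Integration.simple_bochner_integrable M (\<lambda>\<omega>. L (s i \<omega>))" for i
      using simple_bochner_integrable_compose2[where p = "\<lambda>x y. L x", OF L.zero s(1) s(1)] .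
    show "(\<lambda>i. Bochner_Integration.simple_bochner_integral M (\<lambda>\<omega>. L (s i \<omega>))) \<longlonglongrightarrow> L I"
      using L.tendsto[OF s(3)] simple_bochner_integral_linear[OF L.linear_axioms s(1)] by simp
    show "(\<lambda>i. \<integral>\<^sup>+\<omega>. ennreal (norm (L (X \<omega>) - L (s i \<omega>))) \<partial>M) \<longlonglongrightarrow> 0"
    proof (rule tendsto_sandwich[OF _ _ tendsto_const])
      show "eventually (\<lambda>i. (\<integral>\<^sup>+\<omega>. ennreal (norm (L (X \<omega>) - L (s i \<omega>))) \<partial>M)
          \<le> ennreal (onorm L) * (\<integral>\<^sup>+\<omega>. ennreal (norm (X \<omega> - s i \<omega>)) \<partial>M)) sequentially"
      proof (intro always_eventually allI)
        fix i
        have "(\<integral>\<^sup>+\<omega>. ennreal (norm (L (X \<omega>) - L (s i \<omega>))) \<partial>M)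
            \<le> (\<integral>\<^sup>+\<omega>. ennreal (onorm L) * ennreal (norm (X \<omega> - s i \<omega>)) \<partial>M)"
          using bound onorm_pos_le[OF L] by (intro nn_integral_mono) (simp add: ennreal_mult[symmetric])
        also have "\<dots> = ennreal (onorm L) * (\<integral>\<^sup>+\<omega>. ennreal (norm (X \<omega> - s i \<omega>)) \<partial>M)"
          using meas by (intro nn_integral_cmult) auto
        finally show "(\<integral>\<^sup>+\<omega>. ennreal (norm (L (X \<omega>) - L (s i \<omega>))) \<partial>M)
          \<le> ennreal (onorm L) * (\<integral>\<^sup>+\<omega>. ennreal (norm (X \<omega> - s i \<omega>)) \<partial>M)" .
      qed
      show "(\<lambda>i. ennreal (onorm L) * (\<integral>\<^sup>+\<omega>. ennreal (norm (X \<omega> - s i \<omega>)) \<partial>M)) \<longlonglongrightarrow> 0"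
        using ennreal_tendsto_cmult[OF _ s(2), of "ennreal (onorm L)"] by simp
    qed auto
  qed
qed

lemma unbiased_errors_integral:
  fixes \<delta> :: "nat \<Rightarrow> 'w \<Rightarrow> 'a::real_normed_vector dual"
  assumes "unbiased_errors P F \<delta>" and A: "A \<in> sets (F k)"
  shows "integrable P (\<lambda>\<omega>. indicator A \<omega> * (\<delta> k \<omega>) v)"
    and "(\<integral>\<omega>. indicator A \<omega> * (\<delta> k \<omega>) v \<partial>P) = 0"
proof -
  obtain I where 1: "has_bochner_integral_gen P (\<lambda>\<omega>. indicator A \<omega> *\<^sub>R \<delta> k \<omega>) I"
    and 0: "has_bochner_integral_gen P (\<lambda>\<omega>. indicator A \<omega> *\<^sub>R (0 :: 'a dual)) I"
    using assms unfolding unbiased_errors_def has_cond_exp_def by blast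
  have L: "bounded_linear (\<lambda>u :: 'a dual. u v)" by (intro bounded_linear_intros)
  have "has_bochner_integral P (\<lambda>\<omega>. 0 :: real) (I v)"
    using has_bochner_integral_gen_functional[OF 0 L] by simp
  then have "I v = 0"
    using has_bochner_integral_eq has_bochner_integral_zero by blast
  then have *: "has_bochner_integral P (\<lambda>\<omega>. indicator A \<omega> * (\<delta> k \<omega>) v) 0"
    using has_bochner_integral_gen_functional[OF 1 L] by (simp add: blinfun.scaleR_left)
  then show "integrable P (\<lambda>\<omega>. indicator A \<omega> * (\<delta> k \<omega>) v)"
    "(\<integral>\<omega>. indicator A \<omega> * (\<delta> k \<omega>) v \<partial>P) = 0"
    using integrable.intros has_bochner_integral_integral_eq by blast+
qed

section \<open>Summability and unbiased errors\<close>

lemma telescoping_bound_tendsto_zero: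
  fixes V s e :: "nat \<Rightarrow> real"
  assumes step: "\<And>k. V (Suc k) + s k \<le> V k + e k" and V: "\<And>k. 0 \<le> V k" and s: "\<And>k. 0 \<le> s k"
    and e: "summable e" "\<And>k. 0 \<le> e k"
  shows "s \<longlonglongrightarrow> 0"
proof -
  have "V n + sum s {..<n} \<le> V 0 + sum e {..<n}" for n
  proof (induction n)
    case (Suc n) then show ?case using step[of n] by simp
  qed simp
  moreover have "sum e {..<n} \<le> suminf e" for n using e by (intro sum_le_suminf) auto
  ultimately have "sum s {..<n} \<le> V 0 + suminf e" for n
    using V[of n] by (meson add_left_mono le_add_same_cancel2 order_trans)
  then have "summable s" using s by (intro summableI_nonneg_bounded) auto
  then show ?thesis by (rule summable_LIMSEQ_zero)
qed

lemma AE_summable_if_integrals_bounded: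
  fixes r :: "nat \<Rightarrow> 'w \<Rightarrow> real"
  assumes r: "\<And>k. integrable M (r k)" "\<And>k. AE \<omega> in M. 0 \<le> r k \<omega>"
    and B: "\<And>n. (\<Sum>k<n. \<integral>\<omega>. r k \<omega> \<partial>M) \<le> B"
  shows "AE \<omega> in M. summable (\<lambda>k. r k \<omega>)"
proof -
  have nn: "(\<integral>\<^sup>+\<omega>. ennreal (r k \<omega>) \<partial>M) = ennreal (\<integral>\<omega>. r k \<omega> \<partial>M)" for k
    using r by (intro nn_integral_eq_integral) auto
  have i: "0 \<le> (\<integral>\<omega>. r k \<omega> \<partial>M)" for k using r(2) by (intro integral_nonneg_AE)
  have "(\<integral>\<^sup>+\<omega>. (\<Sum>k. ennreal (r k \<omega>)) \<partial>M) = (\<Sum>k. ennreal (\<integral>\<omega>. r k \<omega> \<partial>M))"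
    using r(1) by (subst nn_integral_suminf) (auto simp: nn)
  also have "summable (\<lambda>k. \<integral>\<omega>. r k \<omega> \<partial>M)" using i B by (intro summableI_nonneg_bounded)
  then have "(\<Sum>k. ennreal (\<integral>\<omega>. r k \<omega> \<partial>M)) \<noteq> \<infinity>" using i by (simp add: suminf_ennreal2)
  finally have "AE \<omega> in M. (\<Sum>k. ennreal (r k \<omega>)) \<noteq> \<infinity>"
    using r(1) by (intro nn_integral_PInf_AE) auto
  moreover have "AE \<omega> in M. \<forall>k. 0 \<le> r k \<omega>" using r(2) by (simp add: AE_all_countable)
  ultimately show ?thesis
  proof eventually_elim
    case (elim \<omega>)
    then show ?case by (intro summable_suminf_not_top) auto
  qed
qed

lemma AE_summable_moments:
  assumes "summable_moments M F q \<delta>"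
  shows "AE \<omega> in M. summable (\<lambda>k. norm (\<delta> k \<omega>) ^ q)"
proof (rule AE_summable_if_integrals_bounded)
  have s: "\<And>k. 0 \<le> (\<integral>\<omega>. norm (\<delta> k \<omega>) ^ q \<partial>M)" "summable (\<lambda>k. \<integral>\<omega>. norm (\<delta> k \<omega>) ^ q \<partial>M)"
    using assms unfolding summable_moments_def ell1_plus_def by auto
  show "integrable M (\<lambda>\<omega>. norm (\<delta> k \<omega>) ^ q)" for k using assms unfolding summable_moments_def by blast
  show "(\<Sum>k<n. \<integral>\<omega>. norm (\<delta> k \<omega>) ^ q \<partial>M) \<le> (\<Sum>k. \<integral>\<omega>. norm (\<delta> k \<omega>) ^ q \<partial>M)" for n
    using s by (intro sum_le_suminf) auto
qed simp

lemma natural_filtration_measurable: "w k \<in> measurable (natural_filtration M w k) borel"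
proof -
  define A where "A = (\<Union>i\<in>{..k}. {w i -` B \<inter> space M | B. B \<in> sets borel})"
  have A: "A \<subseteq> Pow (space M)" unfolding A_def by auto
  have F: "natural_filtration M w k = sigma (space M) A" unfolding natural_filtration_def A_def ..
  show ?thesis
  proof (rule measurableI)
    fix B assume "B \<in> sets (borel :: 'b measure)"
    then have "w k -` B \<inter> space M \<in> A" unfolding A_def by blast
    then show "w k -` B \<inter> space (natural_filtration M w k) \<in> sets (natural_filtration M w k)"
      unfolding F using A by (simp add: space_measure_of sets_measure_of sigma_sets.Basic)
  qed simp
qed

text \<open>
  A countably valued \<open>q\<close> is the point here: on each of its level sets the vector \<open>c (q \<omega>)\<close> is constant and the
  statement reduces to the definition of the conditional expectation.
\<close>

lemma unbiased_pairing_integral_zero: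
  fixes \<delta> :: "nat \<Rightarrow> 'w \<Rightarrow> 'a::real_normed_vector dual" and q :: "'w \<Rightarrow> nat"
  assumes un: "unbiased_errors P F \<delta>" and q: "q \<in> measurable (F k) (count_space UNIV)"
    and int: "integrable P (\<lambda>\<omega>. (\<delta> k \<omega>) (c (q \<omega>)))"
  shows "(\<integral>\<omega>. (\<delta> k \<omega>) (c (q \<omega>)) \<partial>P) = 0"
proof -
  have "subalgebra P (F k)" using un unfolding unbiased_errors_def has_cond_exp_def by blast
  then have sp: "space (F k) = space P" and st: "sets (F k) \<subseteq> sets P" unfolding subalgebra_def by auto
  define A where "A n = q -` {n} \<inter> space P" for n
  have A: "A n \<in> sets (F k)" for n using measurable_sets[OF q, of "{n}"] unfolding A_def sp by simp
  have union: "(\<Union>n. A n) = space P" unfolding A_def by auto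
  have "(\<integral>\<omega>. (\<delta> k \<omega>) (c (q \<omega>)) \<partial>P)
      = (LINT \<omega>:(\<Union>n. A n)|P. (\<delta> k \<omega>) (c (q \<omega>)))"
    unfolding union by (simp add: set_integral_space[OF int])
  also have "\<dots> = (\<Sum>n. LINT \<omega>:A n|P. (\<delta> k \<omega>) (c (q \<omega>)))"
  proof (rule lebesgue_integral_countable_add)
    show "A n \<in> sets P" for n using A st by blast
    show "A i \<inter> A j = {}" if "i \<noteq> j" for i j using that unfolding A_def by auto
    show "set_integrable P (\<Union>n. A n) (\<lambda>\<omega>. (\<delta> k \<omega>) (c (q \<omega>)))"
      unfolding union using integrable_mult_indicator[OF sets.top int] unfolding set_integrable_def .
  qed
  finally have *: "(\<integral>\<omega>. (\<delta> k \<omega>) (c (q \<omega>)) \<partial>P)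
      = (\<Sum>n. LINT \<omega>:A n|P. (\<delta> k \<omega>) (c (q \<omega>)))" .
  have "(LINT \<omega>:A n|P. (\<delta> k \<omega>) (c (q \<omega>))) = 0" for n
  proof -
    have "(LINT \<omega>:A n|P. (\<delta> k \<omega>) (c (q \<omega>)))
        = (\<integral>\<omega>. indicator (A n) \<omega> * (\<delta> k \<omega>) (c n) \<partial>P)"
      unfolding set_lebesgue_integral_def by (intro Bochner_Integration.integral_cong) (auto simp: A_def split: split_indicator)
    then show ?thesis using unbiased_errors_integral(2)[OF un A] by simp
  qed
  then show ?thesis unfolding * by simp
qed

lemma unbiased_pairing_square_integrable:
  fixes \<delta> :: "nat \<Rightarrow> 'w \<Rightarrow> 'a::real_normed_vector dual" and q :: "'w \<Rightarrow> nat"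
  assumes un: "unbiased_errors P F \<delta>" and \<delta>: "\<delta> k \<in> borel_measurable P"
    and q: "q \<in> measurable (F k) (count_space UNIV)"
    and int: "integrable P (\<lambda>\<omega>. (norm (\<delta> k \<omega>))\<^sup>2)" "integrable P B"
    and le: "AE \<omega> in P. (norm (c (q \<omega>)))\<^sup>2 \<le> B \<omega>"
  shows "integrable P (\<lambda>\<omega>. \<delta> k \<omega> (c (q \<omega>)))" "(\<integral>\<omega>. \<delta> k \<omega> (c (q \<omega>)) \<partial>P) = 0"
proof -
  have "subalgebra P (F k)" using un unfolding unbiased_errors_def has_cond_exp_def by blast
  then have qP: "q \<in> measurable P (count_space UNIV)"
    using q measurable_mono[of "count_space UNIV" "count_space UNIV" "F k" P] unfolding subalgebra_def by auto
  show *: "integrable P (\<lambda>\<omega>. \<delta> k \<omega> (c (q \<omega>)))"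
  proof (rule Bochner_Integration.integrable_bound[OF Bochner_Integration.integrable_add[OF int]])
    show "(\<lambda>\<omega>. \<delta> k \<omega> (c (q \<omega>))) \<in> borel_measurable P"
    proof (rule measurable_compose_countable[OF _ qP, of "\<lambda>n \<omega>. \<delta> k \<omega> (c n)"])
      show "(\<lambda>\<omega>. \<delta> k \<omega> (c n)) \<in> borel_measurable P" for n
        by (rule measurable_compose[OF \<delta>])
          (intro borel_measurable_continuous_onI blinfun.continuous_on continuous_on_id continuous_on_const)
    qed
    show "AE \<omega> in P. norm (\<delta> k \<omega> (c (q \<omega>))) \<le> norm ((norm (\<delta> k \<omega>))\<^sup>2 + B \<omega>)"
      using le
    proof eventually_elim
      case (elim \<omega>)
      have "norm (\<delta> k \<omega> (c (q \<omega>))) \<le> norm (\<delta> k \<omega>) * norm (c (q \<omega>))" by (rule norm_blinfun)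
      also have "\<dots> \<le> (norm (\<delta> k \<omega>))\<^sup>2 + (norm (c (q \<omega>)))\<^sup>2"
        using sum_squares_bound[of "norm (\<delta> k \<omega>)" "norm (c (q \<omega>))"]
          mult_nonneg_nonneg[OF norm_ge_zero norm_ge_zero, of "\<delta> k \<omega>" "c (q \<omega>)"] by linarith
      finally show ?case using elim by simp
    qed
  qed
  show "(\<integral>\<omega>. \<delta> k \<omega> (c (q \<omega>)) \<partial>P) = 0" by (rule unbiased_pairing_integral_zero[OF un q *])
qed

lemma quadratic_form_coercive:
  fixes \<alpha> \<beta> \<tau> :: real
  assumes \<alpha>: "0 < \<alpha>" and \<beta>: "0 < \<beta>" and \<tau>: "0 \<le> \<tau>" "\<tau>\<^sup>2 < \<alpha> * \<beta>"
  obtains c where "0 < c" "\<And>a b. c * (a\<^sup>2 + b\<^sup>2) \<le> \<alpha> / 2 * a\<^sup>2 + \<beta> / 2 * b\<^sup>2 - \<tau> * a * b"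
proof -
  define \<theta> where "\<theta> = \<tau> / sqrt (\<alpha> * \<beta>)"
  have sq: "0 < sqrt (\<alpha> * \<beta>)" using \<alpha> \<beta> by simp
  have "\<tau> < sqrt (\<alpha> * \<beta>)" using \<tau> by (simp add: real_less_rsqrt)
  then have \<theta>: "0 \<le> \<theta>" "\<theta> < 1" "\<tau> = \<theta> * sqrt (\<alpha> * \<beta>)" using \<tau> sq unfolding \<theta>_def by auto
  define c where "c = (1 - \<theta>) * min \<alpha> \<beta> / 2"
  have "0 < c" using \<alpha> \<beta> \<theta> unfolding c_def by simp
  moreover have "c * (a\<^sup>2 + b\<^sup>2) \<le> \<alpha> / 2 * a\<^sup>2 + \<beta> / 2 * b\<^sup>2 - \<tau> * a * b" for a b
  proof -
    have "0 \<le> (sqrt \<alpha> * a - sqrt \<beta> * b)\<^sup>2" by simp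
    also have "\<dots> = \<alpha> * a\<^sup>2 + \<beta> * b\<^sup>2 - 2 * (sqrt (\<alpha> * \<beta>) * a * b)"
      using \<alpha> \<beta> by (simp add: power2_diff power_mult_distrib real_sqrt_mult)
    finally have "sqrt (\<alpha> * \<beta>) * a * b \<le> (\<alpha> * a\<^sup>2 + \<beta> * b\<^sup>2) / 2" by simp
    then have "\<theta> * (sqrt (\<alpha> * \<beta>) * a * b) \<le> \<theta> * ((\<alpha> * a\<^sup>2 + \<beta> * b\<^sup>2) / 2)"
      using \<theta>(1) by (rule mult_left_mono)
    then have 1: "\<tau> * a * b \<le> \<theta> * ((\<alpha> * a\<^sup>2 + \<beta> * b\<^sup>2) / 2)" using \<theta>(3) by (simp add: mult.assoc)
    have "min \<alpha> \<beta> * (a\<^sup>2 + b\<^sup>2) \<le> \<alpha> * a\<^sup>2 + \<beta> * b\<^sup>2"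
      unfolding distrib_left by (intro add_mono mult_right_mono) auto
    then have "(1 - \<theta>) * (min \<alpha> \<beta> * (a\<^sup>2 + b\<^sup>2)) \<le> (1 - \<theta>) * (\<alpha> * a\<^sup>2 + \<beta> * b\<^sup>2)"
      using \<theta>(2) by (intro mult_left_mono) auto
    then have "c * (a\<^sup>2 + b\<^sup>2) \<le> (1 - \<theta>) * (\<alpha> * a\<^sup>2 + \<beta> * b\<^sup>2) / 2" unfolding c_def by simp
    then show ?thesis using 1 by (simp add: left_diff_distrib)
  qed
  ultimately show thesis using that by blast
qed

section \<open>Stochastic primal-dual iterations\<close>

context primal_dual_setting
begin

definition primal_step :: "real \<Rightarrow> 'x \<Rightarrow> 'y \<Rightarrow> 'x dual \<Rightarrow> 'x \<Rightarrow> bool" where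
  "primal_step t x \<mu> e x' \<longleftrightarrow>
     x' \<in> bregman_resolvent \<phi>p t g (grad \<phi>p x - t *\<^sub>R (grad f x + (e + adjoint_map T \<mu>)))"

definition dual_step :: "real \<Rightarrow> 'x \<Rightarrow> 'x \<Rightarrow> 'y \<Rightarrow> 'y dual \<Rightarrow> 'y \<Rightarrow> bool" where
  "dual_step t x x' \<mu> e \<mu>' \<longleftrightarrow>
     \<mu>' \<in> bregman_resolvent \<phi>d t ls (grad \<phi>d \<mu> - t *\<^sub>R (grad hs \<mu> + (e - T (2 *\<^sub>R x' - x))))"

text \<open>
  The properties that almost every path has, collected for deterministic arguments: the iterates stay in the
  regions of the coercivity assumption and in the closures of the countable sets \<open>D k\<close>, every step is a
  resolvent step, and an error-free step from the same point exists as well.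
\<close>

definition regular_path ::
    "(nat \<Rightarrow> real) \<Rightarrow> (nat \<Rightarrow> real) \<Rightarrow> (nat \<Rightarrow> ('x \<times> 'y) set) \<Rightarrow> (nat \<Rightarrow> 'x dual) \<Rightarrow> (nat \<Rightarrow> 'y dual) \<Rightarrow>
     (nat \<Rightarrow> 'x) \<Rightarrow> (nat \<Rightarrow> 'y) \<Rightarrow> bool" where
  "regular_path lam \<nu> D dp dd x \<mu> \<longleftrightarrow> (\<forall>k.
     x k \<in> int_region \<phi>p g \<and> \<mu> k \<in> int_region \<phi>d ls \<and> (x k, \<mu> k) \<in> closure (D k) \<and>
     primal_step (lam k) (x k) (\<mu> k) (dp k) (x (Suc k)) \<and>
     dual_step (\<nu> k) (x k) (x (Suc k)) (\<mu> k) (dd k) (\<mu> (Suc k)) \<and>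
     (\<exists>x' \<mu>'. primal_step (lam k) (x k) (\<mu> k) 0 x' \<and> dual_step (\<nu> k) (x k) x' (\<mu> k) 0 \<mu>'))"

lemma continuous_on_breg:
  fixes \<phi> :: "'a::banach \<Rightarrow> ereal"
  assumes \<phi>: "\<phi> \<in> Gamma0" and d: "gateaux_differentiable_on \<phi> (interior (edom \<phi>))"
  shows "continuous_on (interior (edom \<phi>)) (breg \<phi> a)"
  unfolding breg_def
  by (intro continuous_on_diff continuous_on_const Gamma0_continuous_interior[OF \<phi>]
      continuous_on_gradient_pairing[OF \<phi> open_interior d] continuous_on_id)

lemma continuous_on_energy:
  "continuous_on (interior (edom \<phi>p) \<times> interior (edom \<phi>d)) (\<lambda>w. energy a b (fst w) (snd w))"
proof -
  have p: "continuous_on (interior (edom \<phi>p) \<times> interior (edom \<phi>d)) (\<lambda>w. breg \<phi>p xs (fst w))"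
    by (rule continuous_on_compose2[OF continuous_on_breg[OF \<phi>p diff_p, of xs] continuous_on_fst[OF continuous_on_id]]) auto
  have d: "continuous_on (interior (edom \<phi>p) \<times> interior (edom \<phi>d)) (\<lambda>w. breg \<phi>d \<mu>s (snd w))"
    by (rule continuous_on_compose2[OF continuous_on_breg[OF \<phi>d diff_d, of \<mu>s] continuous_on_snd[OF continuous_on_id]]) auto
  show ?thesis unfolding energy_def
    by (intro continuous_on_add continuous_on_diff continuous_on_mult continuous_on_const p d
        blinfun.continuous_on continuous_on_fst continuous_on_snd continuous_on_id)
qed

end

text \<open>
  The random iteration, reduced to what holds on almost every path. The countable sets \<open>D k\<close> witness that
  the \<open>k\<close>-th iterate is almost surely separably valued.
\<close>

locale primal_dual_iteration = primal_dual_setting f g \<phi>p hs ls \<phi>d T Lp Ld lamI \<nu>I xs \<mu>s + prob_space P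
  for f g \<phi>p :: "'x::banach \<Rightarrow> ereal" and hs ls \<phi>d :: "'y::banach \<Rightarrow> ereal"
    and T :: "'x \<Rightarrow>\<^sub>L 'y dual" and Lp Ld lamI \<nu>I :: real and xs :: 'x and \<mu>s :: 'y and P :: "'w measure" +
  fixes lam \<nu> :: "nat \<Rightarrow> real" and \<delta>p :: "nat \<Rightarrow> 'w \<Rightarrow> 'x dual" and \<delta>d :: "nat \<Rightarrow> 'w \<Rightarrow> 'y dual"
    and x :: "nat \<Rightarrow> 'w \<Rightarrow> 'x" and \<mu> :: "nat \<Rightarrow> 'w \<Rightarrow> 'y" and D :: "nat \<Rightarrow> ('x \<times> 'y) set"
    and x0 :: 'x and \<mu>0 :: 'y
  assumes reflexive: "reflexive_space TYPE('x)" "reflexive_space TYPE('y)"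
    and lam: "\<And>k. 0 < lam k" "incseq lam" "\<And>k. lam k \<le> lamI"
    and \<nu>: "\<And>k. 0 < \<nu> k" "incseq \<nu>" "\<And>k. \<nu> k \<le> \<nu>I"
    and errors_measurable: "\<And>k. \<delta>p k \<in> borel_measurable P" "\<And>k. \<delta>d k \<in> borel_measurable P"
    and iterates_measurable: "\<And>k. (\<lambda>\<omega>. (x k \<omega>, \<mu> k \<omega>)) \<in> borel_measurable P"
    and D: "\<And>k. countable (D k)"
    and start: "\<And>\<omega>. \<omega> \<in> space P \<Longrightarrow> x 0 \<omega> = x0 \<and> \<mu> 0 \<omega> = \<mu>0"
    and regular: "AE \<omega> in P. regular_path lam \<nu> D (\<lambda>k. \<delta>p k \<omega>) (\<lambda>k. \<delta>d k \<omega>) (\<lambda>k. x k \<omega>) (\<lambda>k. \<mu> k \<omega>)"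
begin

abbreviation reg :: "'w \<Rightarrow> bool" where
  "reg \<omega> \<equiv> regular_path lam \<nu> D (\<lambda>k. \<delta>p k \<omega>) (\<lambda>k. \<delta>d k \<omega>) (\<lambda>k. x k \<omega>) (\<lambda>k. \<mu> k \<omega>)"

definition primal_excess :: "nat \<Rightarrow> 'w \<Rightarrow> real" where
  "primal_excess k \<omega> = step_excess f g \<phi>p (lam k) (\<delta>p k \<omega> + adjoint_map T (\<mu> k \<omega>)) xs (x k \<omega>) (x (Suc k) \<omega>)"

definition dual_excess :: "nat \<Rightarrow> 'w \<Rightarrow> real" where
  "dual_excess k \<omega> =
     step_excess hs ls \<phi>d (\<nu> k) (\<delta>d k \<omega> - T (2 *\<^sub>R x (Suc k) \<omega> - x k \<omega>)) \<mu>s (\<mu> k \<omega>) (\<mu> (Suc k) \<omega>)"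

definition excess :: "nat \<Rightarrow> 'w \<Rightarrow> real" where
  "excess k \<omega> = primal_excess k \<omega> + dual_excess k \<omega>"

definition V :: "nat \<Rightarrow> 'w \<Rightarrow> real" where
  "V k \<omega> = energy (lam k) (\<nu> k) (x k \<omega>) (\<mu> k \<omega>)"

abbreviation filtration :: "nat \<Rightarrow> 'w measure" where
  "filtration \<equiv> natural_filtration P (\<lambda>k \<omega>. (x k \<omega>, \<mu> k \<omega>))"

lemma regD:
  assumes "reg \<omega>"
  shows "x k \<omega> \<in> int_region \<phi>p g" "\<mu> k \<omega> \<in> int_region \<phi>d ls" "(x k \<omega>, \<mu> k \<omega>) \<in> closure (D k)"
    "primal_step (lam k) (x k \<omega>) (\<mu> k \<omega>) (\<delta>p k \<omega>) (x (Suc k) \<omega>)"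
    "dual_step (\<nu> k) (x k \<omega>) (x (Suc k) \<omega>) (\<mu> k \<omega>) (\<delta>d k \<omega>) (\<mu> (Suc k) \<omega>)"
    "\<exists>x' \<mu>'. primal_step (lam k) (x k \<omega>) (\<mu> k \<omega>) 0 x' \<and> dual_step (\<nu> k) (x k \<omega>) x' (\<mu> k \<omega>) 0 \<mu>'"
  using assms unfolding regular_path_def by blast+

lemma step_subgradient_in_subdiff:
  assumes "reg \<omega>"
  shows "step_subgradient \<phi>p (lam k) f (\<delta>p k \<omega> + adjoint_map T (\<mu> k \<omega>)) (x k \<omega>) (x (Suc k) \<omega>)
      \<in> subdiff g (x (Suc k) \<omega>)"
    "step_subgradient \<phi>d (\<nu> k) hs (\<delta>d k \<omega> - T (2 *\<^sub>R x (Suc k) \<omega> - x k \<omega>)) (\<mu> k \<omega>) (\<mu> (Suc k) \<omega>)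
      \<in> subdiff ls (\<mu> (Suc k) \<omega>)"
  using regD(4,5)[OF assms] lam(1) \<nu>(1) unfolding primal_step_def dual_step_def
  by (blast intro: resolvent_subgradient(1))+

lemma excess_parts_nonneg:
  assumes reg: "reg \<omega>" shows "0 \<le> primal_excess k \<omega>" "0 \<le> dual_excess k \<omega>"
proof -
  show "0 \<le> primal_excess k \<omega>"
    unfolding primal_excess_def using xs dom_p int_region_interior regD(1)[OF reg]
    by (intro step_excess_nonneg[OF extended_convex(1,2) step_subgradient_in_subdiff(1)[OF reg] diff_f]) auto
  show "0 \<le> dual_excess k \<omega>"
    unfolding dual_excess_def using \<mu>s dom_d int_region_interior regD(2)[OF reg]
    by (intro step_excess_nonneg[OF extended_convex(4,5) step_subgradient_in_subdiff(2)[OF reg] diff_hs]) auto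
qed

lemma excess_nonneg: "reg \<omega> \<Longrightarrow> 0 \<le> excess k \<omega>"
  unfolding excess_def by (intro add_nonneg_nonneg excess_parts_nonneg)

lemma V_nonneg: "reg \<omega> \<Longrightarrow> 0 \<le> V k \<omega>"
  unfolding V_def using energy_nonneg[OF lam(1,3) \<nu>(1,3) regD(1,2)] by blast

lemma V_descent:
  assumes "reg \<omega>"
  shows "V (Suc k) \<omega> + excess k \<omega>
    \<le> V k \<omega> + \<delta>p k \<omega> (xs - x (Suc k) \<omega>) + \<delta>d k \<omega> (\<mu>s - \<mu> (Suc k) \<omega>)"
proof -
  note U = regD(1,2)[OF assms]
  have "V (Suc k) \<omega> \<le> energy (lam k) (\<nu> k) (x (Suc k) \<omega>) (\<mu> (Suc k) \<omega>)"
    unfolding V_def using lam \<nu> U by (intro energy_antimono) (auto simp: incseq_Suc_iff)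
  then show ?thesis
    using energy_descent[OF lam(1)[of k] lam(3)[of k] \<nu>(1)[of k] \<nu>(3)[of k]
      U(1)[of k] U(1)[of "Suc k"] U(2)[of k] U(2)[of "Suc k"], of "\<delta>p k \<omega>" "\<delta>d k \<omega>"]
    unfolding V_def excess_def primal_excess_def dual_excess_def by linarith
qed

lemma dual_pairing_le: "(u :: 'a::real_normed_vector dual) v \<le> norm u * norm v"
  using norm_blinfun[of u v] by simp

lemma excess_tendsto_zero_of_summable_noise:
  assumes reg: "reg \<omega>" and e: "summable e"
    and le: "\<And>k. norm (\<delta>p k \<omega>) * norm (xs - x (Suc k) \<omega>) + norm (\<delta>d k \<omega>) * norm (\<mu>s - \<mu> (Suc k) \<omega>) \<le> e k"
  shows "(\<lambda>k. excess k \<omega>) \<longlonglongrightarrow> 0"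
proof (rule telescoping_bound_tendsto_zero[of "\<lambda>k. V k \<omega>" _ e])
  show "V (Suc k) \<omega> + excess k \<omega> \<le> V k \<omega> + e k" for k
    using V_descent[OF reg, of k] dual_pairing_le[of "\<delta>p k \<omega>" "xs - x (Suc k) \<omega>"]
      dual_pairing_le[of "\<delta>d k \<omega>" "\<mu>s - \<mu> (Suc k) \<omega>"] le[of k] by linarith
  have "0 \<le> norm (\<delta>p k \<omega>) * norm (xs - x (Suc k) \<omega>) + norm (\<delta>d k \<omega>) * norm (\<mu>s - \<mu> (Suc k) \<omega>)" for k
    by simp
  then show "0 \<le> e k" for k using le[of k] by (meson order_trans)
qed (use V_nonneg excess_nonneg reg e in auto)

lemma excess_tendsto_zero_exact:
  assumes "AE \<omega> in P. \<forall>k. \<delta>p k \<omega> = 0 \<and> \<delta>d k \<omega> = 0"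
  shows "AE \<omega> in P. (\<lambda>k. excess k \<omega>) \<longlonglongrightarrow> 0"
  using regular assms
proof eventually_elim
  case (elim \<omega>)
  show ?case by (rule excess_tendsto_zero_of_summable_noise[OF elim(1), of "\<lambda>_. 0"]) (use elim(2) in auto)
qed

text \<open>
  In bounded regions the pairing with an error is at most a constant times its norm, and summability of the
  expected norms implies almost sure summability of the norms.
\<close>

lemma excess_tendsto_zero_bounded:
  assumes sm: "summable_moments P F 1 \<delta>p" "summable_moments P F 1 \<delta>d"
    and bdd: "bounded (int_region \<phi>p g)" "bounded (int_region \<phi>d ls)"
  shows "AE \<omega> in P. (\<lambda>k. excess k \<omega>) \<longlonglongrightarrow> 0"
proof -
  obtain B where B: "\<And>z. z \<in> int_region \<phi>p g \<Longrightarrow> norm z \<le> B" using bdd(1) unfolding bounded_iff by blast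
  obtain C where C: "\<And>z. z \<in> int_region \<phi>d ls \<Longrightarrow> norm z \<le> C" using bdd(2) unfolding bounded_iff by blast
  show ?thesis using regular AE_summable_moments[OF sm(1)] AE_summable_moments[OF sm(2)]
  proof eventually_elim
    case (elim \<omega>)
    show ?case
    proof (rule excess_tendsto_zero_of_summable_noise[OF elim(1),
        of "\<lambda>k. norm (\<delta>p k \<omega>) * (norm xs + B) + norm (\<delta>d k \<omega>) * (norm \<mu>s + C)"])
      show "summable (\<lambda>k. norm (\<delta>p k \<omega>) * (norm xs + B) + norm (\<delta>d k \<omega>) * (norm \<mu>s + C))"
        using elim(2,3) by (intro summable_add summable_mult2) auto
      show "norm (\<delta>p k \<omega>) * norm (xs - x (Suc k) \<omega>) + norm (\<delta>d k \<omega>) * norm (\<mu>s - \<mu> (Suc k) \<omega>)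
          \<le> norm (\<delta>p k \<omega>) * (norm xs + B) + norm (\<delta>d k \<omega>) * (norm \<mu>s + C)" for k
      proof (intro add_mono mult_left_mono)
        show "norm (xs - x (Suc k) \<omega>) \<le> norm xs + B"
          using norm_triangle_ineq4[of xs "x (Suc k) \<omega>"] B[OF regD(1)[OF elim(1)], of "Suc k"] by linarith
        show "norm (\<mu>s - \<mu> (Suc k) \<omega>) \<le> norm \<mu>s + C"
          using norm_triangle_ineq4[of \<mu>s "\<mu> (Suc k) \<omega>"] C[OF regD(2)[OF elim(1)], of "Suc k"] by linarith
      qed auto
    qed
  qed
qed

end

context primal_dual_iteration
begin

text \<open>
  The proxies for the next iterates. All paths in a class of \<open>q\<close> have almost the same dual evaluation points
  \<open>G1\<close> and \<open>G2\<close> at time \<open>k\<close>, so the error-free step of one representative path is close to the actual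
  step of every path in the class: the distance is controlled by the quantisation error and by the errors
  \<open>\<delta>\<close> through the Lipschitz bound for the resolvents. The dual step depends on the new primal point, which
  is why \<open>Kd\<close> involves \<open>Kp\<close>.
\<close>

lemma quantised_error_free_step:
  assumes \<sigma>p: "0 < \<sigma>p" "\<And>z y. ereal (\<sigma>p / 2 * (norm (z - y))\<^sup>2) \<le> bregman \<phi>p z y"
    and \<sigma>d: "0 < \<sigma>d" "\<And>z y. ereal (\<sigma>d / 2 * (norm (z - y))\<^sup>2) \<le> bregman \<phi>d z y"
    and Kp: "Kp = (1 + lamI) / \<sigma>p" and Kd: "Kd = (1 + \<nu>I + 2 * \<nu>I * norm T * Kp) / \<sigma>d"
    and \<eta>: "0 < \<eta>"
  shows "\<exists>(q :: 'w \<Rightarrow> nat) zp zd. q \<in> measurable (filtration k) (count_space UNIV) \<and>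
    (\<forall>\<omega>. reg \<omega> \<longrightarrow> norm (x (Suc k) \<omega> - zp (q \<omega>)) \<le> Kp * (norm (\<delta>p k \<omega>) + norm (\<delta>d k \<omega>) + \<eta>) \<and>
      norm (\<mu> (Suc k) \<omega> - zd (q \<omega>)) \<le> Kd * (norm (\<delta>p k \<omega>) + norm (\<delta>d k \<omega>) + \<eta>))"
proof -
  define w where "w \<omega> = (x k \<omega>, \<mu> k \<omega>)" for \<omega>
  define G1 where "G1 v = grad \<phi>p (fst v) - lam k *\<^sub>R (grad f (fst v) + adjoint_map T (snd v))" for v :: "'x \<times> 'y"
  define G2 where "G2 v = grad \<phi>d (snd v) - \<nu> k *\<^sub>R (grad hs (snd v) + T (fst v))" for v :: "'x \<times> 'y"
  define U where "U = interior (edom \<phi>p) \<times> interior (edom \<phi>d)"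
  \<comment> \<open>\<open>G1\<close> and \<open>G2\<close> are the parts of the evaluation points that are determined by the current iterate.\<close>
  define S where "S = w ` {\<omega>. reg \<omega>}"
  have U: "open U" unfolding U_def by (intro open_Times open_interior)
  have SD: "S \<subseteq> closure (D k)" unfolding S_def w_def using regD(3) by blast
  have SU: "S \<subseteq> U" unfolding S_def w_def U_def using regD(1,2) int_region_interior by blast
  have cp: "continuous_on U (\<lambda>w. grad \<phi> (fst w) v)"
    if "\<phi> \<in> Gamma0" "gateaux_differentiable_on \<phi> (interior (edom \<phi>p))" for \<phi> v
    by (rule continuous_on_compose2[OF continuous_on_gradient_pairing[OF that(1) open_interior that(2) continuous_on_const, of v]
          continuous_on_fst[OF continuous_on_id]]) (auto simp: U_def)
  have cd: "continuous_on U (\<lambda>w. grad \<phi> (snd w) v)"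
    if "\<phi> \<in> Gamma0" "gateaux_differentiable_on \<phi> (interior (edom \<phi>d))" for \<phi> v
    by (rule continuous_on_compose2[OF continuous_on_gradient_pairing[OF that(1) open_interior that(2) continuous_on_const, of v]
          continuous_on_snd[OF continuous_on_id]]) (auto simp: U_def)
  have c1: "continuous_on U (\<lambda>w. G1 w v)" for v
    unfolding G1_def blinfun.diff_left blinfun.scaleR_left blinfun.add_left adjoint_map_apply
    by (intro continuous_on_diff continuous_on_scaleR continuous_on_add continuous_on_const
        cp[OF \<phi>p diff_p] cp[OF f diff_f] blinfun.continuous_on continuous_on_snd continuous_on_id)
  have c2: "continuous_on U (\<lambda>w. G2 w v)" for v
    unfolding G2_def blinfun.diff_left blinfun.scaleR_left blinfun.add_left
    by (intro continuous_on_diff continuous_on_scaleR continuous_on_add continuous_on_const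
        cd[OF \<phi>d diff_d] cd[OF hs diff_hs] blinfun.continuous_on continuous_on_fst continuous_on_id)
  obtain q1 :: "'x \<times> 'y \<Rightarrow> nat" where q1: "q1 \<in> measurable borel (count_space UNIV)"
    "\<And>w w'. w \<in> S \<Longrightarrow> w' \<in> S \<Longrightarrow> q1 w = q1 w' \<Longrightarrow> norm (G1 w - G1 w') \<le> \<eta>"
    using quantise_weakly_continuous_map[OF reflexive(1) D SD SU U c1 \<eta>] by blast
  obtain q2 :: "'x \<times> 'y \<Rightarrow> nat" where q2: "q2 \<in> measurable borel (count_space UNIV)"
    "\<And>w w'. w \<in> S \<Longrightarrow> w' \<in> S \<Longrightarrow> q2 w = q2 w' \<Longrightarrow> norm (G2 w - G2 w') \<le> \<eta>"
    using quantise_weakly_continuous_map[OF reflexive(2) D SD SU U c2 \<eta>] by blast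
  define q where "q \<omega> = prod_encode (q1 (w \<omega>), q2 (w \<omega>))" for \<omega>
  have "w \<in> measurable (filtration k) borel"
    unfolding w_def using natural_filtration_measurable[of "\<lambda>k \<omega>. (x k \<omega>, \<mu> k \<omega>)" k] .
  then have "(\<lambda>\<omega>. q1 (w \<omega>)) \<in> measurable (filtration k) (count_space UNIV)"
    "(\<lambda>\<omega>. q2 (w \<omega>)) \<in> measurable (filtration k) (count_space UNIV)"
    using q1(1) q2(1) measurable_compose by blast+
  then have qm: "q \<in> measurable (filtration k) (count_space UNIV)" unfolding q_def by measurable
  define r where "r n = (SOME \<omega>. reg \<omega> \<and> q \<omega> = n)" for n
  have r: "reg (r (q \<omega>))" "q (r (q \<omega>)) = q \<omega>" if "reg \<omega>" for \<omega>
    using someI[of "\<lambda>\<omega>'. reg \<omega>' \<and> q \<omega>' = q \<omega>" \<omega>] that unfolding r_def by auto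
  have "\<forall>\<omega>. \<exists>x' \<mu>'. reg \<omega> \<longrightarrow> primal_step (lam k) (x k \<omega>) (\<mu> k \<omega>) 0 x' \<and>
      dual_step (\<nu> k) (x k \<omega>) x' (\<mu> k \<omega>) 0 \<mu>'"
    using regD(6) by blast
  then obtain xh \<mu>h where h: "\<And>\<omega>. reg \<omega> \<Longrightarrow> primal_step (lam k) (x k \<omega>) (\<mu> k \<omega>) 0 (xh \<omega>)"
      "\<And>\<omega>. reg \<omega> \<Longrightarrow> dual_step (\<nu> k) (x k \<omega>) (xh \<omega>) (\<mu> k \<omega>) 0 (\<mu>h \<omega>)"
    by metis
  define zp where "zp n = xh (r n)" for n
  define zd where "zd n = \<mu>h (r n)" for n
  have "norm (x (Suc k) \<omega> - zp (q \<omega>)) \<le> Kp * (norm (\<delta>p k \<omega>) + norm (\<delta>d k \<omega>) + \<eta>) \<and>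
      norm (\<mu> (Suc k) \<omega> - zd (q \<omega>)) \<le> Kd * (norm (\<delta>p k \<omega>) + norm (\<delta>d k \<omega>) + \<eta>)"
    if \<omega>: "reg \<omega>" for \<omega>
  proof
    define R where "R = norm (\<delta>p k \<omega>) + norm (\<delta>d k \<omega>) + \<eta>"
    have R: "norm (\<delta>p k \<omega>) \<le> R" "norm (\<delta>d k \<omega>) \<le> R" "\<eta> \<le> R" using \<eta> unfolding R_def by auto
    define \<omega>' where "\<omega>' = r (q \<omega>)"
    have \<omega>': "reg \<omega>'" "q \<omega>' = q \<omega>" using r[OF \<omega>] unfolding \<omega>'_def by auto
    have wS: "w \<omega> \<in> S" "w \<omega>' \<in> S" using \<omega> \<omega>' unfolding S_def by auto
    have qq: "q1 (w \<omega>) = q1 (w \<omega>')" "q2 (w \<omega>) = q2 (w \<omega>')" using \<omega>'(2) unfolding q_def by (auto simp: prod_encode_eq)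
    have g1: "norm (G1 (w \<omega>) - G1 (w \<omega>')) \<le> \<eta>" using q1(2)[OF wS qq(1)] .
    have g2: "norm (G2 (w \<omega>) - G2 (w \<omega>')) \<le> \<eta>" using q2(2)[OF wS qq(2)] .
    have e1: "grad \<phi>p (x k \<omega>) - lam k *\<^sub>R (grad f (x k \<omega>) + (\<delta>p k \<omega> + adjoint_map T (\<mu> k \<omega>)))
        - (grad \<phi>p (x k \<omega>') - lam k *\<^sub>R (grad f (x k \<omega>') + (0 + adjoint_map T (\<mu> k \<omega>'))))
        = (G1 (w \<omega>) - G1 (w \<omega>')) - lam k *\<^sub>R \<delta>p k \<omega>"
      unfolding G1_def w_def by (simp add: algebra_simps)
    have "norm (x (Suc k) \<omega> - xh \<omega>') \<le> (1 / \<sigma>p) * norm ((G1 (w \<omega>) - G1 (w \<omega>')) - lam k *\<^sub>R \<delta>p k \<omega>)"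
      using resolvent_Lipschitz[OF extended_convex(3,2) diff_p \<sigma>p lam(1)
        regD(4)[OF \<omega>, unfolded primal_step_def] h(1)[OF \<omega>'(1), unfolded primal_step_def]] unfolding e1 .
    also have "\<dots> \<le> (1 / \<sigma>p) * ((1 + lamI) * R)"
    proof (rule mult_left_mono)
      have "norm (lam k *\<^sub>R \<delta>p k \<omega>) \<le> lamI * R"
        using lam(1)[of k] lam(3)[of k] R(1) by (simp add: mult_mono)
      then show "norm ((G1 (w \<omega>) - G1 (w \<omega>')) - lam k *\<^sub>R \<delta>p k \<omega>) \<le> (1 + lamI) * R"
        using g1 R(3) norm_triangle_ineq4[of "G1 (w \<omega>) - G1 (w \<omega>')" "lam k *\<^sub>R \<delta>p k \<omega>"]
        by (simp add: distrib_right)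
    qed (use \<sigma>p in simp)
    finally have xh: "norm (x (Suc k) \<omega> - xh \<omega>') \<le> Kp * R" unfolding Kp by simp
    then show "norm (x (Suc k) \<omega> - zp (q \<omega>)) \<le> Kp * (norm (\<delta>p k \<omega>) + norm (\<delta>d k \<omega>) + \<eta>)"
      unfolding zp_def \<omega>'_def R_def .
    have e2: "grad \<phi>d (\<mu> k \<omega>) - \<nu> k *\<^sub>R (grad hs (\<mu> k \<omega>) + (\<delta>d k \<omega> - T (2 *\<^sub>R x (Suc k) \<omega> - x k \<omega>)))
        - (grad \<phi>d (\<mu> k \<omega>') - \<nu> k *\<^sub>R (grad hs (\<mu> k \<omega>') + (0 - T (2 *\<^sub>R xh \<omega>' - x k \<omega>'))))
        = (G2 (w \<omega>) - G2 (w \<omega>')) - \<nu> k *\<^sub>R \<delta>d k \<omega> + (2 * \<nu> k) *\<^sub>R T (x (Suc k) \<omega> - xh \<omega>')"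
      unfolding G2_def w_def by (simp add: blinfun.diff_right blinfun.scaleR_right algebra_simps)
    have "norm (\<mu> (Suc k) \<omega> - \<mu>h \<omega>') \<le> (1 / \<sigma>d) *
        norm ((G2 (w \<omega>) - G2 (w \<omega>')) - \<nu> k *\<^sub>R \<delta>d k \<omega> + (2 * \<nu> k) *\<^sub>R T (x (Suc k) \<omega> - xh \<omega>'))"
      using resolvent_Lipschitz[OF extended_convex(6,5) diff_d \<sigma>d \<nu>(1)
        regD(5)[OF \<omega>, unfolded dual_step_def] h(2)[OF \<omega>'(1), unfolded dual_step_def]] unfolding e2 .
    also have "\<dots> \<le> (1 / \<sigma>d) * ((1 + \<nu>I + 2 * \<nu>I * norm T * Kp) * R)"
    proof (rule mult_left_mono)
      have 1: "norm (\<nu> k *\<^sub>R \<delta>d k \<omega>) \<le> \<nu>I * R"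
        using \<nu>(1)[of k] \<nu>(3)[of k] R(2) by (simp add: mult_mono)
      have "norm (T (x (Suc k) \<omega> - xh \<omega>')) \<le> norm T * (Kp * R)"
        using norm_blinfun[of T "x (Suc k) \<omega> - xh \<omega>'"] xh by (meson mult_left_mono norm_ge_zero order_trans)
      then have "norm ((2 * \<nu> k) *\<^sub>R T (x (Suc k) \<omega> - xh \<omega>')) \<le> (2 * \<nu>I) * (norm T * (Kp * R))"
        unfolding norm_scaleR using \<nu>(1)[of k] \<nu>(3)[of k] by (intro mult_mono) auto
      then show "norm ((G2 (w \<omega>) - G2 (w \<omega>')) - \<nu> k *\<^sub>R \<delta>d k \<omega> + (2 * \<nu> k) *\<^sub>R T (x (Suc k) \<omega> - xh \<omega>'))
          \<le> (1 + \<nu>I + 2 * \<nu>I * norm T * Kp) * R"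
        using g2 1 R(3) norm_triangle_ineq4[of "G2 (w \<omega>) - G2 (w \<omega>')" "\<nu> k *\<^sub>R \<delta>d k \<omega>"]
          norm_triangle_ineq[of "(G2 (w \<omega>) - G2 (w \<omega>')) - \<nu> k *\<^sub>R \<delta>d k \<omega>" "(2 * \<nu> k) *\<^sub>R T (x (Suc k) \<omega> - xh \<omega>')"]
        by (simp add: distrib_right mult.assoc)
    qed (use \<sigma>d in simp)
    finally show "norm (\<mu> (Suc k) \<omega> - zd (q \<omega>)) \<le> Kd * (norm (\<delta>p k \<omega>) + norm (\<delta>d k \<omega>) + \<eta>)"
      unfolding zd_def \<omega>'_def Kd R_def by simp
  qed
  then show ?thesis using qm by blast
qed

text \<open>
  A Borel function of the iterate that agrees with \<open>V\<close> almost surely; gradients outside the interior of the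
  domains are arbitrary and could spoil measurability.
\<close>

definition V_borel :: "nat \<Rightarrow> 'w \<Rightarrow> real" where
  "V_borel k \<omega> = indicator (interior (edom \<phi>p) \<times> interior (edom \<phi>d)) (x k \<omega>, \<mu> k \<omega>) * V k \<omega>"

lemma V_borel_measurable: "V_borel k \<in> borel_measurable P"
proof -
  have "(\<lambda>w. indicator (interior (edom \<phi>p) \<times> interior (edom \<phi>d)) w *\<^sub>R energy (lam k) (\<nu> k) (fst w) (snd w))
      \<in> borel_measurable borel"
    by (intro borel_measurable_continuous_on_indicator continuous_on_energy borel_open open_Times open_interior)
  from measurable_compose[OF iterates_measurable this]
  show ?thesis unfolding V_borel_def[abs_def] V_def by simp
qed

lemma V_borel_eq: "reg \<omega> \<Longrightarrow> V_borel k \<omega> = V k \<omega>"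
  using regD(1,2) int_region_interior unfolding V_borel_def by simp

text \<open>
  Strong convexity of the entropies makes the divergences dominate the bilinear term with room to spare, precisely when
  the product of the step sizes is small.
\<close>

lemma V_coercive:
  assumes \<sigma>p: "0 < \<sigma>p" "\<And>z y. ereal (\<sigma>p / 2 * (norm (z - y))\<^sup>2) \<le> bregman \<phi>p z y"
    and \<sigma>d: "0 < \<sigma>d" "\<And>z y. ereal (\<sigma>d / 2 * (norm (z - y))\<^sup>2) \<le> bregman \<phi>d z y"
    and small: "\<nu>I * lamI * (norm T)\<^sup>2 < \<sigma>p * \<sigma>d"
  obtains c where "0 < c" "\<And>k \<omega>. reg \<omega> \<Longrightarrow> c * ((norm (xs - x k \<omega>))\<^sup>2 + (norm (\<mu>s - \<mu> k \<omega>))\<^sup>2) \<le> V k \<omega>"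
proof -
  have "(norm T)\<^sup>2 < (\<sigma>p / lamI) * (\<sigma>d / \<nu>I)" using small steps_pos by (simp add: field_simps)
  then obtain c where c: "0 < c"
    "\<And>a b. c * (a\<^sup>2 + b\<^sup>2) \<le> (\<sigma>p / lamI) / 2 * a\<^sup>2 + (\<sigma>d / \<nu>I) / 2 * b\<^sup>2 - norm T * a * b"
    using quadratic_form_coercive[of "\<sigma>p / lamI" "\<sigma>d / \<nu>I" "norm T"] \<sigma>p(1) \<sigma>d(1) steps_pos by auto
  have "c * ((norm (xs - x k \<omega>))\<^sup>2 + (norm (\<mu>s - \<mu> k \<omega>))\<^sup>2) \<le> V k \<omega>" if \<omega>: "reg \<omega>" for k \<omega>
  proof -
    have p: "\<sigma>p / 2 * (norm (xs - x k \<omega>))\<^sup>2 \<le> breg \<phi>p xs (x k \<omega>)"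
      using \<sigma>p(2)[of xs "x k \<omega>"] bregman_eq_breg[OF extended_convex(3) xs(1)] int_region_interior(1)[OF regD(1)[OF \<omega>]] by simp
    have d: "\<sigma>d / 2 * (norm (\<mu>s - \<mu> k \<omega>))\<^sup>2 \<le> breg \<phi>d \<mu>s (\<mu> k \<omega>)"
      using \<sigma>d(2)[of \<mu>s "\<mu> k \<omega>"] bregman_eq_breg[OF extended_convex(6) \<mu>s(1)] int_region_interior(2)[OF regD(2)[OF \<omega>]] by simp
    have p': "(\<sigma>p / lamI) / 2 * (norm (xs - x k \<omega>))\<^sup>2 \<le> (1 / lamI) * breg \<phi>p xs (x k \<omega>)"
      using mult_left_mono[OF p, of "1 / lamI"] steps_pos by (simp add: field_simps)
    have d': "(\<sigma>d / \<nu>I) / 2 * (norm (\<mu>s - \<mu> k \<omega>))\<^sup>2 \<le> (1 / \<nu>I) * breg \<phi>d \<mu>s (\<mu> k \<omega>)"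
      using mult_left_mono[OF d, of "1 / \<nu>I"] steps_pos by (simp add: field_simps)
    have "T (xs - x k \<omega>) (\<mu>s - \<mu> k \<omega>) \<le> norm (T (xs - x k \<omega>)) * norm (\<mu>s - \<mu> k \<omega>)"
      by (rule dual_pairing_le)
    also have "\<dots> \<le> norm T * norm (xs - x k \<omega>) * norm (\<mu>s - \<mu> k \<omega>)"
      using norm_blinfun[of T "xs - x k \<omega>"] by (intro mult_right_mono) auto
    finally have "c * ((norm (xs - x k \<omega>))\<^sup>2 + (norm (\<mu>s - \<mu> k \<omega>))\<^sup>2) \<le> energy lamI \<nu>I (x k \<omega>) (\<mu> k \<omega>)"
      using c(2)[of "norm (xs - x k \<omega>)" "norm (\<mu>s - \<mu> k \<omega>)"] p' d' unfolding energy_def by linarith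
    also have "\<dots> \<le> V k \<omega>"
      unfolding V_def using energy_antimono[OF lam(1,3) \<nu>(1,3) regD(1,2)] \<omega> by blast
    finally show ?thesis .
  qed
  then show thesis using that c(1) by blast
qed

text \<open>
  With \<open>N\<close> the pairings of the errors with the proxies, \<open>E\<^sub>k \<le> r\<^sub>k = V\<^sub>k - V\<^sub>k\<^sub>+\<^sub>1 + N\<^sub>k + O(e\<^sub>k)\<close>, where
  \<open>e\<^sub>k\<close> is a sum of squared errors and the squared quantisation error. Since \<open>N\<^sub>k\<close> has mean
  zero, the partial sums of the expectations of \<open>r\<^sub>k \<ge> 0\<close> stay bounded. Integrability has to come first: the crude bound
  \<open>V\<^sub>k\<^sub>+\<^sub>1 \<le> 2V\<^sub>k + e\<^sub>k / c\<close> propagates it along the iteration, and coercivity of \<open>V\<close> then yields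
  square integrability of the proxies.
\<close>

lemma excess_tendsto_zero_strongly_convex:
  assumes \<sigma>p: "0 < \<sigma>p" "\<And>z y. ereal (\<sigma>p / 2 * (norm (z - y))\<^sup>2) \<le> bregman \<phi>p z y"
    and \<sigma>d: "0 < \<sigma>d" "\<And>z y. ereal (\<sigma>d / 2 * (norm (z - y))\<^sup>2) \<le> bregman \<phi>d z y"
    and small: "\<nu>I * lamI * (norm T)\<^sup>2 < \<sigma>p * \<sigma>d"
    and sm: "summable_moments P F 2 \<delta>p" "summable_moments P F 2 \<delta>d"
    and un: "unbiased_errors P filtration \<delta>p" "unbiased_errors P filtration \<delta>d"
  shows "AE \<omega> in P. (\<lambda>k. excess k \<omega>) \<longlonglongrightarrow> 0"
proof -
  obtain c where c: "0 < c"
    "\<And>k \<omega>. reg \<omega> \<Longrightarrow> c * ((norm (xs - x k \<omega>))\<^sup>2 + (norm (\<mu>s - \<mu> k \<omega>))\<^sup>2) \<le> V k \<omega>"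
    using V_coercive[OF \<sigma>p \<sigma>d small] by blast
  define e where "e k \<omega> = (norm (\<delta>p k \<omega>))\<^sup>2 + (norm (\<delta>d k \<omega>))\<^sup>2 + (1 / 4) ^ k" for k \<omega>
  define R where "R k \<omega> = norm (\<delta>p k \<omega>) + norm (\<delta>d k \<omega>) + (1 / 2) ^ k" for k \<omega>
  have R0: "norm (\<delta>p k \<omega>) \<le> R k \<omega>" "norm (\<delta>d k \<omega>) \<le> R k \<omega>" "(1 / 2) ^ k \<le> R k \<omega>" "0 \<le> R k \<omega>" for k \<omega>
    unfolding R_def by auto
  have Re: "(R k \<omega>)\<^sup>2 \<le> 3 * e k \<omega>" for k \<omega>
  proof -
    have *: "(a + b + d)\<^sup>2 \<le> 3 * (a\<^sup>2 + b\<^sup>2 + d\<^sup>2)" for a b d :: real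
      using sum_squares_ge_zero[of "a - b" "b - d"] zero_le_square[of "a - d"]
      by (simp add: power2_eq_square algebra_simps)
    have "((1 / 2 :: real) ^ k)\<^sup>2 = (1 / 4) ^ k" by (simp add: power2_eq_square power_mult_distrib[symmetric])
    then show ?thesis using *[of "norm (\<delta>p k \<omega>)" "norm (\<delta>d k \<omega>)" "(1 / 2) ^ k"] unfolding R_def e_def by simp
  qed
  have e0: "0 \<le> e k \<omega>" for k \<omega> unfolding e_def by simp
  define Kp where "Kp = (1 + lamI) / \<sigma>p"
  define Kd where "Kd = (1 + \<nu>I + 2 * \<nu>I * norm T * Kp) / \<sigma>d"
  have K0: "0 \<le> Kp" "0 \<le> Kd" using \<sigma>p(1) \<sigma>d(1) steps_pos unfolding Kp_def Kd_def by simp_all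
  define Q where "Q k q zp zd \<longleftrightarrow> q \<in> measurable (filtration k) (count_space UNIV) \<and>
    (\<forall>\<omega>. reg \<omega> \<longrightarrow> norm (x (Suc k) \<omega> - zp (q \<omega>)) \<le> Kp * R k \<omega> \<and> norm (\<mu> (Suc k) \<omega> - zd (q \<omega>)) \<le> Kd * R k \<omega>)"
    for k and q :: "'w \<Rightarrow> nat" and zp zd
  have "\<exists>q zp zd. Q k q zp zd" for k
    using quantised_error_free_step[OF \<sigma>p \<sigma>d Kp_def Kd_def, of "(1 / 2) ^ k" k] unfolding Q_def R_def by simp
  then obtain q zp zd where Q: "\<And>k. Q k (q k) (zp k) (zd k)" by metis
  have q: "q k \<in> measurable (filtration k) (count_space UNIV)" for k using Q unfolding Q_def by blast
  have z: "norm (x (Suc k) \<omega> - zp k (q k \<omega>)) \<le> Kp * R k \<omega>" "norm (\<mu> (Suc k) \<omega> - zd k (q k \<omega>)) \<le> Kd * R k \<omega>"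
    if "reg \<omega>" for k \<omega> using Q[of k] that unfolding Q_def by blast+
  define Np where "Np k \<omega> = \<delta>p k \<omega> (xs - zp k (q k \<omega>))" for k \<omega>
  define Nd where "Nd k \<omega> = \<delta>d k \<omega> (\<mu>s - zd k (q k \<omega>))" for k \<omega>
  define K where "K = 3 * (Kp + Kd)"
  have descent: "V (Suc k) \<omega> + excess k \<omega> \<le> V k \<omega> + Np k \<omega> + Nd k \<omega> + K * e k \<omega>" if \<omega>: "reg \<omega>" for k \<omega>
  proof -
    have *: "u (a - y) \<le> u (a - z) + L * (R k \<omega>)\<^sup>2" if "norm u \<le> R k \<omega>" "norm (y - z) \<le> L * R k \<omega>"
      for u :: "'a::real_normed_vector dual" and a y z L
    proof -
      have "u (a - y) = u (a - z) + u (z - y)" by (simp add: blinfun.diff_right)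
      also have "u (z - y) \<le> norm u * norm (y - z)" using dual_pairing_le by (metis norm_minus_commute)
      also have "\<dots> \<le> R k \<omega> * (L * R k \<omega>)" using that R0 by (intro mult_mono) auto
      finally show ?thesis by (simp add: power2_eq_square mult_ac)
    qed
    have "(Kp + Kd) * (R k \<omega>)\<^sup>2 \<le> (Kp + Kd) * (3 * e k \<omega>)" using Re K0 by (intro mult_left_mono) auto
    then have "Kp * (R k \<omega>)\<^sup>2 + Kd * (R k \<omega>)\<^sup>2 \<le> K * e k \<omega>" unfolding K_def by (simp add: algebra_simps)
    then show ?thesis
      using V_descent[OF \<omega>, of k] *[OF R0(1) z(1)[OF \<omega>], of xs] *[OF R0(2) z(2)[OF \<omega>], of \<mu>s]
      unfolding Np_def Nd_def by linarith
  qed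
  have growth: "V (Suc k) \<omega> \<le> 2 * V k \<omega> + (1 / c) * e k \<omega>" if \<omega>: "reg \<omega>" for k \<omega>
  proof -
    \<comment> \<open>The weight \<open>c\<close> lets half of \<open>V (Suc k)\<close> absorb the quadratic terms, by coercivity.\<close>
    have young: "a * b \<le> a\<^sup>2 / (2 * c) + c * b\<^sup>2 / 2" for a b :: real
    proof -
      have "0 \<le> (a - c * b)\<^sup>2 / (2 * c)" using c(1) by simp
      also have "\<dots> = a\<^sup>2 / (2 * c) + c * b\<^sup>2 / 2 - a * b"
        using c(1) by (simp add: power2_eq_square field_simps)
      finally show ?thesis by simp
    qed
    have "\<delta>p k \<omega> (xs - x (Suc k) \<omega>) \<le> (norm (\<delta>p k \<omega>))\<^sup>2 / (2 * c) + c * (norm (xs - x (Suc k) \<omega>))\<^sup>2 / 2"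
      using dual_pairing_le young order_trans by blast
    moreover have "\<delta>d k \<omega> (\<mu>s - \<mu> (Suc k) \<omega>) \<le> (norm (\<delta>d k \<omega>))\<^sup>2 / (2 * c) + c * (norm (\<mu>s - \<mu> (Suc k) \<omega>))\<^sup>2 / 2"
      using dual_pairing_le young order_trans by blast
    moreover have "((norm (\<delta>p k \<omega>))\<^sup>2 + (norm (\<delta>d k \<omega>))\<^sup>2) / (2 * c) \<le> e k \<omega> / (2 * c)"
      using c(1) unfolding e_def by (intro divide_right_mono) auto
    ultimately have "V (Suc k) \<omega> \<le> V k \<omega> + e k \<omega> / (2 * c) + V (Suc k) \<omega> / 2"
      using V_descent[OF \<omega>, of k] excess_nonneg[OF \<omega>, of k] c(2)[OF \<omega>, of "Suc k"]
      by (simp add: add_divide_distrib distrib_left)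
    then show ?thesis by (simp add: field_simps)
  qed
  have Kp2: "(norm (xs - zp k (q k \<omega>)))\<^sup>2 \<le> (2 / c) * V (Suc k) \<omega> + 6 * Kp\<^sup>2 * e k \<omega>"
    and Kd2: "(norm (\<mu>s - zd k (q k \<omega>)))\<^sup>2 \<le> (2 / c) * V (Suc k) \<omega> + 6 * Kd\<^sup>2 * e k \<omega>" if \<omega>: "reg \<omega>" for k \<omega>
  proof -
    have *: "m\<^sup>2 \<le> (2 / c) * V (Suc k) \<omega> + 6 * L\<^sup>2 * e k \<omega>"
      if m: "0 \<le> m" "m \<le> a + L * R k \<omega>" and a: "0 \<le> a" "c * a\<^sup>2 \<le> V (Suc k) \<omega>" for m a L
    proof -
      have "m\<^sup>2 \<le> (a + L * R k \<omega>)\<^sup>2" using m by (intro power_mono) auto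
      also have "\<dots> \<le> 2 * a\<^sup>2 + 2 * (L * R k \<omega>)\<^sup>2"
        using sum_squares_bound[of a "L * R k \<omega>"] by (simp add: power2_sum)
      also have "(L * R k \<omega>)\<^sup>2 \<le> L\<^sup>2 * (3 * e k \<omega>)" unfolding power_mult_distrib using Re by (intro mult_left_mono) auto
      finally have "m\<^sup>2 \<le> 2 * a\<^sup>2 + 6 * L\<^sup>2 * e k \<omega>" by simp
      moreover have "a\<^sup>2 \<le> V (Suc k) \<omega> / c" using a c(1) by (simp add: le_divide_eq mult.commute)
      ultimately show ?thesis by simp
    qed
    have "c * (norm (xs - x (Suc k) \<omega>))\<^sup>2 \<le> c * ((norm (xs - x (Suc k) \<omega>))\<^sup>2 + (norm (\<mu>s - \<mu> (Suc k) \<omega>))\<^sup>2)"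
      "c * (norm (\<mu>s - \<mu> (Suc k) \<omega>))\<^sup>2 \<le> c * ((norm (xs - x (Suc k) \<omega>))\<^sup>2 + (norm (\<mu>s - \<mu> (Suc k) \<omega>))\<^sup>2)"
      using c(1) by (intro mult_left_mono; simp)+
    then have cc: "c * (norm (xs - x (Suc k) \<omega>))\<^sup>2 \<le> V (Suc k) \<omega>" "c * (norm (\<mu>s - \<mu> (Suc k) \<omega>))\<^sup>2 \<le> V (Suc k) \<omega>"
      using c(2)[OF \<omega>, of "Suc k"] by linarith+
    show "(norm (xs - zp k (q k \<omega>)))\<^sup>2 \<le> (2 / c) * V (Suc k) \<omega> + 6 * Kp\<^sup>2 * e k \<omega>"
      using z(1)[OF \<omega>, of k] norm_triangle_ineq[of "xs - x (Suc k) \<omega>" "x (Suc k) \<omega> - zp k (q k \<omega>)"] cc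
      by (intro *[of _ "norm (xs - x (Suc k) \<omega>)"]) auto
    show "(norm (\<mu>s - zd k (q k \<omega>)))\<^sup>2 \<le> (2 / c) * V (Suc k) \<omega> + 6 * Kd\<^sup>2 * e k \<omega>"
      using z(2)[OF \<omega>, of k] norm_triangle_ineq[of "\<mu>s - \<mu> (Suc k) \<omega>" "\<mu> (Suc k) \<omega> - zd k (q k \<omega>)"] cc
      by (intro *[of _ "norm (\<mu>s - \<mu> (Suc k) \<omega>)"]) auto
  qed
  have ip: "integrable P (\<lambda>\<omega>. (norm (\<delta>p k \<omega>))\<^sup>2)" and id: "integrable P (\<lambda>\<omega>. (norm (\<delta>d k \<omega>))\<^sup>2)" for k
    using sm unfolding summable_moments_def by blast+
  have e_int: "integrable P (e k)" for k
    unfolding e_def[abs_def] by (intro Bochner_Integration.integrable_add ip id integrable_const)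
  have e_integral: "(\<integral>\<omega>. e k \<omega> \<partial>P) = (\<integral>\<omega>. (norm (\<delta>p k \<omega>))\<^sup>2 \<partial>P) + (\<integral>\<omega>. (norm (\<delta>d k \<omega>))\<^sup>2 \<partial>P) + (1 / 4) ^ k" for k
    unfolding e_def using ip id by (simp add: prob_space)
  have e_sum: "summable (\<lambda>k. \<integral>\<omega>. e k \<omega> \<partial>P)"
    unfolding e_integral using sm unfolding summable_moments_def ell1_plus_def
    by (intro summable_add summable_geometric) auto
  have V_int: "integrable P (V_borel k)" for k
  proof (induction k)
    case 0
    have "integrable P (\<lambda>_. \<bar>energy (lam 0) (\<nu> 0) x0 \<mu>0\<bar>)" by (rule integrable_const)
    then show ?case
    proof (rule Bochner_Integration.integrable_bound[OF _ V_borel_measurable])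
      show "AE \<omega> in P. norm (V_borel 0 \<omega>) \<le> norm \<bar>energy (lam 0) (\<nu> 0) x0 \<mu>0\<bar>"
        using regular AE_space
      proof eventually_elim
        case (elim \<omega>)
        then show ?case using V_borel_eq[OF elim(1), of 0] start[OF elim(2)] unfolding V_def by simp
      qed
    qed
  next
    case (Suc k)
    have "integrable P (\<lambda>\<omega>. 2 * V_borel k \<omega> + (1 / c) * e k \<omega>)"
      by (intro Bochner_Integration.integrable_add integrable_mult_right Suc e_int)
    then show ?case
    proof (rule Bochner_Integration.integrable_bound[OF _ V_borel_measurable])
      show "AE \<omega> in P. norm (V_borel (Suc k) \<omega>) \<le> norm (2 * V_borel k \<omega> + (1 / c) * e k \<omega>)"
        using regular
      proof eventually_elim
        case (elim \<omega>)
        show ?case using growth[OF elim, of k] V_nonneg[OF elim, of "Suc k"] V_borel_eq[OF elim] by simp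
      qed
    qed
  qed
  have B_int: "integrable P (\<lambda>\<omega>. (2 / c) * V_borel (Suc k) \<omega> + 6 * L\<^sup>2 * e k \<omega>)" for k L
    by (intro Bochner_Integration.integrable_add integrable_mult_right V_int e_int)
  have "AE \<omega> in P. (norm (xs - zp k (q k \<omega>)))\<^sup>2 \<le> (2 / c) * V_borel (Suc k) \<omega> + 6 * Kp\<^sup>2 * e k \<omega>" for k
    using regular by eventually_elim (simp only: V_borel_eq Kp2)
  note p = unbiased_pairing_square_integrable[OF un(1) errors_measurable(1) q ip B_int this]
  have "AE \<omega> in P. (norm (\<mu>s - zd k (q k \<omega>)))\<^sup>2 \<le> (2 / c) * V_borel (Suc k) \<omega> + 6 * Kd\<^sup>2 * e k \<omega>" for k
    using regular by eventually_elim (simp only: V_borel_eq Kd2)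
  note d = unbiased_pairing_square_integrable[OF un(2) errors_measurable(2) q id B_int this]
  have N_int: "integrable P (Np k)" "integrable P (Nd k)" for k
    unfolding Np_def[abs_def] Nd_def[abs_def] by (rule p(1) d(1))+
  have N_zero: "(\<integral>\<omega>. Np k \<omega> \<partial>P) = 0" "(\<integral>\<omega>. Nd k \<omega> \<partial>P) = 0" for k
    unfolding Np_def Nd_def by (rule p(2) d(2))+
  define r where "r k \<omega> = V_borel k \<omega> - V_borel (Suc k) \<omega> + Np k \<omega> + Nd k \<omega> + K * e k \<omega>" for k \<omega>
  have r_int: "integrable P (r k)" for k
    unfolding r_def[abs_def]
    by (intro Bochner_Integration.integrable_add Bochner_Integration.integrable_diff integrable_mult_right V_int N_int e_int)
  have excess_r: "excess k \<omega> \<le> r k \<omega>" if "reg \<omega>" for k \<omega>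
    using descent[OF that, of k] V_borel_eq[OF that] unfolding r_def by simp
  have r_integral: "(\<integral>\<omega>. r k \<omega> \<partial>P) = (\<integral>\<omega>. V_borel k \<omega> \<partial>P) - (\<integral>\<omega>. V_borel (Suc k) \<omega> \<partial>P) + K * (\<integral>\<omega>. e k \<omega> \<partial>P)" for k
    unfolding r_def using V_int N_int e_int N_zero by simp
  have "AE \<omega> in P. summable (\<lambda>k. r k \<omega>)"
  proof (rule AE_summable_if_integrals_bounded[OF r_int])
    show "AE \<omega> in P. 0 \<le> r k \<omega>" for k
      using regular by eventually_elim (use excess_r excess_nonneg order_trans in blast)
    have tele: "(\<Sum>k<n. \<integral>\<omega>. r k \<omega> \<partial>P) = (\<integral>\<omega>. V_borel 0 \<omega> \<partial>P) - (\<integral>\<omega>. V_borel n \<omega> \<partial>P) + K * (\<Sum>k<n. \<integral>\<omega>. e k \<omega> \<partial>P)" for n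
      by (induction n) (simp_all add: r_integral distrib_left)
    have "0 \<le> (\<integral>\<omega>. V_borel n \<omega> \<partial>P)" for n
    proof (rule integral_nonneg_AE)
      show "AE \<omega> in P. 0 \<le> V_borel n \<omega>" using regular by eventually_elim (simp add: V_borel_eq V_nonneg)
    qed
    moreover have "(\<Sum>k<n. \<integral>\<omega>. e k \<omega> \<partial>P) \<le> (\<Sum>k. \<integral>\<omega>. e k \<omega> \<partial>P)" for n
      using e_sum e0 by (intro sum_le_suminf) auto
    then have "K * (\<Sum>k<n. \<integral>\<omega>. e k \<omega> \<partial>P) \<le> K * (\<Sum>k. \<integral>\<omega>. e k \<omega> \<partial>P)" for n
      using K0 unfolding K_def by (intro mult_left_mono) auto
    ultimately show "(\<Sum>k<n. \<integral>\<omega>. r k \<omega> \<partial>P) \<le> (\<integral>\<omega>. V_borel 0 \<omega> \<partial>P) + K * (\<Sum>k. \<integral>\<omega>. e k \<omega> \<partial>P)" for n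
      unfolding tele by (simp add: add_mono diff_le_eq add_increasing2)
  qed
  then show ?thesis using regular
  proof eventually_elim
    case (elim \<omega>)
    have "(\<lambda>k. r k \<omega>) \<longlonglongrightarrow> 0" using elim(1) by (rule summable_LIMSEQ_zero)
    show ?case
      by (rule tendsto_sandwich[OF _ _ tendsto_const \<open>(\<lambda>k. r k \<omega>) \<longlonglongrightarrow> 0\<close>])
        (use excess_r[OF elim(2)] excess_nonneg[OF elim(2)] in auto)
  qed
qed

end

section \<open>Strong convergence\<close>

text \<open>
  Strong convexity of \<open>F\<close> controls \<open>D\<^sub>\<psi>(a, z\<^sub>k)\<close> and that of \<open>G\<close> controls \<open>D\<^sub>\<psi>(a, z\<^sub>k\<^sub>+\<^sub>1)\<close>; the
  shift does not change the limit.
\<close>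

lemma strong_convexity_convergence:
  fixes z :: "nat \<Rightarrow> 'a::real_normed_vector"
  assumes F: "extended_convex F" and G: "extended_convex G"
    and sc: "strong_convexity_assumption (edom \<phi>) F G \<phi> \<psi>"
    and dF: "gateaux_differentiable_on F (interior (edom \<phi>))"
    and z: "\<And>k. z k \<in> int_region \<phi> G"
    and u: "\<And>k. step_subgradient \<phi> (t k) F (c k) (z k) (z (Suc k)) \<in> subdiff G (z (Suc k))"
    and a: "a \<in> edom \<phi>" "a \<in> edom F" "a \<in> edom G"
    and lim: "(\<lambda>k. step_excess F G \<phi> (t k) (c k) a (z k) (z (Suc k))) \<longlonglongrightarrow> 0"
    and cons: "sequentially_consistent_on \<psi> (int_region \<phi> G)"
    and bdd: "bounded_sublevel_sets (bregman \<psi> a)"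
  shows "z \<longlonglongrightarrow> a"
proof -
  have ent: "convex_entropy \<psi>" and dom: "edom \<phi> \<subseteq> edom \<psi>"
    using sc unfolding strong_convexity_assumption_def by auto
  then have \<psi>: "extended_convex \<psi>" and d\<psi>: "gateaux_differentiable_on \<psi> (interior (edom \<psi>))"
    unfolding convex_entropy_def extended_convex_def by auto
  have int: "z k \<in> interior (edom \<phi>)" for k using z unfolding int_region_def by blast
  have zd: "z k \<in> edom \<phi>" for k using int interior_subset by blast
  have zG: "z k \<in> edom G" for k using z subdiff_edom unfolding int_region_def dom_subdiff_def by blast
  have nn: "0 \<le> breg \<psi> a (z k)" for k
    using int interior_mono[OF dom] a(1) dom by (intro breg_nonneg[OF \<psi> d\<psi>]) auto
  have to_zero: "b \<longlonglongrightarrow> 0"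
    if m: "0 < m" and b: "\<And>k. 0 \<le> b k"
      "\<And>k. m * b k \<le> step_excess F G \<phi> (t k) (c k) a (z k) (z (Suc k))" for m :: real and b :: "nat \<Rightarrow> real"
  proof (rule tendsto_sandwich[OF _ _ tendsto_const])
    show "(\<lambda>k. step_excess F G \<phi> (t k) (c k) a (z k) (z (Suc k)) / m) \<longlonglongrightarrow> 0"
      using tendsto_divide[OF lim tendsto_const[of m]] m by simp
    show "eventually (\<lambda>k. b k \<le> step_excess F G \<phi> (t k) (c k) a (z k) (z (Suc k)) / m) sequentially"
      using b(2) m by (intro always_eventually) (simp add: le_divide_eq mult.commute)
  qed (use b in auto)
  consider m where "0 < m" "relatively_strongly_convex_on m (edom \<phi> \<inter> edom G) F \<psi>"
    | m where "0 < m" "relatively_strongly_convex_on m (edom \<phi> \<inter> edom G) G \<psi>"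
    using sc unfolding strong_convexity_assumption_def by blast
  then have "(\<lambda>k. breg \<psi> a (z k)) \<longlonglongrightarrow> 0"
  proof cases
    case 1
    show ?thesis
    proof (rule to_zero[OF 1(1) nn])
      show "m * breg \<psi> a (z k) \<le> step_excess F G \<phi> (t k) (c k) a (z k) (z (Suc k))" for k
        using 1(2) by (intro step_excess_strongly_convex[OF F G sc u dF int zd zG int zd a(1,2,3,1)]) blast
    qed
  next
    case 2
    have "(\<lambda>k. breg \<psi> a (z (Suc k))) \<longlonglongrightarrow> 0"
    proof (rule to_zero[OF 2(1) nn])
      show "m * breg \<psi> a (z (Suc k)) \<le> step_excess F G \<phi> (t k) (c k) a (z k) (z (Suc k))" for k
        using 2(2) by (intro step_excess_strongly_convex[OF F G sc u dF int zd zG int zd a(1,2,3,1)]) blast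
    qed
    then show ?thesis by (rule LIMSEQ_imp_Suc)
  qed
  then show ?thesis
    using a(1) dom by (intro sequentially_consistent_convergence[OF ent cons z _ bdd]) auto
qed

context primal_dual_iteration
begin

lemma primal_convergence:
  assumes lim: "AE \<omega> in P. (\<lambda>k. excess k \<omega>) \<longlonglongrightarrow> 0"
    and sc: "strong_convexity_assumption (edom \<phi>p) f g \<phi>p \<psi>"
    and cons: "sequentially_consistent_on \<psi> (int_region \<phi>p g)"
    and bdd: "bounded_sublevel_sets (bregman \<psi> xs)"
  shows "AE \<omega> in P. (\<lambda>k. x k \<omega>) \<longlonglongrightarrow> xs"
  using regular lim
proof eventually_elim
  case (elim \<omega>)
  have "(\<lambda>k. primal_excess k \<omega>) \<longlonglongrightarrow> 0"
    by (rule tendsto_sandwich[OF _ _ tendsto_const elim(2)])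
      (use excess_parts_nonneg[OF elim(1)] in \<open>auto simp: excess_def\<close>)
  then show ?case
    using xs dom_p unfolding primal_excess_def
    by (intro strong_convexity_convergence[where z = "\<lambda>k. x k \<omega>" and t = lam
          and c = "\<lambda>k. \<delta>p k \<omega> + adjoint_map T (\<mu> k \<omega>)",
          OF extended_convex(1,2) sc diff_f regD(1)[OF elim(1)]
          step_subgradient_in_subdiff(1)[OF elim(1)] xs(1) _ xs(2) _ cons bdd]) auto
qed

lemma dual_convergence:
  assumes lim: "AE \<omega> in P. (\<lambda>k. excess k \<omega>) \<longlonglongrightarrow> 0"
    and sc: "strong_convexity_assumption (edom \<phi>d) hs ls \<phi>d \<psi>"
    and cons: "sequentially_consistent_on \<psi> (int_region \<phi>d ls)"
    and bdd: "bounded_sublevel_sets (bregman \<psi> \<mu>s)"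
  shows "AE \<omega> in P. (\<lambda>k. \<mu> k \<omega>) \<longlonglongrightarrow> \<mu>s"
  using regular lim
proof eventually_elim
  case (elim \<omega>)
  have "(\<lambda>k. dual_excess k \<omega>) \<longlonglongrightarrow> 0"
    by (rule tendsto_sandwich[OF _ _ tendsto_const elim(2)])
      (use excess_parts_nonneg[OF elim(1)] in \<open>auto simp: excess_def\<close>)
  then show ?case
    using \<mu>s dom_d unfolding dual_excess_def
    by (intro strong_convexity_convergence[where z = "\<lambda>k. \<mu> k \<omega>" and t = \<nu>
          and c = "\<lambda>k. \<delta>d k \<omega> - T (2 *\<^sub>R x (Suc k) \<omega> - x k \<omega>)",
          OF extended_convex(4,5) sc diff_hs regD(2)[OF elim(1)]
          step_subgradient_in_subdiff(2)[OF elim(1)] \<mu>s(1) _ \<mu>s(2) _ cons bdd]) auto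
qed

end

section \<open>Convergence of the algorithm\<close>

lemma argmin_is_resolvent:
  assumes \<phi>: "extended_convex \<phi>" and G: "extended_convex G" and t: "0 < t" and y: "y \<in> interior (edom \<phi>)"
    and res: "bregman_resolvent \<phi> t G \<zeta> = {z'}" and \<zeta>: "\<zeta> = grad \<phi> y - t *\<^sub>R (grad F y + c)"
    and arg: "argmin_on (edom \<phi>) J = {z}"
    and J: "\<And>w. J w = G w + ereal ((grad F y + c) w) + ereal (1 / t) * bregman \<phi> w y"
  shows "z \<in> bregman_resolvent \<phi> t G (grad \<phi> y - t *\<^sub>R (grad F y + c))" "z = z'" "z \<in> int_region \<phi> G"
proof -
  have z': "z' \<in> bregman_resolvent \<phi> t G (grad \<phi> y - t *\<^sub>R (grad F y + c))" using res \<zeta> by auto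
  have "J = (\<lambda>w. G w + ereal ((grad F y + c) w) + ereal (1 / t) * bregman \<phi> w y)" using J by blast
  then have "z' \<in> argmin_on (edom \<phi>) J" using resolvent_in_argmin[OF \<phi> G t y z'] by simp
  then show "z = z'" using arg by simp
  then show z: "z \<in> bregman_resolvent \<phi> t G (grad \<phi> y - t *\<^sub>R (grad F y + c))" using z' by simp
  show "z \<in> int_region \<phi> G"
    using resolvent_subgradient[OF z t] unfolding int_region_def dom_subdiff_def has_gateaux_gradient_def by blast
qed

theorem theorem4p12:
  fixes P :: "'w measure"
    and Cp :: "'x::banach set" and Cd :: "'y::banach set"
    and f g \<phi>p \<psi>p :: "'x \<Rightarrow> ereal" and \<phi>d \<psi>d :: "'y \<Rightarrow> ereal"
    and h l :: "'y dual \<Rightarrow> ereal"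
    and T :: "'x \<Rightarrow>\<^sub>L 'y dual"
    and lam \<nu> :: "nat \<Rightarrow> real" and laminf \<nu>inf Lp Ld :: real
    and \<delta>p :: "nat \<Rightarrow> 'w \<Rightarrow> 'x dual" and \<delta>d :: "nat \<Rightarrow> 'w \<Rightarrow> 'y dual"
    and x :: "nat \<Rightarrow> 'w \<Rightarrow> 'x" and \<mu> :: "nat \<Rightarrow> 'w \<Rightarrow> 'y"
    and F :: "nat \<Rightarrow> 'w measure"
    and xstar :: 'x and \<mu>star :: 'y
  assumes "prob_space P"
    and "F = natural_filtration P (\<lambda>k \<omega>. (x k \<omega>, \<mu> k \<omega>))"
    and "saddle_problem Cp Cd f g h l T"
    and "primal_dual_iterates P Cp Cd f g h l T \<phi>p \<phi>d lam \<nu> \<delta>p \<delta>d x \<mu>"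
    and "entropy_assumption P Cp Cd f g h l T \<phi>p \<phi>d Lp Ld lam \<nu> \<delta>p \<delta>d x \<mu>"
    and "step_assumption lam laminf" and "step_assumption \<nu> \<nu>inf"
    and "coercivity_assumption g l T \<phi>p \<phi>d Lp Ld laminf \<nu>inf"
    and "unbiased_errors P F \<delta>p" and "unbiased_errors P F \<delta>d"
    and "error_assumption P F g l T \<phi>p \<phi>d laminf \<nu>inf \<delta>p \<delta>d"
    and "strong_convexity_assumption Cp f g \<phi>p \<psi>p"
    and "sequentially_consistent_on \<psi>p (int_region \<phi>p g)"
    and "primal_solutions Cp Cd f g h l T = {xstar}"
    and "bounded_sublevel_sets (bregman \<psi>p xstar)"
  shows "(AE \<omega> in P. (\<lambda>k. x k \<omega>) \<longlonglongrightarrow> xstar) \<and>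
    (strong_convexity_assumption Cd (fenchel_conj h) (fenchel_conj l) \<phi>d \<psi>d \<and>
     dual_solutions Cp Cd f g h l T = {\<mu>star} \<and>
     sequentially_consistent_on \<psi>d (int_region \<phi>d (fenchel_conj l)) \<and>
     bounded_sublevel_sets (bregman \<psi>d \<mu>star)
     \<longrightarrow> (xstar, \<mu>star) \<in> saddle_points (lagrangian Cp Cd f g h l T) \<and>
         (AE \<omega> in P. (\<lambda>k. (x k \<omega>, \<mu> k \<omega>)) \<longlonglongrightarrow> (xstar, \<mu>star)))"
proof -
  define hs where "hs = fenchel_conj h"
  define ls where "ls = fenchel_conj l"
  note prob = assms(3) and iter = assms(4) and ent = assms(5)
  obtain xh \<mu>s where sad: "(xh, \<mu>s) \<in> saddle_points (lagrangian Cp Cd f g h l T)"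
    using prob unfolding saddle_problem_def by auto
  note sp = saddle_point_properties[OF prob sad, folded hs_def ls_def]
  note sol = saddle_point_solutions[OF sad sp(1) sp(3)]
  have xh: "xh = xstar" using sol(1) assms(14) by simp
  have dom: "edom \<phi>p = Cp" "edom \<phi>d = Cd" using ent unfolding entropy_assumption_def by auto
  have G0: "f \<in> Gamma0" "g \<in> Gamma0" "hs \<in> Gamma0" "ls \<in> Gamma0" "\<phi>p \<in> Gamma0" "\<phi>d \<in> Gamma0"
    using prob ent fenchel_conj_Gamma0 unfolding saddle_problem_def entropy_assumption_def hs_def ls_def by blast+
  have steps: "0 < lam k" "incseq lam" "lam k \<le> laminf" "0 < \<nu> k" "incseq \<nu>" "\<nu> k \<le> \<nu>inf" for k
    using assms(6,7) incseq_le unfolding step_assumption_def by blast+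
  obtain x0 \<mu>0 where start: "x0 \<in> int_region \<phi>p g" "\<mu>0 \<in> int_region \<phi>d ls"
    "\<And>\<omega>. \<omega> \<in> space P \<Longrightarrow> x 0 \<omega> = x0 \<and> \<mu> 0 \<omega> = \<mu>0"
    using iter unfolding primal_dual_iterates_def ls_def by blast
  interpret primal_dual_setting f g \<phi>p hs ls \<phi>d T Lp Ld laminf \<nu>inf xstar \<mu>s
  proof
    show "f \<in> Gamma0" "g \<in> Gamma0" "hs \<in> Gamma0" "ls \<in> Gamma0" "\<phi>p \<in> Gamma0" "\<phi>d \<in> Gamma0" by (rule G0)+
    show "edom \<phi>p \<subseteq> edom f" "edom \<phi>d \<subseteq> edom hs"
      using dom prob unfolding saddle_problem_def hs_def by auto
    show "gateaux_differentiable_on \<phi>p (interior (edom \<phi>p))" "gateaux_differentiable_on \<phi>d (interior (edom \<phi>d))"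
      "relatively_smooth Lp f \<phi>p" "relatively_smooth Ld hs \<phi>d"
      using ent unfolding entropy_assumption_def hs_def by blast+
    show "0 < laminf" "0 < \<nu>inf" using steps(1,3,4,6)[of 0] by linarith+
    show "int_region \<phi>p g \<noteq> {}" "int_region \<phi>d ls \<noteq> {}" using start by auto
    show "xstar \<in> edom \<phi>p" "xstar \<in> edom g" "\<mu>s \<in> edom \<phi>d" "\<mu>s \<in> edom ls"
      using sp(1-4) dom xh by auto
    show "fval f xstar + fval g xstar + T xstar \<mu>s \<le> fval f x + fval g x + T x \<mu>s"
      if "x \<in> edom \<phi>p" "x \<in> edom g" for x using sp(5)[of x] that dom xh by simp
    show "T xstar \<mu> - fval hs \<mu> - fval ls \<mu> \<le> T xstar \<mu>s - fval hs \<mu>s - fval ls \<mu>s"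
      if "\<mu> \<in> edom \<phi>d" "\<mu> \<in> edom ls" for \<mu> using sp(6)[of \<mu>] that dom xh by simp
    show "T (x1 - x2) (\<mu>1 - \<mu>2) \<le> (1 / laminf - Lp) * breg \<phi>p x1 x2 + (1 / \<nu>inf - Ld) * breg \<phi>d \<mu>1 \<mu>2"
      if "x1 \<in> dom_region \<phi>p g" "x2 \<in> int_region \<phi>p g" "\<mu>1 \<in> dom_region \<phi>d ls" "\<mu>2 \<in> int_region \<phi>d ls"
      for x1 x2 \<mu>1 \<mu>2
      using that G0 unfolding ls_def
      by (intro coercivity_assumptionD[OF assms(8)] Gamma0_extended_convex) auto
  qed
  define J where "J k \<omega> z = g z + ereal ((grad f (x k \<omega>) + \<delta>p k \<omega>) z) + ereal (T z (\<mu> k \<omega>))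
      + ereal (1 / lam k) * bregman \<phi>p z (x k \<omega>)" for k \<omega> z
  define J' where "J' k \<omega> z = ls z + ereal ((grad hs (\<mu> k \<omega>) + \<delta>d k \<omega>) z)
      - ereal (T (2 *\<^sub>R x (Suc k) \<omega> - x k \<omega>) z) + ereal (1 / \<nu> k) * bregman \<phi>d z (\<mu> k \<omega>)" for k \<omega> z
  have "\<forall>k. \<exists>D. countable D \<and> (AE \<omega> in P. (x k \<omega>, \<mu> k \<omega>) \<in> closure D)"
    using iter unfolding primal_dual_iterates_def random_element_def by blast
  then obtain D where D: "\<And>k. countable (D k)" "\<And>k. AE \<omega> in P. (x k \<omega>, \<mu> k \<omega>) \<in> closure (D k)" by metis
  have AE_D: "AE \<omega> in P. \<forall>k. (x k \<omega>, \<mu> k \<omega>) \<in> closure (D k)" using D(2) by (simp add: AE_all_countable)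
  have AE_iter: "AE \<omega> in P. \<forall>k. argmin_on Cp (J k \<omega>) = {x (Suc k) \<omega>} \<and> argmin_on Cd (J' k \<omega>) = {\<mu> (Suc k) \<omega>}"
    using iter unfolding primal_dual_iterates_def J_def J'_def hs_def ls_def by blast
  have AE_step: "AE \<omega> in P. \<forall>k.
        well_posed_step f g h l T \<phi>p \<phi>d (lam k) (\<nu> k) (x k \<omega>) (\<mu> k \<omega>) (\<delta>p k \<omega>) (\<delta>d k \<omega>) \<and>
        well_posed_step f g h l T \<phi>p \<phi>d (lam k) (\<nu> k) (x k \<omega>) (\<mu> k \<omega>) 0 0"
    using ent unfolding entropy_assumption_def by blast
  have pe: "primal_eval_point f T \<phi>p t a b e = grad \<phi>p a - t *\<^sub>R (grad f a + (e + adjoint_map T b))" for t a b e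
    unfolding primal_eval_point_def by (simp add: add.assoc)
  have de: "dual_eval_point h T \<phi>d t a a' b e = grad \<phi>d b - t *\<^sub>R (grad hs b + (e - T (2 *\<^sub>R a' - a)))" for t a a' b e
    unfolding dual_eval_point_def hs_def by (simp add: add_diff_eq)
  have regular: "AE \<omega> in P. regular_path lam \<nu> D (\<lambda>k. \<delta>p k \<omega>) (\<lambda>k. \<delta>d k \<omega>) (\<lambda>k. x k \<omega>) (\<lambda>k. \<mu> k \<omega>)"
    using AE_space AE_D AE_iter AE_step
  proof eventually_elim
    case (elim \<omega>)
    have step: "primal_step (lam k) (x k \<omega>) (\<mu> k \<omega>) (\<delta>p k \<omega>) (x (Suc k) \<omega>) \<and>
         x (Suc k) \<omega> \<in> int_region \<phi>p g \<and>
         dual_step (\<nu> k) (x k \<omega>) (x (Suc k) \<omega>) (\<mu> k \<omega>) (\<delta>d k \<omega>) (\<mu> (Suc k) \<omega>) \<and>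
         \<mu> (Suc k) \<omega> \<in> int_region \<phi>d ls"
      if U: "x k \<omega> \<in> int_region \<phi>p g" "\<mu> k \<omega> \<in> int_region \<phi>d ls" for k
    proof -
      obtain x' \<mu>' where r: "bregman_resolvent \<phi>p (lam k) g (primal_eval_point f T \<phi>p (lam k) (x k \<omega>) (\<mu> k \<omega>) (\<delta>p k \<omega>)) = {x'}"
        "bregman_resolvent \<phi>d (\<nu> k) ls (dual_eval_point h T \<phi>d (\<nu> k) (x k \<omega>) x' (\<mu> k \<omega>) (\<delta>d k \<omega>)) = {\<mu>'}"
        using elim(4) unfolding well_posed_step_def ls_def by blast
      have a: "argmin_on (edom \<phi>p) (J k \<omega>) = {x (Suc k) \<omega>}" "argmin_on (edom \<phi>d) (J' k \<omega>) = {\<mu> (Suc k) \<omega>}"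
        using elim(3) dom by auto
      have J: "J k \<omega> z = g z + ereal ((grad f (x k \<omega>) + (\<delta>p k \<omega> + adjoint_map T (\<mu> k \<omega>))) z)
             + ereal (1 / lam k) * bregman \<phi>p z (x k \<omega>)" for z
        unfolding J_def by (cases "g z") (simp_all add: blinfun.add_left add.assoc)
      have J': "J' k \<omega> z = ls z + ereal ((grad hs (\<mu> k \<omega>) + (\<delta>d k \<omega> - T (2 *\<^sub>R x (Suc k) \<omega> - x k \<omega>))) z)
             + ereal (1 / \<nu> k) * bregman \<phi>d z (\<mu> k \<omega>)" for z
        unfolding J'_def by (cases "ls z") (simp_all add: blinfun.add_left blinfun.diff_left add_diff_eq)
      note p = argmin_is_resolvent[OF extended_convex(3,2) steps(1) int_region_interior(1)[OF U(1)] r(1) pe a(1) J]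
      \<comment> \<open>The dual evaluation point contains the resolvent point \<open>x'\<close>, which is the new primal iterate by \<open>p(2)\<close>.\<close>
      note d = argmin_is_resolvent[OF extended_convex(6,5) steps(4) int_region_interior(2)[OF U(2)]
          r(2)[folded p(2)] de a(2) J']
      show ?thesis unfolding primal_step_def dual_step_def using p(1,3) d(1,3) by blast
    qed
    have U: "x k \<omega> \<in> int_region \<phi>p g \<and> \<mu> k \<omega> \<in> int_region \<phi>d ls" for k
    proof (induction k)
      case 0 then show ?case using start elim(1) by simp
    next
      case (Suc k) then show ?case using step by blast
    qed
    have free: "\<exists>x' \<mu>'. primal_step (lam k) (x k \<omega>) (\<mu> k \<omega>) 0 x' \<and> dual_step (\<nu> k) (x k \<omega>) x' (\<mu> k \<omega>) 0 \<mu>'" for k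
    proof -
      have "well_posed_step f g h l T \<phi>p \<phi>d (lam k) (\<nu> k) (x k \<omega>) (\<mu> k \<omega>) 0 0" using elim(4) by blast
      then show ?thesis
        unfolding well_posed_step_def pe de ls_def[symmetric] primal_step_def dual_step_def by blast
    qed
    show ?case unfolding regular_path_def using U step elim(2) free by blast
  qed
  interpret primal_dual_iteration f g \<phi>p hs ls \<phi>d T Lp Ld laminf \<nu>inf xstar \<mu>s P lam \<nu> \<delta>p \<delta>d x \<mu> D x0 \<mu>0
  proof (intro primal_dual_iteration.intro primal_dual_iteration_axioms.intro)
    show "primal_dual_setting f g \<phi>p hs ls \<phi>d T Lp Ld laminf \<nu>inf xstar \<mu>s" by (rule primal_dual_setting_axioms)
    show "prob_space P" by (rule assms(1))
    show "reflexive_space TYPE('x)" "reflexive_space TYPE('y)" using prob unfolding saddle_problem_def by auto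
    show "\<delta>p k \<in> borel_measurable P" "\<delta>d k \<in> borel_measurable P" "(\<lambda>\<omega>. (x k \<omega>, \<mu> k \<omega>)) \<in> borel_measurable P" for k
      using iter unfolding primal_dual_iterates_def random_element_def by blast+
  qed (use steps D(1) start(3) regular in auto)
  have lim: "AE \<omega> in P. (\<lambda>k. excess k \<omega>) \<longlonglongrightarrow> 0"
  proof -
    consider "AE \<omega> in P. \<forall>k. \<delta>p k \<omega> = 0 \<and> \<delta>d k \<omega> = 0"
      | "summable_moments P F 1 \<delta>p" "summable_moments P F 1 \<delta>d" "bounded (int_region \<phi>p g)" "bounded (int_region \<phi>d ls)"
      | \<sigma>p \<sigma>d where "0 < \<sigma>p" "0 < \<sigma>d" "\<And>z y. ereal (\<sigma>p / 2 * (norm (z - y))\<^sup>2) \<le> bregman \<phi>p z y"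
          "\<And>z y. ereal (\<sigma>d / 2 * (norm (z - y))\<^sup>2) \<le> bregman \<phi>d z y" "\<nu>inf * laminf * (norm T)\<^sup>2 < \<sigma>p * \<sigma>d"
          "summable_moments P F 2 \<delta>p" "summable_moments P F 2 \<delta>d"
      using assms(11) unfolding error_assumption_def ls_def by blast
    then show ?thesis
    proof cases
      case 1 then show ?thesis by (rule excess_tendsto_zero_exact)
    next
      case 2 then show ?thesis by (rule excess_tendsto_zero_bounded)
    next
      case 3
      then show ?thesis
        using assms(9,10) unfolding assms(2) by (intro excess_tendsto_zero_strongly_convex[of \<sigma>p \<sigma>d]) auto
    qed
  qed
  have px: "AE \<omega> in P. (\<lambda>k. x k \<omega>) \<longlonglongrightarrow> xstar"
    using primal_convergence[OF lim _ assms(13,15)] assms(12) dom by simp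
  show ?thesis
  proof (intro conjI impI px)
    assume dual: "strong_convexity_assumption Cd (fenchel_conj h) (fenchel_conj l) \<phi>d \<psi>d \<and>
     dual_solutions Cp Cd f g h l T = {\<mu>star} \<and>
     sequentially_consistent_on \<psi>d (int_region \<phi>d (fenchel_conj l)) \<and>
     bounded_sublevel_sets (bregman \<psi>d \<mu>star)"
    then have \<mu>s: "\<mu>s = \<mu>star" using sol(2) by simp
    then show "(xstar, \<mu>star) \<in> saddle_points (lagrangian Cp Cd f g h l T)" using sad xh by simp
    have "AE \<omega> in P. (\<lambda>k. \<mu> k \<omega>) \<longlonglongrightarrow> \<mu>s"
      using dual dom \<mu>s unfolding hs_def[symmetric] ls_def[symmetric]
      by (intro dual_convergence[OF lim, of \<psi>d]) auto
    with px show "AE \<omega> in P. (\<lambda>k. (x k \<omega>, \<mu> k \<omega>)) \<longlonglongrightarrow> (xstar, \<mu>star)"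
    proof eventually_elim
      case (elim \<omega>)
      show ?case using tendsto_Pair[OF elim] \<mu>s by simp
    qed
  qed
qed

end
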